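(* Let $n > 1$ be an integer and let $\lambda < 0$ be a real number. Then there exists a closed, embedded $\lambda$-hypersurface $\Sigma^{2n+1} \subset \mathbb{R}^{2n+2}$ that is diffeomorphic to $\mathbb{S}^n \times \mathbb{S}^n \times \mathbb{S}^1$ and is invariant under the action of $O(n+1) \times O(n+1)$ on $\mathbb{R}^{2n+2} = \mathbb{R}^{n+1} \times \mathbb{R}^{n+1}$.
   Context: For a real constant $\lambda$, a $\lambda$-hypersurface $\Sigma \subset \mathbb{R}^{N+1}$ is a smooth hypersurface which, for some choice of smooth unit normal field $\nu$, satisfies $$H = \tfrac12 \langle x, \nu\rangle + \lambda$$ at every point, where $x$ is the position vector and $H$ is the mean curvature (the sum of the principal curvatures), with sign convention $\vec{H} = -H\nu$, $\vec H$ being the mean curvature vector. "Closed" means compact without boundary. The group $O(n+1)\times O(n+1)$ acts on $\mathbb{R}^{n+1}\times\mathbb{R}^{n+1}$ by $(A,B)\cdot(\vec x,\vec y) = (A\vec x, B\vec y)$; $\Sigma$ is invariant if this action maps $\Sigma$ to itself. *)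

theory Defs
  imports "HOL-Analysis.Analysis"
begin

(* Meaningful for open U: partial derivatives up to order k exist and are continuous. *)
fun Ck_on :: "nat \<Rightarrow> 'a::euclidean_space set \<Rightarrow> ('a \<Rightarrow> 'b::euclidean_space) \<Rightarrow> bool" where
  "Ck_on 0 U f \<longleftrightarrow> continuous_on U f"
| "Ck_on (Suc k) U f \<longleftrightarrow>
     (\<forall>x\<in>U. f differentiable (at x)) \<and>
     (\<forall>v. Ck_on k U (\<lambda>x. frechet_derivative f (at x) v))"

definition smooth_on :: "'a::euclidean_space set \<Rightarrow> ('a \<Rightarrow> 'b::euclidean_space) \<Rightarrow> bool" where
  "smooth_on U f \<longleftrightarrow> (\<forall>k. Ck_on k U f)"

(* Smoothness on an arbitrary subset S (in practice a submanifold): f extends locally to a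
   smooth map on an open subset of the ambient space. *)
definition smooth_map_on :: "'a::euclidean_space set \<Rightarrow> ('a \<Rightarrow> 'b::euclidean_space) \<Rightarrow> bool" where
  "smooth_map_on S f \<longleftrightarrow>
     (\<forall>p\<in>S. \<exists>U g. open U \<and> p \<in> U \<and> smooth_on U g \<and> (\<forall>x\<in>U \<inter> S. g x = f x))"

definition diffeomorphism ::
  "'a::euclidean_space set \<Rightarrow> 'b::euclidean_space set \<Rightarrow> ('a \<Rightarrow> 'b) \<Rightarrow> ('b \<Rightarrow> 'a) \<Rightarrow> bool" where
  "diffeomorphism S T f g \<longleftrightarrow>
     homeomorphism S T f g \<and> smooth_map_on S f \<and> smooth_map_on T g"

definition diffeomorphic :: "'a::euclidean_space set \<Rightarrow> 'b::euclidean_space set \<Rightarrow> bool" where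
  "diffeomorphic S T \<longleftrightarrow> (\<exists>f g. diffeomorphism S T f g)"

(* Embedded submanifold of codimension one, given by slice charts.  The slices are full
   relatively open pieces of a hyperplane, so there is no boundary. *)
definition smooth_hypersurface :: "'a::euclidean_space set \<Rightarrow> bool" where
  "smooth_hypersurface S \<longleftrightarrow>
     (\<forall>p\<in>S. \<exists>U V \<phi> \<psi>. \<exists>b\<in>(Basis :: 'a set).
        open U \<and> open V \<and> p \<in> U \<and> diffeomorphism U V \<phi> \<psi> \<and>
        \<phi> ` (U \<inter> S) = {y \<in> V. y \<bullet> b = 0})"

definition tangent_space :: "'a::euclidean_space set \<Rightarrow> 'a \<Rightarrow> 'a set" where
  "tangent_space S p =
     {v. \<exists>\<gamma> \<epsilon>. \<epsilon> > 0 \<and> smooth_on {-\<epsilon><..<\<epsilon>} \<gamma> \<and> \<gamma> ` {-\<epsilon><..<\<epsilon>} \<subseteq> S \<and>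
               \<gamma> (0::real) = p \<and> (\<gamma> has_vector_derivative v) (at 0)}"

definition unit_normal_field :: "'a::euclidean_space set \<Rightarrow> ('a \<Rightarrow> 'a) \<Rightarrow> bool" where
  "unit_normal_field S \<nu> \<longleftrightarrow>
     smooth_map_on S \<nu> \<and>
     (\<forall>p\<in>S. norm (\<nu> p) = 1 \<and> (\<forall>v\<in>tangent_space S p. \<nu> p \<bullet> v = 0))"

(* The shape operator is v |-> d\<nu>(v) on tangent vectors.  The derivative within S is not
   unique as a linear map of the ambient space, but its values on tangent vectors are.
   Sign: with shape operator +d\<nu> the mean curvature vector is -H \<nu>; thus a round sphere
   with outward normal has H > 0. *)
definition principal_space ::
  "'a::euclidean_space set \<Rightarrow> ('a \<Rightarrow> 'a) \<Rightarrow> 'a \<Rightarrow> real \<Rightarrow> 'a set" where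
  "principal_space S \<nu> p \<kappa> =
     {v \<in> tangent_space S p. frechet_derivative \<nu> (at p within S) v = \<kappa> *\<^sub>R v}"

definition principal_curvatures ::
  "'a::euclidean_space set \<Rightarrow> ('a \<Rightarrow> 'a) \<Rightarrow> 'a \<Rightarrow> real set" where
  "principal_curvatures S \<nu> p = {\<kappa>. \<exists>v\<in>principal_space S \<nu> p \<kappa>. v \<noteq> 0}"

(* Sum of the principal curvatures, counted with multiplicity (not their average). *)
definition mean_curvature ::
  "'a::euclidean_space set \<Rightarrow> ('a \<Rightarrow> 'a) \<Rightarrow> 'a \<Rightarrow> real" where
  "mean_curvature S \<nu> p =
     (\<Sum>\<kappa>\<in>principal_curvatures S \<nu> p. real (dim (principal_space S \<nu> p \<kappa>)) * \<kappa>)"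

definition lambda_hypersurface :: "real \<Rightarrow> 'a::euclidean_space set \<Rightarrow> bool" where
  "lambda_hypersurface c S \<longleftrightarrow>
     smooth_hypersurface S \<and>
     (\<exists>\<nu>. unit_normal_field S \<nu> \<and>
          (\<forall>x\<in>S. mean_curvature S \<nu> x = (1/2) * (x \<bullet> \<nu> x) + c))"

definition bi_orthogonal_invariant :: "((real^'n) \<times> (real^'n)) set \<Rightarrow> bool" where
  "bi_orthogonal_invariant S \<longleftrightarrow>
     (\<forall>A B :: real^'n^'n. orthogonal_matrix A \<and> orthogonal_matrix B \<longrightarrow>
        (\<lambda>(x, y). (A *v x, B *v y)) ` S = S)"

end

(* The hypersurface is {(X, Y). (|X|, |Y|) in C} for a closed embedded curve C in the open
   quadrant, for which the curvature equation becomes an ordinary differential equation. C is found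
   by shooting from the diagonal point (b, b), perpendicularly to the diagonal. For large b the
   trajectory returns to the diagonal while its distance to the origin is still strictly decreasing.
   Lower b to the infimum of the values above which this persists. The limiting trajectory must still
   return: it can neither collapse to the origin, nor stay outside the radius of the round sphere
   solution forever, nor escape along the axis inside that radius. At its first return the distance
   has vanishing derivative, since a transversal crossing would be stable under perturbation of b;
   the curve thus meets the diagonal perpendicularly, and reflection in the diagonal closes it up.
   Monotonicity of the distance along the half arc makes it embedded.
   The principal curvatures of the hypersurface are the curvature of C once, cos p / |X| with
   multiplicity n and sin p / |Y| with multiplicity n, where (cos p, sin p) is the normal of C. *)
theory Submission
  imports Defs
begin

section \<open>Lipschitz differential equations\<close>

text \<open>The limit \<open>b\<close> of crossing values need not inherit a crossing: the return
  times may tend to infinity while the trajectories run along the axis. \<open>neck\<close> is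
  therefore uniform over all trajectories, and is applied not to the limit but to the crossing
  trajectories for slightly larger \<open>b\<close>, which follow the limit into the thin region
  near the axis and then could no longer return with \<open>q < 0\<close>. The control comes from
  two first variation identities for the weight \<open>w\<close>: \<open>w q\<close> is the flux of
  the dilation field, \<open>w (cos p + sin p)\<close> that of the field \<open>(-1, 1)\<close>. The
  rate of \<open>w q\<close> is a positive multiple of \<open>2 n + 1 - rho^2 / 2 - c h\<close>,
  with \<open>rho\<close> the distance to the origin; it vanishes on the sphere solution, where
  \<open>h = rho = RS\<close>. Here the sign of \<open>c\<close> decides: a curve moving away from
  the axis \<open>x = 0\<close> has \<open>sin p <= 0\<close>, so \<open>h <= x\<close> is small and
  inside radius \<open>RS\<close> the rate is about \<open>c RS\<close> or more, which pushes
  \<open>w q\<close> above zero before the diagonal is reached. For \<open>c = 0\<close> the rate at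
  radius \<open>RS\<close> would vanish for either orientation. The flow behind the shooting is that
  of a clamped field; a trajectory with \<open>q <= 0\<close> does not feel the clamp.\<close>

lemma exp_mult_le:
  fixes L t :: real
  assumes "L > 0" "t \<ge> 0"
  shows "exp (-(2*L*t)) * t \<le> 1 / (2*L)"
proof -
  have "2*L*t \<le> exp (2*L*t)"
    using exp_ge_add_one_self[of "2*L*t"] by linarith
  then have "exp (-(2*L*t)) * (2*L*t) \<le> exp (-(2*L*t)) * exp (2*L*t)"
    by (intro mult_left_mono) auto
  also have "\<dots> = 1" by (simp add: exp_minus)
  finally show ?thesis using assms by (simp add: field_simps)
qed

text \<open>Picard iteration in an exponentially weighted sup norm: with
  \<open>u = u0 + exp (2 L t) z\<close> the integral operator contracts bounded continuous
  \<open>z\<close> by the factor 1/2 on the whole half line, which gives a global solution at once.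
  The bound on \<open>G\<close> keeps the image of the operator bounded.\<close>

lemma ode_forward_exists:
  fixes G :: "'a::euclidean_space \<Rightarrow> 'a"
  assumes lip: "\<And>x y. norm (G x - G y) \<le> L * norm (x - y)" and L: "L > 0"
    and bdd: "\<And>x. norm (G x) \<le> B"
  shows "\<exists>u. u 0 = u0 \<and> (\<forall>t\<ge>0. (u has_vector_derivative G (u t)) (at t within {0..}))"
proof -
  have contG: "continuous_on S (\<lambda>s. G (f s))" if "continuous_on S f" for f :: "real \<Rightarrow> 'a" and S
  proof -
    have "continuous_on UNIV G"
      by (rule lipschitz_on_continuous_on[of L], rule lipschitz_onI)
        (use lip L in \<open>auto simp: dist_norm\<close>)
    then show ?thesis
      using continuous_on_compose2 that by blast
  qed
  define g where "g z = (\<lambda>s. G (u0 + exp (2*L* s) *\<^sub>R apply_bcontfun z s))" for z :: "(real, 'a) bcontfun"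
  \<comment> \<open>Elements of \<open>bcontfun\<close> are defined on all of \<open>real\<close>;
    \<open>max 0 t\<close> freezes the operator at negative times, whose values are discarded
    later.\<close>
  define F where "F z = (\<lambda>t. exp (-(2*L*max 0 t)) *\<^sub>R integral {0..max 0 t} (g z))" for z :: "(real, 'a) bcontfun"
  have contg: "continuous_on S (g z)" for z S
    unfolding g_def by (intro contG continuous_intros continuous_on_apply_bcontfun)
  have intg: "g z integrable_on {0..t}" for z t
    by (rule integrable_continuous_real, rule contg)
  have deriv: "((\<lambda>t. integral {0..t} (g z)) has_vector_derivative g z t) (at t within {0..T})"
    if "t \<in> {0..T}" for z t T
    by (rule integral_has_vector_derivative[OF contg that])
  have contI: "continuous_on {0..T} (\<lambda>t. integral {0..t} (g z))" for z T
    using deriv has_vector_derivative_continuous continuous_on_eq_continuous_within by blast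
  have contI': "continuous_on {0..} (\<lambda>t. integral {0..t} (g z))" for z
  proof -
    have "continuous (at t within {0..}) (\<lambda>t. integral {0..t} (g z))" if "t \<ge> 0" for t
    proof -
      have "continuous (at t within {0..t+1}) (\<lambda>t. integral {0..t} (g z))"
        using contI[of "t+1" z] that by (auto simp: continuous_on_eq_continuous_within)
      moreover have "at t within {0..t+1} = at t within {0..}"
        by (rule at_within_nhd[of _ "{..<t+1}"]) auto
      ultimately show ?thesis by simp
    qed
    then show ?thesis by (auto simp: continuous_on_eq_continuous_within)
  qed
  have contF: "continuous_on UNIV (F z)" for z
    unfolding F_def
    by (intro continuous_intros continuous_on_compose2[OF contI'[of z]]) auto
  have nI: "norm (integral {0..t} (g z)) \<le> B * t" if "t \<ge> 0" for z t
  proof -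
    have "norm (integral {0..t} (g z)) \<le> integral {0..t} (\<lambda>_. B)"
      by (rule integral_norm_bound_integral[OF intg]) (auto simp: g_def bdd)
    then show ?thesis using that by (simp add: mult.commute)
  qed
  have B0: "B \<ge> 0" using order_trans[OF norm_ge_zero bdd] .
  have Fb: "norm (F z t) \<le> B / (2*L)" for z t
  proof -
    let ?t = "max 0 t"
    have "norm (F z t) \<le> exp (-(2*L*?t)) * (B * ?t)"
      unfolding F_def using nI[of ?t z] by (simp add: mult_left_mono)
    also have "\<dots> = B * (exp (-(2*L*?t)) * ?t)" by simp
    also have "\<dots> \<le> B * (1 / (2*L))"
      by (intro mult_left_mono exp_mult_le L B0) auto
    finally show ?thesis by simp
  qed
  have Fbc: "F z \<in> bcontfun" for z :: "(real, 'a) bcontfun"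
    by (rule bcontfun_normI[OF contF Fb])
  define FF where "FF z = Bcontfun (F z)" for z
  have app: "apply_bcontfun (FF z) = F z" for z
    unfolding FF_def by (simp add: Bcontfun_inverse Fbc)
  have contr: "dist (FF z) (FF w) \<le> (1/2) * dist z w" for z w
  proof (rule dist_bound)
    fix t :: real
    let ?t = "max 0 t" and ?D = "dist z w"
    have pt: "norm (g z s - g w s) \<le> L * ?D * exp (2*L* s)" for s
    proof -
      have "norm (g z s - g w s) \<le> L * norm (exp (2*L* s) *\<^sub>R (apply_bcontfun z s - apply_bcontfun w s))"
        unfolding g_def using lip[of "u0 + exp (2*L* s) *\<^sub>R apply_bcontfun z s" "u0 + exp (2*L* s) *\<^sub>R apply_bcontfun w s"]
        by (simp add: algebra_simps)
      also have "\<dots> = L * (exp (2*L* s) * dist (apply_bcontfun z s) (apply_bcontfun w s))"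
        by (simp add: dist_norm)
      also have "\<dots> \<le> L * (exp (2*L* s) * ?D)"
        using L by (intro mult_left_mono dist_bounded) auto
      finally show ?thesis by (simp add: algebra_simps)
    qed
    have ftc: "((\<lambda>s. L * ?D * exp (2*L* s)) has_integral (?D/2 * exp (2*L*?t) - ?D/2 * exp (2*L*0))) {0..?t}"
      by (rule fundamental_theorem_of_calculus)
        (use L in \<open>auto intro!: derivative_eq_intros simp: has_real_derivative_iff_has_vector_derivative[symmetric]\<close>)
    have "norm (integral {0..?t} (g z) - integral {0..?t} (g w)) = norm (integral {0..?t} (\<lambda>s. g z s - g w s))"
      by (simp add: integral_diff[OF intg intg])
    also have "\<dots> \<le> integral {0..?t} (\<lambda>s. L * ?D * exp (2*L* s))"
      by (rule integral_norm_bound_integral) (auto intro!: integrable_diff intg pt has_integral_integrable[OF ftc])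
    also have "\<dots> = ?D/2 * exp (2*L*?t) - ?D/2 * exp (2*L*0)"
      by (rule integral_unique[OF ftc])
    also have "\<dots> \<le> ?D/2 * exp (2*L*?t)" by simp
    finally have "norm (integral {0..?t} (g z) - integral {0..?t} (g w)) \<le> ?D/2 * exp (2*L*?t)" .
    then have "exp (-(2*L*?t)) * norm (integral {0..?t} (g z) - integral {0..?t} (g w))
        \<le> exp (-(2*L*?t)) * (?D/2 * exp (2*L*?t))"
      by (intro mult_left_mono) auto
    also have "\<dots> = ?D / 2" by (simp add: exp_minus)
    finally show "dist (apply_bcontfun (FF z) t) (apply_bcontfun (FF w) t) \<le> (1/2) * ?D"
      unfolding app F_def dist_norm by (simp flip: scaleR_diff_right)
  qed
  have "\<exists>!z. FF z = z"
    by (rule banach_fix_type[of "1/2"]) (use contr in auto)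
  then obtain z where z: "FF z = z" by blast
  define u where "u t = u0 + exp (2*L*t) *\<^sub>R apply_bcontfun z t" for t
  have ueq: "u t = u0 + integral {0..t} (g z)" if "t \<ge> 0" for t
  proof -
    have "apply_bcontfun z t = F z t" using app[of z] z by simp
    also have "\<dots> = exp (-(2*L*t)) *\<^sub>R integral {0..t} (g z)"
      using that by (simp add: F_def max_def)
    finally show ?thesis by (simp add: u_def exp_minus)
  qed
  have gz: "g z = (\<lambda>s. G (u s))" by (simp add: g_def u_def)
  have "(u has_vector_derivative G (u t)) (at t within {0..})" if "t \<ge> 0" for t
  proof -
    have "((\<lambda>t. u0 + integral {0..t} (g z)) has_vector_derivative g z t) (at t within {0..t+1})"
      using deriv[of t "t+1" z] that by (auto intro!: derivative_eq_intros)
    then have "(u has_vector_derivative g z t) (at t within {0..t+1})"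
      by (rule has_vector_derivative_transform[rotated 2]) (use that ueq in auto)
    moreover have "at t within {0..t+1} = at t within {0..}"
      by (rule at_within_nhd[of _ "{..<t+1}"]) auto
    ultimately show ?thesis by (simp add: gz)
  qed
  moreover have "u 0 = u0" using ueq[of 0] by simp
  ultimately show ?thesis by blast
qed

text \<open>The past is a forward solution for the reversed field \<open>- G\<close>; the one-sided
  derivatives of the two halves agree at 0.\<close>

lemma ode_global_exists:
  fixes G :: "'a::euclidean_space \<Rightarrow> 'a"
  assumes lip: "\<And>x y. norm (G x - G y) \<le> L * norm (x - y)" and L: "L > 0"
    and bdd: "\<And>x. norm (G x) \<le> B"
  shows "\<exists>u. u 0 = u0 \<and> (\<forall>t. (u has_vector_derivative G (u t)) (at t))"
proof -
  obtain u where u0: "u 0 = u0" and u: "\<And>t. t \<ge> 0 \<Longrightarrow> (u has_vector_derivative G (u t)) (at t within {0..})"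
    using ode_forward_exists[of G L B u0] lip L bdd by blast
  obtain v where v0: "v 0 = u0" and v: "\<And>t. t \<ge> 0 \<Longrightarrow> (v has_vector_derivative - G (v t)) (at t within {0..})"
  proof -
    have "norm (- G x - - G y) \<le> L * norm (x - y)" for x y
      using lip[of y x] by (simp add: norm_minus_commute)
    then show ?thesis
      using ode_forward_exists[of "\<lambda>x. - G x" L B u0] L bdd that by auto
  qed
  define w where "w t = (if t \<ge> 0 then u t else v (-t))" for t
  have 1: "(w has_vector_derivative G (w t)) (at t within {0..})" if "t \<ge> 0" for t
    by (rule has_vector_derivative_transform[of _ _ w u]) (use that u[of t] in \<open>auto simp: w_def\<close>)
  have 2: "(w has_vector_derivative G (w t)) (at t within {..0})" if "t \<le> 0" for t
  proof -
    have "((\<lambda>t. v (- t)) has_vector_derivative (-1) *\<^sub>R (- G (v (-t)))) (at t within {..0})"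
    proof -
      have "(v has_vector_derivative - G (v (-t))) (at (-t) within uminus ` {..0})"
        by (rule has_vector_derivative_within_subset[OF v]) (use that in auto)
      then show ?thesis
        using vector_diff_chain_within[of uminus "-1" t "{..0}" v "- G (v (-t))"]
          has_vector_derivative_minus[OF has_vector_derivative_id]
        by (simp add: o_def)
    qed
    then have "((\<lambda>t. v (- t)) has_vector_derivative G (v (-t))) (at t within {..0})" by simp
    moreover have "G (v (-t)) = G (w t)" using that u0 v0 by (auto simp: w_def)
    ultimately have "((\<lambda>t. v (- t)) has_vector_derivative G (w t)) (at t within {..0})" by simp
    then show ?thesis
      by (rule has_vector_derivative_transform[rotated 2]) (use that u0 v0 in \<open>auto simp: w_def\<close>)
  qed
  have "(w has_vector_derivative G (w t)) (at t)" for t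
  proof (cases t "0::real" rule: linorder_cases)
    case less
    have "at t within {..0} = at t" by (rule at_within_interior) (use less in simp)
    then show ?thesis using 2[of t] less by simp
  next
    case greater
    have "at t within {0..} = at t" by (rule at_within_interior) (use greater in simp)
    then show ?thesis using 1[of t] greater by simp
  next
    case equal
    have "(w has_vector_derivative G (w 0)) (at 0 within {..0} \<union> {0..})"
      using 1[of 0] 2[of 0] unfolding has_vector_derivative_def has_derivative_within
      by (auto intro: Lim_Un)
    moreover have "{..0::real} \<union> {0..} = UNIV" by auto
    ultimately show ?thesis by (simp add: equal)
  qed
  moreover have "w 0 = u0" by (simp add: w_def u0)
  ultimately show ?thesis by blast
qed

section \<open>Monotonicity from derivatives, Gronwall estimates, dependence on initial
  values\<close>

lemma DERIV_nonneg_mono: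
  fixes f :: "real \<Rightarrow> real"
  assumes "a \<le> b" "\<And>t. a \<le> t \<Longrightarrow> t \<le> b \<Longrightarrow> (f has_real_derivative f' t) (at t)"
    "\<And>t. a < t \<Longrightarrow> t < b \<Longrightarrow> f' t \<ge> 0"
  shows "f a \<le> f b"
proof (cases "a = b")
  case False
  then obtain z where "a < z" "z < b" "f b - f a = (b - a) * f' z"
    using MVT2[of a b f f'] assms by (metis order_le_less)
  moreover have "0 \<le> (b - a) * f' z" using assms(1) assms(3)[of z] \<open>a < z\<close> \<open>z < b\<close> by simp
  ultimately show ?thesis by linarith
qed simp

lemma DERIV_pos_strict_mono:
  fixes f :: "real \<Rightarrow> real"
  assumes "a < b" "\<And>t. a \<le> t \<Longrightarrow> t \<le> b \<Longrightarrow> (f has_real_derivative f' t) (at t)"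
    "\<And>t. a < t \<Longrightarrow> t < b \<Longrightarrow> f' t > 0"
  shows "f a < f b"
proof -
  obtain z where "a < z" "z < b" "f b - f a = (b - a) * f' z"
    using MVT2[of a b f f'] assms by metis
  moreover have "0 < (b - a) * f' z" using assms(1) assms(3)[of z] \<open>a < z\<close> \<open>z < b\<close> by simp
  ultimately show ?thesis by linarith
qed

text \<open>The product of \<open>norm (e t)^2\<close> and \<open>exp (- 2 L t)\<close> is
  nonincreasing. Squaring avoids differentiating the norm where \<open>e\<close> vanishes.\<close>

lemma gronwall_forward:
  fixes e :: "real \<Rightarrow> 'a::real_inner"
  assumes "a \<le> b" "\<And>t. a \<le> t \<Longrightarrow> t \<le> b \<Longrightarrow> (e has_vector_derivative e' t) (at t)"
    and "\<And>t. a \<le> t \<Longrightarrow> t \<le> b \<Longrightarrow> norm (e' t) \<le> L * norm (e t)"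
  shows "norm (e b) \<le> norm (e a) * exp (L * (b - a))"
proof -
  define f where "f t = - (e t \<bullet> e t) * exp (- 2 * L * t)" for t
  have d: "(f has_real_derivative (2 * L * (e t \<bullet> e t) - 2 * (e t \<bullet> e' t)) * exp (- 2 * L * t)) (at t)"
    if "a \<le> t" "t \<le> b" for t
  proof -
    have "((\<lambda>t. e t \<bullet> e t) has_real_derivative (e t \<bullet> e' t + e' t \<bullet> e t)) (at t)"
      unfolding has_real_derivative_iff_has_vector_derivative
      by (rule bounded_bilinear.has_vector_derivative[OF bounded_bilinear_inner]) (use assms(2) that in auto)
    then show ?thesis unfolding f_def
      by (auto intro!: derivative_eq_intros simp: algebra_simps inner_commute)
  qed
  have "f a \<le> f b"
  proof (rule DERIV_nonneg_mono[OF assms(1) d])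
    fix t assume t: "a < t" "t < b"
    have "e t \<bullet> e' t \<le> norm (e t) * norm (e' t)" by (rule norm_cauchy_schwarz)
    also have "\<dots> \<le> norm (e t) * (L * norm (e t))" using assms(3)[of t] t by (intro mult_left_mono) auto
    also have "\<dots> = L * (e t \<bullet> e t)" by (simp add: dot_square_norm power2_eq_square)
    finally show "0 \<le> (2 * L * (e t \<bullet> e t) - 2 * (e t \<bullet> e' t)) * exp (- 2 * L * t)" by simp
  qed auto
  then have "(norm (e b))\<^sup>2 * exp (-2*L*b) \<le> (norm (e a))\<^sup>2 * exp (-2*L*a)"
    by (simp add: f_def dot_square_norm)
  then have "(norm (e b))\<^sup>2 * exp (-2*L*b) * exp (2*L*b) \<le> (norm (e a))\<^sup>2 * exp (-2*L*a) * exp (2*L*b)"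
    by (intro mult_right_mono) auto
  then have "(norm (e b))\<^sup>2 \<le> (norm (e a))\<^sup>2 * exp (2*L*b - 2*L*a)"
    by (simp add: exp_minus exp_diff field_simps)
  also have "\<dots> = (norm (e a) * exp (L * (b - a)))\<^sup>2"
    by (simp add: power_mult_distrib algebra_simps flip: exp_double)
  finally show ?thesis by (rule power2_le_imp_le) simp
qed

lemma gronwall:
  fixes e :: "real \<Rightarrow> 'a::real_inner"
  assumes d: "\<And>t. t \<in> closed_segment a b \<Longrightarrow> (e has_vector_derivative e' t) (at t)"
    and n: "\<And>t. t \<in> closed_segment a b \<Longrightarrow> norm (e' t) \<le> L * norm (e t)"
  shows "norm (e b) \<le> norm (e a) * exp (L * \<bar>b - a\<bar>)"
proof (cases "a \<le> b")
  case True
  then show ?thesis using gronwall_forward[of a b e e' L] d n by (simp add: closed_segment_eq_real_ivl)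
next
  case False
  have "norm (e (- (- b))) \<le> norm (e (- (- a))) * exp (L * (- b - - a))"
  proof (rule gronwall_forward[of "-a" "-b" "\<lambda>t. e (-t)" "\<lambda>t. - e' (-t)" L])
    fix t assume t: "- a \<le> t" "t \<le> - b"
    have "(e has_vector_derivative e' (-t)) (at (-t))"
      using d[of "-t"] t False by (auto simp: closed_segment_eq_real_ivl)
    then show "((\<lambda>t. e (- t)) has_vector_derivative - e' (- t)) (at t)"
      using vector_diff_chain_at[of uminus "-1" t e "e' (-t)"] has_vector_derivative_minus[OF has_vector_derivative_id]
      by (auto simp: o_def)
    show "norm (- e' (- t)) \<le> L * norm (e (- t))"
      using n[of "-t"] t False by (auto simp: closed_segment_eq_real_ivl)
  qed (use False in auto)
  then show ?thesis using False by simp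
qed

lemma ode_dependence:
  fixes G :: "'a::euclidean_space \<Rightarrow> 'a"
  assumes lip: "\<And>x y. norm (G x - G y) \<le> L * norm (x - y)"
    and u: "\<And>t. (u has_vector_derivative G (u t)) (at t)" and v: "\<And>t. (v has_vector_derivative G (v t)) (at t)"
  shows "norm (u t - v t) \<le> norm (u a - v a) * exp (L * \<bar>t - a\<bar>)"
  by (rule gronwall[where e = "\<lambda>t. u t - v t" and e' = "\<lambda>t. G (u t) - G (v t)"])
    (auto intro!: derivative_eq_intros u v lip)

section \<open>The profile equation\<close>

locale profile =
  fixes n :: nat and c :: real
  assumes n_ge_1: "n \<ge> 1" and c_pos: "c > 0"
begin

text \<open>The profile curve \<open>(x, y) = (|X|, |Y|)\<close> has unit normal \<open>(cos p, sin p)\<close>. Its parameter is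
  arc length divided by \<open>x y\<close>, which removes the singular terms \<open>n cos p / x\<close> and \<open>n sin p / y\<close>
  of the curvature at the axes. Relative to the statement the normal is reversed, so that \<open>c > 0\<close>.\<close>

definition K :: "real \<Rightarrow> real \<Rightarrow> real \<Rightarrow> real" where
  "K x y p = c * x * y + (x\<^sup>2 / 2 - n) * y * cos p + (y\<^sup>2 / 2 - n) * x * sin p"

definition ode :: "(real \<Rightarrow> real) \<Rightarrow> (real \<Rightarrow> real) \<Rightarrow> (real \<Rightarrow> real) \<Rightarrow> real \<Rightarrow> bool" where
  "ode x y p t \<longleftrightarrow>
     (x has_real_derivative - (x t * y t * sin (p t))) (at t) \<and>
     (y has_real_derivative x t * y t * cos (p t)) (at t) \<and>
     (p has_real_derivative K (x t) (y t) (p t)) (at t)"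

text \<open>\<open>h\<close> and \<open>q\<close> are the normal and (up to sign) tangential components of the position vector, so \<open>q = 0\<close>
  identically on centred circles; \<open>w\<close> is the Gaussian area weight.\<close>

definition q :: "real \<Rightarrow> real \<Rightarrow> real \<Rightarrow> real" where "q x y p = y * cos p - x * sin p"
definition h :: "real \<Rightarrow> real \<Rightarrow> real \<Rightarrow> real" where "h x y p = x * cos p + y * sin p"
definition w :: "real \<Rightarrow> real \<Rightarrow> real" where "w x y = x ^ n * y ^ n * exp (- (x\<^sup>2 + y\<^sup>2) / 4)"

lemma rho_qh: "x\<^sup>2 + y\<^sup>2 = (q x y p)\<^sup>2 + (h x y p)\<^sup>2"
  unfolding q_def h_def using sin_cos_squared_add[of p] by algebra

text \<open>\<open>K\<close> in the moving frame, cleared of the division by the squared radius. At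
  \<open>q = 0\<close> only \<open>h\<close> and the factor \<open>x y\<close> remain, which is how
  centred spheres are recognised later.\<close>

lemma K_qh: "(x\<^sup>2 + y\<^sup>2) * K x y p =
    (x\<^sup>2 + y\<^sup>2) * x * y * (c + h x y p / 2) - n * (2 * x * y * h x y p + (y\<^sup>2 - x\<^sup>2) * q x y p)"
  unfolding K_def q_def h_def by (simp add: field_simps power2_eq_square)

context
  fixes x y p :: "real \<Rightarrow> real" and t :: real
  assumes o: "ode x y p t"
begin

lemma x': "(x has_real_derivative - (x t * y t * sin (p t))) (at t)"
  and y': "(y has_real_derivative x t * y t * cos (p t)) (at t)"
  and p': "(p has_real_derivative K (x t) (y t) (p t)) (at t)"
  using o by (auto simp: ode_def)

lemma rho': "((\<lambda>t. (x t)\<^sup>2 + (y t)\<^sup>2) has_real_derivative 2 * x t * y t * q (x t) (y t) (p t)) (at t)"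
  by (auto intro!: derivative_eq_intros x' y' p' simp: q_def power2_eq_square algebra_simps)

lemma q': "((\<lambda>t. q (x t) (y t) (p t)) has_real_derivative
    x t * y t - K (x t) (y t) (p t) * h (x t) (y t) (p t)) (at t)"
proof -
  let ?s = "sin (p t)" and ?k = "cos (p t)"
  have "((\<lambda>t. q (x t) (y t) (p t)) has_real_derivative
      x t * y t * ?k * ?k + (- ?s * K (x t) (y t) (p t)) * y t
       - (- (x t * y t * ?s) * ?s + ?k * K (x t) (y t) (p t) * x t)) (at t)"
    unfolding q_def by (auto intro!: derivative_eq_intros x' y' p')
  moreover have "x t * y t * ?k * ?k + (- ?s * K (x t) (y t) (p t)) * y t
       - (- (x t * y t * ?s) * ?s + ?k * K (x t) (y t) (p t) * x t)
      = x t * y t * (?s\<^sup>2 + ?k\<^sup>2) - K (x t) (y t) (p t) * h (x t) (y t) (p t)"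
    unfolding h_def by (simp add: algebra_simps power2_eq_square del: sin_cos_squared_add sin_cos_squared_add2 sin_cos_squared_add3)
  ultimately show ?thesis by simp
qed

lemma h': "((\<lambda>t. h (x t) (y t) (p t)) has_real_derivative
    K (x t) (y t) (p t) * q (x t) (y t) (p t)) (at t)"
  unfolding h_def
  by (auto intro!: derivative_eq_intros x' y' p' simp: q_def algebra_simps)

lemma w': "((\<lambda>t. w (x t) (y t)) has_real_derivative
    w (x t) (y t) * (n * (x t * cos (p t) - y t * sin (p t)) - x t * y t * q (x t) (y t) (p t) / 2)) (at t)"
proof -
  have pw: "((\<lambda>t. f t ^ n) has_real_derivative n * f t ^ n * d) (at t)"
    if "(f has_real_derivative f t * d) (at t)" for f :: "real \<Rightarrow> real" and d
  proof -
    obtain m where m: "n = Suc m" using n_ge_1 by (cases n) auto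
    show ?thesis using DERIV_power[OF that, of n] by (simp add: m algebra_simps)
  qed
  have "((\<lambda>t. x t ^ n) has_real_derivative n * x t ^ n * - (y t * sin (p t))) (at t)"
    "((\<lambda>t. y t ^ n) has_real_derivative n * y t ^ n * (x t * cos (p t))) (at t)"
    using pw[of x "- (y t * sin (p t))"] pw[of y "x t * cos (p t)"] x' y' by (simp_all add: algebra_simps)
  moreover have "((\<lambda>t. exp (- ((x t)\<^sup>2 + (y t)\<^sup>2) / 4)) has_real_derivative
      exp (- ((x t)\<^sup>2 + (y t)\<^sup>2) / 4) * (- (2 * x t * y t * q (x t) (y t) (p t)) / 4)) (at t)"
    by (auto intro!: derivative_eq_intros x' y' simp: q_def field_simps)
  ultimately show ?thesis
    unfolding w_def by (rule DERIV_cong[OF DERIV_mult[OF DERIV_mult]]) (simp add: field_simps)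
qed

text \<open>First variation of the weighted length under the dilation field \<open>(x, y)\<close>:
  \<open>1\<close> is its tangential divergence, \<open>2 n - (x^2 + y^2) / 2\<close> the derivative
  of \<open>ln w\<close> along it, and \<open>c h\<close> the constant curvature term times its
  normal component. The sign is thus decided by radius and \<open>h\<close> alone.\<close>

lemma wq': "((\<lambda>t. w (x t) (y t) * q (x t) (y t) (p t)) has_real_derivative
    w (x t) (y t) * (x t * y t) * (2 * n + 1 - ((x t)\<^sup>2 + (y t)\<^sup>2) / 2 - c * h (x t) (y t) (p t))) (at t)"
proof -
  let ?x = "x t" and ?y = "y t" and ?s = "sin (p t)" and ?k = "cos (p t)"
  let ?K = "K ?x ?y (p t)" and ?h = "h ?x ?y (p t)" and ?q = "q ?x ?y (p t)" and ?W = "w ?x ?y"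
  have "?q * (n * (?x * ?k - ?y * ?s) - ?x * ?y * ?q / 2) + (?x * ?y - ?K * ?h)
      = ?x * ?y * (2 * n + 1 - (?x\<^sup>2 + ?y\<^sup>2) / 2 - c * ?h) + ?x * ?y * (2 * n - (?x\<^sup>2 + ?y\<^sup>2) / 2) * (?s\<^sup>2 + ?k\<^sup>2 - 1)"
    unfolding K_def h_def q_def
    by (simp add: field_simps power2_eq_square del: sin_cos_squared_add sin_cos_squared_add2 sin_cos_squared_add3)
  then have "?q * (n * (?x * ?k - ?y * ?s) - ?x * ?y * ?q / 2) + (?x * ?y - ?K * ?h)
      = ?x * ?y * (2 * n + 1 - (?x\<^sup>2 + ?y\<^sup>2) / 2 - c * ?h)" by simp
  then have "?W * (n * (?x * ?k - ?y * ?s) - ?x * ?y * ?q / 2) * ?q + (?x * ?y - ?K * ?h) * ?W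
      = ?W * (?x * ?y) * (2 * n + 1 - (?x\<^sup>2 + ?y\<^sup>2) / 2 - c * ?h)" by algebra
  then show ?thesis using DERIV_mult[OF w' q'] by simp
qed

lemma diff': "((\<lambda>t. y t - x t) has_real_derivative x t * y t * (cos (p t) + sin (p t))) (at t)"
  by (auto intro!: derivative_eq_intros x' y' p' simp: algebra_simps)

text \<open>The same identity for the constant field \<open>(-1, 1)\<close>, whose tangential
  component is \<open>cos p + sin p\<close> and whose normal component is
  \<open>sin p - cos p\<close>.\<close>

lemma wC': "((\<lambda>t. w (x t) (y t) * (cos (p t) + sin (p t))) has_real_derivative
    - w (x t) (y t) * ((y t - x t) * (x t * y t / 2 + n) + c * x t * y t * (sin (p t) - cos (p t)))) (at t)"
proof -
  let ?x = "x t" and ?y = "y t" and ?s = "sin (p t)" and ?k = "cos (p t)"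
  let ?K = "K ?x ?y (p t)" and ?q = "q ?x ?y (p t)" and ?W = "w ?x ?y"
  have C': "((\<lambda>t. cos (p t) + sin (p t)) has_real_derivative ?K * (?k - ?s)) (at t)"
    by (auto intro!: derivative_eq_intros x' y' p' simp: algebra_simps)
  have "(?k + ?s) * (n * (?x * ?k - ?y * ?s) - ?x * ?y * ?q / 2) + ?K * (?k - ?s)
      = - ((?y - ?x) * (?x * ?y / 2 + n) + c * ?x * ?y * (?s - ?k))
        + (?x - ?y) * (n + ?x * ?y / 2) * (?s\<^sup>2 + ?k\<^sup>2 - 1)"
    unfolding K_def q_def
    by (simp add: field_simps power2_eq_square del: sin_cos_squared_add sin_cos_squared_add2 sin_cos_squared_add3)
  then have "(?k + ?s) * (n * (?x * ?k - ?y * ?s) - ?x * ?y * ?q / 2) + ?K * (?k - ?s)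
      = - ((?y - ?x) * (?x * ?y / 2 + n) + c * ?x * ?y * (?s - ?k))" by simp
  then have "?W * (n * (?x * ?k - ?y * ?s) - ?x * ?y * ?q / 2) * (?k + ?s) + ?K * (?k - ?s) * ?W
      = - ?W * ((?y - ?x) * (?x * ?y / 2 + n) + c * ?x * ?y * (?s - ?k))" by algebra
  then show ?thesis using DERIV_mult[OF w' C'] by simp
qed

lemma xs': "((\<lambda>t. x t * sin (p t)) has_real_derivative
    - (x t * y t) * (sin (p t))\<^sup>2 + x t * cos (p t) * K (x t) (y t) (p t)) (at t)"
  by (auto intro!: derivative_eq_intros x' y' p' simp: algebra_simps power2_eq_square)

text \<open>Subtracting \<open>(y^2 - x^2) / 4\<close> removes the cubic terms of \<open>K\<close>
  up to a multiple of \<open>y - x\<close>, so that near the diagonal and far from the origin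
  \<open>c x y\<close> dominates.\<close>

lemma lam': "((\<lambda>t. p t - ((y t)\<^sup>2 - (x t)\<^sup>2) / 4) has_real_derivative
    x t * y t * (c + (y t - x t) * (sin (p t) - cos (p t)) / 2) - n * (y t * cos (p t) + x t * sin (p t))) (at t)"
  by (auto intro!: derivative_eq_intros x' y' p' simp: K_def field_simps power2_eq_square)

lemma ratio': "y t > 0 \<Longrightarrow> ((\<lambda>t. x t / y t) has_real_derivative - (x t / y t) * h (x t) (y t) (p t)) (at t)"
  by (auto intro!: derivative_eq_intros x' y' p' simp: h_def field_simps power2_eq_square)

end

end

section \<open>Barriers, bounded Lipschitz functions and the clamped flow\<close>

lemma first_hit:
  fixes f :: "real \<Rightarrow> real"
  assumes "continuous_on {a..b} f" "a \<le> b" "f a < k" "k \<le> f b"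
  obtains t where "a < t" "t \<le> b" "f t = k" "\<And>s. a \<le> s \<Longrightarrow> s < t \<Longrightarrow> f s < k"
proof -
  define S where "S = {t \<in> {a..b}. k \<le> f t}"
  have clip: "closed S"
    unfolding S_def by (intro continuous_on_closed_Collect_le continuous_intros assms(1))
  have ne: "S \<noteq> {}" using assms by (auto simp: S_def)
  have bd: "bdd_below S" unfolding S_def by (intro bdd_belowI[of _ a]) auto
  define t where "t = Inf S"
  have tS: "t \<in> S" unfolding t_def by (rule closed_contains_Inf[OF ne bd clip])
  have lt: "f s < k" if "a \<le> s" "s < t" for s
  proof (rule ccontr)
    assume "\<not> f s < k"
    then have "s \<in> S" using that tS by (auto simp: S_def)
    then have "t \<le> s" unfolding t_def by (rule cInf_lower[OF _ bd])
    then show False using that by simp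
  qed
  have at: "a < t" using tS assms(3) by (cases "a = t") (auto simp: S_def)
  have "f t = k"
  proof (rule ccontr)
    assume "f t \<noteq> k"
    then have "k < f t" using tS by (auto simp: S_def)
    then obtain s where "a \<le> s" "s \<le> t" "f s = k"
      using IVT'[of f a k t] assms at tS continuous_on_subset[OF assms(1), of "{a..t}"]
      by (force simp: S_def)
    with lt[of s] \<open>k < f t\<close> show False by (cases "s = t") auto
  qed
  with at lt tS show ?thesis by (intro that[of t]) (auto simp: S_def)
qed

text \<open>Applied to reversed time, \<open>first_hit\<close> gives the last moment at level
  \<open>k\<close>; after it \<open>f\<close> lies above \<open>k\<close> and is therefore
  nonincreasing.\<close>

lemma barrier_le:
  fixes f :: "real \<Rightarrow> real"
  assumes "a \<le> b" "\<And>t. a \<le> t \<Longrightarrow> t \<le> b \<Longrightarrow> (f has_real_derivative f' t) (at t)"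
    "\<And>t. a \<le> t \<Longrightarrow> t \<le> b \<Longrightarrow> f t > k \<Longrightarrow> f' t \<le> 0" "f a \<le> k"
  shows "f b \<le> k"
proof (rule ccontr)
  assume "\<not> f b \<le> k"
  then have fb: "f b > k" by simp
  have cont: "continuous_on {a..b} f"
    by (intro continuous_at_imp_continuous_on ballI DERIV_isCont[OF assms(2)]) auto
  have "continuous_on {a..b} (\<lambda>s. - f (a + b - s))"
    by (intro continuous_intros continuous_on_compose2[OF cont]) auto
  then obtain s where s: "a < s" "s \<le> b" "- f (a + b - s) = - k"
    and lt: "\<And>r. a \<le> r \<Longrightarrow> r < s \<Longrightarrow> - f (a + b - r) < - k"
    using first_hit[of a b "\<lambda>s. - f (a + b - s)" "- k"] fb assms by auto
  have gt: "f r > k" if "a + b - s < r" "r \<le> b" for r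
    using lt[of "a + b - r"] that by auto
  have "- f (a + b - s) \<le> - f b"
    by (rule DERIV_nonneg_mono[where f' = "\<lambda>t. - f' t"])
      (use s gt assms in \<open>auto intro!: derivative_eq_intros\<close>)
  then show False using s fb by simp
qed

text \<open>Boundedness belongs to the class because a product of Lipschitz functions is again
  Lipschitz when the factors are bounded.\<close>

definition bounded_lipschitz :: "('a::metric_space \<Rightarrow> real) \<Rightarrow> bool" where
  "bounded_lipschitz f \<longleftrightarrow> (\<exists>B L. B \<ge> 0 \<and> L \<ge> 0 \<and> (\<forall>u. \<bar>f u\<bar> \<le> B) \<and> (\<forall>u v. \<bar>f u - f v\<bar> \<le> L * dist u v))"

lemma bounded_lipschitzI:
  assumes "\<And>u. \<bar>f u\<bar> \<le> B" "\<And>u v. \<bar>f u - f v\<bar> \<le> L * dist u v" "B \<ge> 0" "L \<ge> 0"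
  shows "bounded_lipschitz f"
  unfolding bounded_lipschitz_def using assms by blast

lemma bounded_lipschitz_const: "bounded_lipschitz (\<lambda>_. k)"
  by (rule bounded_lipschitzI[of _ "\<bar>k\<bar>" 0]) auto

lemma bounded_lipschitz_add:
  assumes "bounded_lipschitz f" "bounded_lipschitz g" shows "bounded_lipschitz (\<lambda>u. f u + g u)"
proof -
  obtain B L where f: "\<And>u. \<bar>f u\<bar> \<le> B" "\<And>u v. \<bar>f u - f v\<bar> \<le> L * dist u v" "B \<ge> 0" "L \<ge> 0"
    using assms(1) unfolding bounded_lipschitz_def by blast
  obtain B' L' where g: "\<And>u. \<bar>g u\<bar> \<le> B'" "\<And>u v. \<bar>g u - g v\<bar> \<le> L' * dist u v" "B' \<ge> 0" "L' \<ge> 0"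
    using assms(2) unfolding bounded_lipschitz_def by blast
  show ?thesis
  proof (rule bounded_lipschitzI[of _ "B + B'" "L + L'"])
    show "\<bar>f u + g u\<bar> \<le> B + B'" for u using f(1)[of u] g(1)[of u] by linarith
    show "\<bar>f u + g u - (f v + g v)\<bar> \<le> (L + L') * dist u v" for u v
      using f(2)[of u v] g(2)[of u v] by (simp add: distrib_right)
  qed (use f g in auto)
qed

lemma bounded_lipschitz_mult:
  assumes "bounded_lipschitz f" "bounded_lipschitz g" shows "bounded_lipschitz (\<lambda>u. f u * g u)"
proof -
  obtain B L where f: "\<And>u. \<bar>f u\<bar> \<le> B" "\<And>u v. \<bar>f u - f v\<bar> \<le> L * dist u v" "B \<ge> 0" "L \<ge> 0"
    using assms(1) unfolding bounded_lipschitz_def by blast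
  obtain B' L' where g: "\<And>u. \<bar>g u\<bar> \<le> B'" "\<And>u v. \<bar>g u - g v\<bar> \<le> L' * dist u v" "B' \<ge> 0" "L' \<ge> 0"
    using assms(2) unfolding bounded_lipschitz_def by blast
  show ?thesis
  proof (rule bounded_lipschitzI[of _ "B * B'" "B * L' + L * B'"])
    show "\<bar>f u * g u\<bar> \<le> B * B'" for u using f(1)[of u] g(1)[of u] f(3) by (simp add: abs_mult mult_mono)
    fix u v
    have "f u * g u - f v * g v = f u * (g u - g v) + (f u - f v) * g v" by (simp add: algebra_simps)
    also have "\<bar>\<dots>\<bar> \<le> \<bar>f u\<bar> * \<bar>g u - g v\<bar> + \<bar>f u - f v\<bar> * \<bar>g v\<bar>"
      by (rule order_trans[OF abs_triangle_ineq]) (simp add: abs_mult)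
    also have "\<dots> \<le> B * (L' * dist u v) + (L * dist u v) * B'"
      by (intro add_mono mult_mono) (use f g in auto)
    finally show "\<bar>f u * g u - f v * g v\<bar> \<le> (B * L' + L * B') * dist u v" by (simp add: algebra_simps)
  qed (use f g in auto)
qed

lemma bounded_lipschitz_minus: "bounded_lipschitz f \<Longrightarrow> bounded_lipschitz (\<lambda>u. - f u)"
  using bounded_lipschitz_mult[OF bounded_lipschitz_const[of "-1"]] by simp

lemma bounded_lipschitz_diff: "bounded_lipschitz f \<Longrightarrow> bounded_lipschitz g \<Longrightarrow> bounded_lipschitz (\<lambda>u. f u - g u)"
  using bounded_lipschitz_add[OF _ bounded_lipschitz_minus, of f g] by simp

lemma bounded_lipschitz_divide: "bounded_lipschitz f \<Longrightarrow> bounded_lipschitz (\<lambda>u. f u / k)"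
  using bounded_lipschitz_mult[OF _ bounded_lipschitz_const[of "inverse k"], of f] by (simp add: divide_inverse)

lemma bounded_lipschitz_power2: "bounded_lipschitz f \<Longrightarrow> bounded_lipschitz (\<lambda>u. (f u)\<^sup>2)"
  using bounded_lipschitz_mult[of f f] by (simp add: power2_eq_square)

lemma abs_sin_diff_le: "\<bar>sin a - sin b\<bar> \<le> \<bar>a - b\<bar>" for a b :: real
proof -
  have "\<bar>sin ((a - b) / 2)\<bar> * \<bar>cos ((a + b) / 2)\<bar> \<le> \<bar>(a - b) / 2\<bar> * 1"
    by (intro mult_mono abs_sin_x_le_abs_x) auto
  then show ?thesis by (simp add: sin_diff_sin abs_mult)
qed

lemma abs_cos_diff_le: "\<bar>cos a - cos b\<bar> \<le> \<bar>a - b\<bar>" for a b :: real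
  using abs_sin_diff_le[of "a + pi/2" "b + pi/2"] by (simp add: sin_add)

lemma bounded_lipschitz_sin: "(\<And>u v. \<bar>f u - f v\<bar> \<le> dist u v) \<Longrightarrow> bounded_lipschitz (\<lambda>u. sin (f u))"
  by (rule bounded_lipschitzI[of _ 1 1]) (auto intro: order_trans[OF abs_sin_diff_le])

lemma bounded_lipschitz_cos: "(\<And>u v. \<bar>f u - f v\<bar> \<le> dist u v) \<Longrightarrow> bounded_lipschitz (\<lambda>u. cos (f u))"
  by (rule bounded_lipschitzI[of _ 1 1]) (auto intro: order_trans[OF abs_cos_diff_le])

text \<open>Clipping \<open>x\<close> and \<open>y\<close> to \<open>[0, M]\<close> makes the vector field bounded and Lipschitz without
  changing the trajectories that matter.\<close>

definition clip :: "real \<Rightarrow> real \<Rightarrow> real" where "clip M z = max 0 (min M z)"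

lemma clip_id: "0 \<le> z \<Longrightarrow> z \<le> M \<Longrightarrow> clip M z = z"
  and clip_nonneg: "0 \<le> clip M z"
  and clip_le: "0 \<le> M \<Longrightarrow> clip M z \<le> M"
  and clip_abs: "0 \<le> M \<Longrightarrow> clip M z \<le> \<bar>z\<bar>"
  by (auto simp: clip_def)

lemma bounded_lipschitz_clip:
  assumes "M \<ge> 0" "\<And>u v. \<bar>f u - f v\<bar> \<le> dist u v"
  shows "bounded_lipschitz (\<lambda>u. clip M (f u))"
proof (rule bounded_lipschitzI[of _ M 1])
  fix u v
  show "\<bar>clip M (f u) - clip M (f v)\<bar> \<le> 1 * dist u v"
    using assms(2)[of u v] by (auto simp: clip_def)
qed (use assms in \<open>auto simp: clip_def\<close>)

lemma triple_dist:
  fixes u v :: "real \<times> real \<times> real"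
  shows "\<bar>fst u - fst v\<bar> \<le> dist u v" "\<bar>fst (snd u) - fst (snd v)\<bar> \<le> dist u v"
    "\<bar>snd (snd u) - snd (snd v)\<bar> \<le> dist u v"
proof -
  show "\<bar>fst u - fst v\<bar> \<le> dist u v" using dist_fst_le[of u v] by (simp add: dist_real_def)
  have "dist (snd u) (snd v) \<le> dist u v" by (rule dist_snd_le)
  then show "\<bar>fst (snd u) - fst (snd v)\<bar> \<le> dist u v" "\<bar>snd (snd u) - snd (snd v)\<bar> \<le> dist u v"
    using dist_fst_le[of "snd u" "snd v"] dist_snd_le[of "snd u" "snd v"] by (simp_all add: dist_real_def)
qed

lemma norm_triple_le: "norm (a :: real, b :: real, d :: real) \<le> \<bar>a\<bar> + \<bar>b\<bar> + \<bar>d\<bar>"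
  using norm_Pair_le[of a "(b, d)"] norm_Pair_le[of b d] by simp

context profile
begin

definition clamped_field :: "real \<Rightarrow> real \<times> real \<times> real \<Rightarrow> real \<times> real \<times> real" where
  "clamped_field M u = (- (clip M (fst u) * clip M (fst (snd u)) * sin (snd (snd u))),
     clip M (fst u) * clip M (fst (snd u)) * cos (snd (snd u)),
     K (clip M (fst u)) (clip M (fst (snd u))) (snd (snd u)))"

lemma clamped_field_blip:
  assumes "M \<ge> 0"
  shows "\<exists>B L. L > 0 \<and> (\<forall>u. norm (clamped_field M u) \<le> B) \<and> (\<forall>u v. norm (clamped_field M u - clamped_field M v) \<le> L * norm (u - v))"
proof -
  have "bounded_lipschitz (\<lambda>u. fst (clamped_field M u))" "bounded_lipschitz (\<lambda>u. fst (snd (clamped_field M u)))" "bounded_lipschitz (\<lambda>u. snd (snd (clamped_field M u)))"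
    unfolding clamped_field_def K_def fst_conv snd_conv by (rule bounded_lipschitz_add bounded_lipschitz_mult bounded_lipschitz_minus bounded_lipschitz_diff bounded_lipschitz_divide bounded_lipschitz_power2 bounded_lipschitz_const
    bounded_lipschitz_sin[OF triple_dist(3)] bounded_lipschitz_cos[OF triple_dist(3)]
    bounded_lipschitz_clip[OF assms triple_dist(1)] bounded_lipschitz_clip[OF assms triple_dist(2)])+
  then obtain B1 L1 B2 L2 B3 L3 where
    1: "L1 \<ge> 0" "\<And>u. \<bar>fst (clamped_field M u)\<bar> \<le> B1" "\<And>u v. \<bar>fst (clamped_field M u) - fst (clamped_field M v)\<bar> \<le> L1 * dist u v" and
    2: "L2 \<ge> 0" "\<And>u. \<bar>fst (snd (clamped_field M u))\<bar> \<le> B2" "\<And>u v. \<bar>fst (snd (clamped_field M u)) - fst (snd (clamped_field M v))\<bar> \<le> L2 * dist u v" and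
    3: "L3 \<ge> 0" "\<And>u. \<bar>snd (snd (clamped_field M u))\<bar> \<le> B3" "\<And>u v. \<bar>snd (snd (clamped_field M u)) - snd (snd (clamped_field M v))\<bar> \<le> L3 * dist u v"
    unfolding bounded_lipschitz_def by metis
  have nt: "norm u \<le> \<bar>fst u\<bar> + \<bar>fst (snd u)\<bar> + \<bar>snd (snd u)\<bar>" for u :: "real \<times> real \<times> real"
    using norm_triple_le[of "fst u" "fst (snd u)" "snd (snd u)"] by simp
  show ?thesis
  proof (rule exI[of _ "B1 + B2 + B3"], rule exI[of _ "L1 + L2 + L3 + 1"], intro conjI allI)
    fix u v
    show "norm (clamped_field M u) \<le> B1 + B2 + B3"
      using nt[of "clamped_field M u"] 1(2)[of u] 2(2)[of u] 3(2)[of u] by linarith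
    have "norm (clamped_field M u - clamped_field M v) \<le> L1 * dist u v + L2 * dist u v + L3 * dist u v"
      using nt[of "clamped_field M u - clamped_field M v"] 1(3)[of u v] 2(3)[of u v] 3(3)[of u v] by simp
    also have "\<dots> \<le> (L1 + L2 + L3 + 1) * dist u v" by (simp add: algebra_simps)
    finally show "norm (clamped_field M u - clamped_field M v) \<le> (L1 + L2 + L3 + 1) * norm (u - v)"
      by (simp add: dist_norm)
  qed (use 1 2 3 in auto)
qed

definition clamped_ode :: "real \<Rightarrow> (real \<Rightarrow> real) \<Rightarrow> (real \<Rightarrow> real) \<Rightarrow> (real \<Rightarrow> real) \<Rightarrow> real \<Rightarrow> bool" where
  "clamped_ode M x y p t \<longleftrightarrow>
     (x has_real_derivative - (clip M (x t) * clip M (y t) * sin (p t))) (at t) \<and>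
     (y has_real_derivative clip M (x t) * clip M (y t) * cos (p t)) (at t) \<and>
     (p has_real_derivative K (clip M (x t)) (clip M (y t)) (p t)) (at t)"

lemma clamped_ode_iff: "clamped_ode M x y p t \<longleftrightarrow>
    ((\<lambda>t. (x t, y t, p t)) has_vector_derivative clamped_field M (x t, y t, p t)) (at t)"
proof
  assume "clamped_ode M x y p t"
  then show "((\<lambda>t. (x t, y t, p t)) has_vector_derivative clamped_field M (x t, y t, p t)) (at t)"
    unfolding clamped_ode_def clamped_field_def has_real_derivative_iff_has_vector_derivative fst_conv snd_conv
    by (intro has_vector_derivative_Pair) auto
next
  assume d: "((\<lambda>t. (x t, y t, p t)) has_vector_derivative clamped_field M (x t, y t, p t)) (at t)"
  show "clamped_ode M x y p t"
    using bounded_linear.has_vector_derivative[OF bounded_linear_fst d]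
      bounded_linear.has_vector_derivative[OF bounded_linear_compose[OF bounded_linear_fst bounded_linear_snd] d]
      bounded_linear.has_vector_derivative[OF bounded_linear_compose[OF bounded_linear_snd bounded_linear_snd] d]
    unfolding clamped_ode_def clamped_field_def has_real_derivative_iff_has_vector_derivative by simp
qed

lemma clamped_ode_imp_ode: "clamped_ode M x y p t \<Longrightarrow> 0 < x t \<Longrightarrow> x t \<le> M \<Longrightarrow> 0 < y t \<Longrightarrow> y t \<le> M \<Longrightarrow> ode x y p t"
  unfolding clamped_ode_def ode_def by (simp add: clip_id)

text \<open>With angle \<open>pi / 4\<close> the normal points along the diagonal, so the curve
  leaves it perpendicularly. The factor 2 bounds the norm of the initial difference
  \<open>(b - b', b - b', 0)\<close>.\<close>

lemma clamped_ode_flow: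
  assumes "M \<ge> 0"
  shows "\<exists>X Y P L. L > 0 \<and> (\<forall>b. X b 0 = b \<and> Y b 0 = b \<and> P b 0 = pi / 4) \<and> (\<forall>b t. clamped_ode M (X b) (Y b) (P b) t)
     \<and> (\<forall>b b' t. \<bar>X b t - X b' t\<bar> \<le> 2 * \<bar>b - b'\<bar> * exp (L * \<bar>t\<bar>) \<and> \<bar>Y b t - Y b' t\<bar> \<le> 2 * \<bar>b - b'\<bar> * exp (L * \<bar>t\<bar>)
          \<and> \<bar>P b t - P b' t\<bar> \<le> 2 * \<bar>b - b'\<bar> * exp (L * \<bar>t\<bar>))"
proof -
  obtain B L where L: "L > 0" and B: "\<And>u. norm (clamped_field M u) \<le> B"
    and lip: "\<And>u v. norm (clamped_field M u - clamped_field M v) \<le> L * norm (u - v)"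
    using clamped_field_blip[OF assms] by blast
  have "\<exists>u. u 0 = (b, b, pi / 4) \<and> (\<forall>t. (u has_vector_derivative clamped_field M (u t)) (at t))" for b
    by (rule ode_global_exists[OF lip L B])
  then obtain u where u0: "\<And>b. u b 0 = (b, b, pi / 4)"
    and u: "\<And>b t. (u b has_vector_derivative clamped_field M (u b t)) (at t)" by metis
  define X Y P where "X = (\<lambda>b t. fst (u b t))" "Y = (\<lambda>b t. fst (snd (u b t)))" "P = (\<lambda>b t. snd (snd (u b t)))"
  have XYP: "(X b t, Y b t, P b t) = u b t" for b t by (simp add: X_Y_P_def)
  have dep: "dist (u b t) (u b' t) \<le> 2 * \<bar>b - b'\<bar> * exp (L * \<bar>t\<bar>)" for b b' t
  proof -
    have "norm (u b t - u b' t) \<le> norm (u b 0 - u b' 0) * exp (L * \<bar>t - 0\<bar>)"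
      by (rule ode_dependence[OF lip u u])
    also have "norm (u b 0 - u b' 0) \<le> 2 * \<bar>b - b'\<bar>"
      using norm_triple_le[of "b - b'" "b - b'" 0] by (simp add: u0)
    finally show ?thesis by (simp add: dist_norm)
  qed
  show ?thesis
  proof (rule exI[of _ X], rule exI[of _ Y], rule exI[of _ P], rule exI[of _ L], intro conjI allI)
    show "clamped_ode M (X b) (Y b) (P b) t" for b t
      unfolding clamped_ode_iff XYP by (rule u)
  qed (use L u0 order_trans[OF triple_dist(1) dep] order_trans[OF triple_dist(2) dep] order_trans[OF triple_dist(3) dep]
      in \<open>auto simp: X_Y_P_def\<close>)
qed

lemma clamped_ode_unique:
  assumes "M \<ge> 0" "\<And>t. clamped_ode M x y p t" "\<And>t. clamped_ode M x' y' p' t" "x a = x' a" "y a = y' a" "p a = p' a"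
  shows "x t = x' t" "y t = y' t" "p t = p' t"
proof -
  obtain L where lip: "\<And>u v. norm (clamped_field M u - clamped_field M v) \<le> L * norm (u - v)"
    using clamped_field_blip[OF assms(1)] by blast
  have "norm ((x t, y t, p t) - (x' t, y' t, p' t)) \<le> norm ((x a, y a, p a) - (x' a, y' a, p' a)) * exp (L * \<bar>t - a\<bar>)"
    by (rule ode_dependence[OF lip]) (use assms clamped_ode_iff in blast)+
  then show "x t = x' t" "y t = y' t" "p t = p' t" using assms by (auto simp: zero_prod_def)
qed

text \<open>The derivatives of \<open>x\<close> and \<open>y\<close> are bounded by \<open>M\<close>
  times \<open>x\<close> and \<open>y\<close> themselves, so by Gronwall neither can vanish in
  finite time: in this parametrisation the axes are invariant.\<close>

lemma clamped_ode_pos: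
  assumes "M \<ge> 0" "\<And>t. clamped_ode M x y p t" "x 0 > 0" "y 0 > 0"
  shows "x t > 0" "y t > 0"
proof -
  have *: "z t > 0" if d: "\<And>t. (z has_real_derivative z' t) (at t)" and b: "\<And>t. \<bar>z' t\<bar> \<le> M * \<bar>z t\<bar>" and z0: "z 0 > 0"
    for z z' :: "real \<Rightarrow> real" and t
  proof -
    have nz: "z t \<noteq> 0" for t
    proof
      assume "z t = 0"
      have "norm (z 0) \<le> norm (z t) * exp (M * \<bar>0 - t\<bar>)"
        by (rule gronwall[where e' = z']) (use d b in \<open>auto simp: has_real_derivative_iff_has_vector_derivative\<close>)
      then show False using z0 \<open>z t = 0\<close> by simp
    qed
    have cont: "continuous_on S z" for S
      using d by (intro continuous_at_imp_continuous_on) (auto intro: DERIV_isCont)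
    show "z t > 0"
    proof (rule ccontr)
      assume "\<not> z t > 0"
      then have "\<exists>s. z s = 0"
        using IVT'[of z t 0 0] IVT2'[of z t 0 0] cont z0 by (cases "t \<le> 0") (auto simp: not_less)
      then show False using nz by blast
    qed
  qed
  show "x t > 0"
  proof (rule *[of x "\<lambda>t. - (clip M (x t) * clip M (y t) * sin (p t))"])
    fix t
    have "\<bar>- (clip M (x t) * clip M (y t) * sin (p t))\<bar> = clip M (x t) * clip M (y t) * \<bar>sin (p t)\<bar>"
      by (simp add: abs_mult clip_nonneg)
    also have "\<dots> \<le> \<bar>x t\<bar> * M * 1"
      by (intro mult_mono clip_abs clip_le assms mult_nonneg_nonneg clip_nonneg) auto
    finally show "\<bar>- (clip M (x t) * clip M (y t) * sin (p t))\<bar> \<le> M * \<bar>x t\<bar>" by (simp add: mult.commute)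
  qed (use assms clamped_ode_def in auto)
  show "y t > 0"
  proof (rule *[of y "\<lambda>t. clip M (x t) * clip M (y t) * cos (p t)"])
    fix t
    have "\<bar>clip M (x t) * clip M (y t) * cos (p t)\<bar> = clip M (x t) * clip M (y t) * \<bar>cos (p t)\<bar>"
      by (simp add: abs_mult clip_nonneg)
    also have "\<dots> \<le> M * \<bar>y t\<bar> * 1"
      by (intro mult_mono clip_abs clip_le assms mult_nonneg_nonneg clip_nonneg) auto
    finally show "\<bar>clip M (x t) * clip M (y t) * cos (p t)\<bar> \<le> M * \<bar>y t\<bar>" by simp
  qed (use assms clamped_ode_def in auto)
qed

text \<open>The radius of the round sphere solution, which corresponds to \<open>q = 0\<close>, \<open>h = RS\<close>.\<close>

definition RS :: real where "RS = sqrt (c\<^sup>2 + 2 * (2 * n + 1)) - c"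

lemma RS_pos: "RS > 0"
proof -
  have "sqrt (c\<^sup>2) < sqrt (c\<^sup>2 + 2 * (2 * n + 1))" by (intro real_sqrt_less_mono) simp
  then show ?thesis using c_pos by (simp add: RS_def)
qed

lemma RS_eq: "RS\<^sup>2 / 2 + c * RS = 2 * n + 1"
proof -
  have "(RS + c)\<^sup>2 = c\<^sup>2 + 2 * (2 * n + 1)" by (simp add: RS_def)
  then show ?thesis by (simp add: power2_eq_square algebra_simps)
qed

lemma RS_mono: "0 \<le> r \<Longrightarrow> r \<le> s \<Longrightarrow> r\<^sup>2 / 2 + c * r \<le> s\<^sup>2 / 2 + c * s"
  using c_pos by (intro add_mono divide_right_mono power_mono mult_left_mono) auto

lemma abs_h_le: "\<bar>h x y p\<bar> \<le> sqrt (x\<^sup>2 + y\<^sup>2)"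
  unfolding rho_qh[of x y p] by (rule real_le_rsqrt) simp

lemma abs_q_le: "\<bar>q x y p\<bar> \<le> sqrt (x\<^sup>2 + y\<^sup>2)"
  unfolding rho_qh[of x y p] by (rule real_le_rsqrt) simp

section \<open>Where a trajectory above the diagonal with \<open>q <= 0\<close> cannot go\<close>

lemma w_pos: "0 < x \<Longrightarrow> 0 < y \<Longrightarrow> w x y > 0"
  by (simp add: w_def)

text \<open>From \<open>q <= 0\<close> one has \<open>y cos p <= x sin p\<close>, so the left side
  is at least \<open>(y - x) sin p\<close>.\<close>

lemma sin_minus_cos_ge:
  assumes "q x y p \<le> 0" "x \<le> y"
  shows "y * (sin p - cos p) \<ge> - (y - x)"
proof -
  have "(y - x) * sin p \<ge> (y - x) * (-1)" using assms by (intro mult_left_mono) auto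
  then show ?thesis using assms by (simp add: q_def algebra_simps)
qed

lemma rho_antimono:
  assumes "\<And>t. a \<le> t \<Longrightarrow> t \<le> b \<Longrightarrow> ode x y p t \<and> x t > 0 \<and> y t > 0 \<and> q (x t) (y t) (p t) \<le> 0" "a \<le> b"
  shows "(x b)\<^sup>2 + (y b)\<^sup>2 \<le> (x a)\<^sup>2 + (y a)\<^sup>2"
proof (rule barrier_le[OF assms(2)])
  fix t assume t: "a \<le> t" "t \<le> b"
  show "((\<lambda>t. (x t)\<^sup>2 + (y t)\<^sup>2) has_real_derivative 2 * x t * y t * q (x t) (y t) (p t)) (at t)"
    using rho' assms(1)[OF t] by blast
  have "0 \<le> 2 * x t * y t" using assms(1)[OF t] by simp
  then show "2 * x t * y t * q (x t) (y t) (p t) \<le> 0"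
    using assms(1)[OF t] by (intro mult_nonneg_nonpos) auto
qed simp

text \<open>The flux \<open>w (cos p + sin p)\<close> decreases while \<open>x < y\<close>; near the origin this forces \<open>y - x\<close> to increase.\<close>

lemma no_collapse:
  assumes A: "\<And>t. t \<ge> t0 \<Longrightarrow> ode x y p t \<and> 0 < x t \<and> x t < y t \<and> q (x t) (y t) (p t) \<le> 0"
    and small: "\<And>e. e > 0 \<Longrightarrow> \<exists>t\<ge>t0. (x t)\<^sup>2 + (y t)\<^sup>2 < e"
  shows False
proof -
  let ?r = "\<lambda>t. (x t)\<^sup>2 + (y t)\<^sup>2" and ?C = "\<lambda>t. cos (p t) + sin (p t)"
  have anti: "?r t \<le> ?r s" if "t0 \<le> s" "s \<le> t" for s t
  proof (rule rho_antimono[where p = p])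
    fix r assume "s \<le> r" "r \<le> t"
    then show "ode x y p r \<and> 0 < x r \<and> 0 < y r \<and> q (x r) (y r) (p r) \<le> 0"
      using A[of r] that by auto
  qed (use that in auto)
  have small': "\<exists>t>s. ?r t < e" if se: "s \<ge> t0" "e > 0" for s e
  proof -
    have "?r s > 0" using A[OF se(1)] by (simp add: add_pos_pos)
    then obtain t where t: "t \<ge> t0" "?r t < min e (?r s)" using small[of "min e (?r s)"] se(2) by auto
    moreover have "s < t"
    proof (rule ccontr)
      assume "\<not> s < t"
      then show False using anti[of t s] t by auto
    qed
    ultimately show ?thesis by auto
  qed
  \<comment> \<open>From here on the trajectory lies in the unit disc with \<open>x < n / c\<close>.
    The latter lets \<open>n (y - x)\<close> absorb the \<open>c\<close> term in the derivative of
    the flux, the former gives \<open>wsmall\<close>.\<close>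
  obtain t1 where t1: "t1 \<ge> t0" "?r t1 < min 1 ((n / c)\<^sup>2)"
    using small[of "min 1 ((n / c)\<^sup>2)"] n_ge_1 c_pos by auto
  have bnd: "x t < 1 \<and> y t < 1 \<and> x t < n / c" if "t \<ge> t1" for t
  proof -
    have "?r t < min 1 ((n / c)\<^sup>2)" using anti[of t1 t] t1 that by auto
    then have "(x t)\<^sup>2 < 1\<^sup>2" "(y t)\<^sup>2 < 1\<^sup>2" "(x t)\<^sup>2 < (n / c)\<^sup>2"
      using zero_le_power2[of "x t"] zero_le_power2[of "y t"] by (simp_all, linarith+)
    then show ?thesis using power2_less_imp_less[of "x t" 1] power2_less_imp_less[of "y t" 1]
      power2_less_imp_less[of "x t" "n / c"] c_pos by auto
  qed
  have dec: "w (x t) (y t) * ?C t < w (x s) (y s) * ?C s" if "t1 \<le> s" "s < t" for s t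
  proof -
    let ?f = "\<lambda>t. w (x t) (y t) * ((y t - x t) * (x t * y t / 2 + n) + c * x t * y t * (sin (p t) - cos (p t)))"
    have "- (w (x s) (y s) * ?C s) < - (w (x t) (y t) * ?C t)"
    proof (rule DERIV_pos_strict_mono[OF that(2)])
      fix r assume "s \<le> r" "r \<le> t"
      then have "ode x y p r" using A[of r] t1 that by auto
      then show "((\<lambda>t. - (w (x t) (y t) * ?C t)) has_real_derivative ?f r) (at r)"
        using DERIV_minus[OF wC'[of x y p r]] by simp
    next
      fix r assume r: "s < r" "r < t"
      then have a: "0 < x r" "x r < y r" "q (x r) (y r) (p r) \<le> 0" "x r < n / c"
        using A[of r] t1 that bnd[of r] by auto
      have "c * x r * (y r * (sin (p r) - cos (p r))) \<ge> c * x r * (- (y r - x r))"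
        using a c_pos by (intro mult_left_mono sin_minus_cos_ge) auto
      moreover have "c * x r * (y r - x r) \<le> n * (y r - x r)"
        using a c_pos by (intro mult_right_mono) (auto simp: field_simps)
      moreover have "0 < (y r - x r) * (x r * y r / 2)" using a by (intro mult_pos_pos) auto
      moreover have "(y r - x r) * (x r * y r / 2 + n) + c * x r * y r * (sin (p r) - cos (p r))
          = (y r - x r) * (x r * y r / 2) + n * (y r - x r) + c * x r * (y r * (sin (p r) - cos (p r)))"
        by (simp add: algebra_simps)
      moreover have "c * x r * (- (y r - x r)) = - (c * x r * (y r - x r))" by (simp add: algebra_simps)
      ultimately have "0 < (y r - x r) * (x r * y r / 2 + n) + c * x r * y r * (sin (p r) - cos (p r))"
        by linarith
      then show "0 < ?f r" using w_pos[of "x r" "y r"] a by simp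
    qed
    then show ?thesis by simp
  qed
  have wsmall: "\<bar>w (x t) (y t) * ?C t\<bar> \<le> 2 * ?r t" if "t \<ge> t1" for t
  proof -
    have a: "0 < x t" "x t < y t" "x t < 1" "y t < 1" using A[of t] t1 that bnd[of t] by auto
    have "x t ^ n \<le> x t ^ 1" "y t ^ n \<le> y t ^ 1" using a n_ge_1 by (intro power_decreasing; simp)+
    then have "w (x t) (y t) \<le> x t * y t * 1"
      unfolding w_def using a by (intro mult_mono) auto
    also have "\<dots> \<le> ?r t"
    proof -
      have "2 * (x t * y t) \<le> ?r t" using sum_squares_bound[of "x t" "y t"] by (simp add: mult.assoc)
      moreover have "0 < x t * y t" using a by simp
      ultimately show ?thesis by linarith
    qed
    finally have "w (x t) (y t) \<le> ?r t" .
    moreover have "\<bar>?C t\<bar> \<le> 2"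
      using abs_cos_le_one[of "p t"] abs_sin_le_one[of "p t"] by linarith
    ultimately have "w (x t) (y t) * \<bar>?C t\<bar> \<le> ?r t * 2"
      using w_pos[of "x t" "y t"] a by (intro mult_mono) auto
    then show ?thesis using w_pos[of "x t" "y t"] a by (simp add: abs_mult)
  qed
  \<comment> \<open>The flux strictly decreases and has values arbitrarily close to zero at late
    times. Once nonpositive it would stay below a negative constant.\<close>
  have Cpos: "?C t > 0" if t: "t \<ge> t1" for t
  proof (rule ccontr)
    assume "\<not> ?C t > 0"
    then have "w (x t) (y t) * ?C t \<le> 0" using A[of t] t t1 w_pos[of "x t" "y t"]
      by (intro mult_nonneg_nonpos) auto
    then have neg: "w (x (t+1)) (y (t+1)) * ?C (t+1) < 0" using dec[of t "t+1"] t by auto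
    let ?d = "- (w (x (t+1)) (y (t+1)) * ?C (t+1))"
    obtain s where s: "s > t + 1" "?r s < ?d / 2" using small'[of "t+1" "?d / 2"] neg t t1 by auto
    have "w (x s) (y s) * ?C s < - ?d" using dec[of "t+1" s] s t by auto
    then show False using wsmall[of s] s t by auto
  qed
  \<comment> \<open>So \<open>y - x\<close> cannot decrease, although it is bounded by the radius,
    which becomes arbitrarily small.\<close>
  obtain s where s: "s > t1" "?r s < (y t1 - x t1)\<^sup>2" using small'[of t1 "(y t1 - x t1)\<^sup>2"] A[of t1] t1 by auto
  have "y t1 - x t1 \<le> y s - x s"
  proof (rule DERIV_nonneg_mono[of t1 s "\<lambda>t. y t - x t"])
    fix r assume "t1 \<le> r" "r \<le> s"
    then show "((\<lambda>t. y t - x t) has_real_derivative x r * y r * ?C r) (at r)" using diff' A[of r] t1 by auto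
  next
    fix r assume "t1 < r" "r < s"
    then show "0 \<le> x r * y r * ?C r" using A[of r] t1 Cpos[of r] by (intro mult_nonneg_nonneg) auto
  qed (use s in auto)
  also have "y s - x s < y s" using A[of s] s t1 by auto
  finally have "(y t1 - x t1)\<^sup>2 < (y s)\<^sup>2" using A[of t1] t1 by (intro power_strict_mono) auto
  then show False using s(2) zero_le_power2[of "x s"] by linarith
qed

text \<open>At \<open>p = 0\<close> one has \<open>q = y > 0\<close>, at \<open>p = 3 pi / 2\<close>
  one has \<open>q = x > 0\<close>; with \<open>q <= 0\<close> neither angle can be passed.\<close>

lemma p_bounds:
  fixes p x y :: "real \<Rightarrow> real"
  assumes cont: "continuous_on {0..T} p" and p0: "p 0 = pi / 4"
    and pos: "\<And>t. 0 \<le> t \<Longrightarrow> t \<le> T \<Longrightarrow> x t > 0 \<and> y t > 0 \<and> q (x t) (y t) (p t) \<le> 0"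
    and t: "0 \<le> t" "t \<le> T"
  shows "0 < p t" "p t < 3 * pi / 2"
proof -
  have ct: "continuous_on {0..t} p" by (rule continuous_on_subset[OF cont]) (use t in \<open>simp add: atLeastatMost_subset_iff\<close>)
  have ne: "p s \<noteq> 0" "p s \<noteq> 3 * pi / 2" if "0 \<le> s" "s \<le> T" for s
  proof -
    have sc: "sin (3 * pi / 2) = -1" "cos (3 * pi / 2) = 0"
      using sin_3over2_pi cos_3over2_pi by (simp_all add: mult.commute)
    show "p s \<noteq> 0" using pos[OF that] by (auto simp: q_def)
    show "p s \<noteq> 3 * pi / 2"
    proof
      assume "p s = 3 * pi / 2"
      then have "sin (p s) = -1" "cos (p s) = 0" using sc by metis+
      then show False using pos[OF that] by (auto simp: q_def)
    qed
  qed
  show "0 < p t"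
  proof (rule ccontr)
    assume "\<not> 0 < p t"
    then obtain s where "0 \<le> s" "s \<le> t" "p s = 0"
      using IVT2'[of p t 0 0] ct t p0 by auto
    then show False using ne(1)[of s] t by auto
  qed
  show "p t < 3 * pi / 2"
  proof (rule ccontr)
    assume "\<not> p t < 3 * pi / 2"
    then obtain s where "0 \<le> s" "s \<le> t" "p s = 3 * pi / 2"
      using IVT'[of p 0 "3 * pi / 2" t] ct t p0 pi_gt_zero by auto
    then show False using ne(2)[of s] t by auto
  qed
qed

text \<open>Outside the critical radius \<open>h / |(x, y)|\<close> drops below a negative constant, and then \<open>x / y\<close> grows
  exponentially, by \<open>ratio'\<close>.\<close>

lemma no_stay_outside:
  assumes A: "\<And>t. t \<ge> t0 \<Longrightarrow> ode x y p t \<and> 0 < x t \<and> x t < y t \<and> q (x t) (y t) (p t) < 0"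
    and lo: "\<And>t. t \<ge> t0 \<Longrightarrow> RS\<^sup>2 \<le> (x t)\<^sup>2 + (y t)\<^sup>2"
  shows False
proof -
  define rho where "rho t = sqrt ((x t)\<^sup>2 + (y t)\<^sup>2)" for t
  \<comment> \<open>The cosine of the angle between position and normal; \<open>Q / rho\<close> is
    the matching sine.\<close>
  define r where "r t = h (x t) (y t) (p t) / rho t" for t
  define Q where "Q t = q (x t) (y t) (p t)" for t
  have Apos: "0 < x t" "0 < y t" "x t < y t" "Q t < 0" "ode x y p t" if "t \<ge> t0" for t
    using A[OF that] by (auto simp: Q_def)
  have rho_pos: "rho t > 0" if "t \<ge> t0" for t
    using Apos[OF that] by (simp add: rho_def add_pos_pos)
  have rho_sq: "(rho t)\<^sup>2 = (x t)\<^sup>2 + (y t)\<^sup>2" for t by (simp add: rho_def)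
  have rho_RS: "rho t \<ge> RS" if "t \<ge> t0" for t
    using lo[OF that] RS_pos unfolding rho_def by (intro real_le_rsqrt) auto
  define Rm where "Rm = rho t0"
  have Rm_pos: "Rm > 0" using rho_pos[of t0] by (simp add: Rm_def)
  have rho_Rm: "rho t \<le> Rm" if "t \<ge> t0" for t
  proof -
    have "(x t)\<^sup>2 + (y t)\<^sup>2 \<le> (x t0)\<^sup>2 + (y t0)\<^sup>2"
    proof (rule rho_antimono[where p = p])
      fix s assume "t0 \<le> s" "s \<le> t"
      then show "ode x y p s \<and> 0 < x s \<and> 0 < y s \<and> q (x s) (y s) (p s) \<le> 0"
        using A[of s] by auto
    qed (use that in auto)
    then show ?thesis by (simp add: Rm_def rho_def)
  qed
  have r_Q: "(r t)\<^sup>2 + (Q t / rho t)\<^sup>2 = 1" if "t \<ge> t0" for t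
  proof -
    have e: "(h (x t) (y t) (p t))\<^sup>2 + (Q t)\<^sup>2 = (rho t)\<^sup>2"
      using rho_qh[of "x t" "y t" "p t"] rho_sq[of t] by (simp add: Q_def)
    have "(r t)\<^sup>2 + (Q t / rho t)\<^sup>2 = ((h (x t) (y t) (p t))\<^sup>2 + (Q t)\<^sup>2) / (rho t)\<^sup>2"
      by (simp add: r_def power_divide add_divide_distrib)
    then show ?thesis using rho_pos[OF that] by (simp add: e)
  qed
  let ?D = "\<lambda>t. x t * y t * (c + h (x t) (y t) (p t) * (1 / 2 - (2 * n + 1) / (rho t)\<^sup>2)) - n * ((y t)\<^sup>2 - (x t)\<^sup>2) * Q t / (rho t)\<^sup>2"
  have r': "(r has_real_derivative Q t / rho t * ?D t) (at t)" if t: "t \<ge> t0" for t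
  proof -
    let ?h = "h (x t) (y t) (p t)" and ?K = "K (x t) (y t) (p t)"
    have o: "ode x y p t" using Apos[OF t] by simp
    have rho': "(rho has_real_derivative x t * y t * Q t / rho t) (at t)"
    proof -
      have "(rho has_real_derivative (2 * x t * y t * q (x t) (y t) (p t)) * (inverse (sqrt ((x t)\<^sup>2 + (y t)\<^sup>2)) / 2)) (at t)"
        unfolding rho_def using DERIV_chain2[OF DERIV_real_sqrt rho'[OF o]] rho_sq[of t] zero_less_power[OF rho_pos[OF t], of 2]
        by (simp add: mult.commute)
      then show ?thesis by (simp add: Q_def rho_def field_simps)
    qed
    have "(r has_real_derivative (?K * Q t * rho t - ?h * (x t * y t * Q t / rho t)) / (rho t * rho t)) (at t)"
      unfolding r_def using DERIV_divide[OF h'[OF o] rho'] rho_pos[OF t] by (simp add: Q_def)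
    moreover have "(?K * Q t * rho t - ?h * (x t * y t * Q t / rho t)) / (rho t * rho t)
        = Q t / rho t * ((rho t)\<^sup>2 * ?K - x t * y t * ?h) / (rho t)\<^sup>2"
      using rho_pos[OF t] by (simp add: field_simps power2_eq_square)
    moreover have "Q t / rho t * ((rho t)\<^sup>2 * ?K - x t * y t * ?h) / (rho t)\<^sup>2 = Q t / rho t * ?D t"
    proof -
      define R2 where "R2 = (rho t)\<^sup>2"
      have R2: "R2 > 0" using rho_pos[OF t] by (simp add: R2_def)
      have "R2 * ?K = R2 * x t * y t * (c + ?h / 2) - n * (2 * x t * y t * ?h + ((y t)\<^sup>2 - (x t)\<^sup>2) * Q t)"
        using K_qh[of "x t" "y t" "p t"] by (simp add: R2_def rho_sq Q_def)
      moreover have "R2 * (x t * y t * (c + ?h * (1 / 2 - (2 * n + 1) / R2)) - n * ((y t)\<^sup>2 - (x t)\<^sup>2) * Q t / R2)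
          = R2 * x t * y t * (c + ?h / 2) - x t * y t * ?h * (2 * n + 1) - n * ((y t)\<^sup>2 - (x t)\<^sup>2) * Q t"
        using R2 by (simp add: field_simps)
      ultimately have "(rho t)\<^sup>2 * ?K - x t * y t * ?h = (rho t)\<^sup>2 * ?D t"
        unfolding R2_def[symmetric] by (simp add: algebra_simps)
      then show ?thesis using rho_pos[OF t] by simp
    qed
    ultimately show ?thesis by simp
  qed
  \<comment> \<open>Here \<open>rho >= RS\<close> enters: the sphere equation and
    \<open>RS_mono\<close> bound \<open>(2 n + 1) / rho^2\<close> by
    \<open>1 / 2 + c / rho\<close>.\<close>
  have fac: "c + h (x t) (y t) (p t) * (1 / 2 - (2 * n + 1) / (rho t)\<^sup>2) \<ge> c - c * r t"
    if t: "t \<ge> t0" and r0: "r t \<ge> 0" for t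
  proof -
    have "(2 * n + 1) \<le> (rho t)\<^sup>2 / 2 + c * rho t"
      using RS_mono[of RS "rho t"] RS_eq RS_pos rho_RS[OF t] by auto
    then have "(2 * n + 1) / (rho t)\<^sup>2 \<le> ((rho t)\<^sup>2 / 2 + c * rho t) / (rho t)\<^sup>2"
      by (intro divide_right_mono) auto
    also have "\<dots> = 1 / 2 + c / rho t" using rho_pos[OF t] by (simp add: field_simps power2_eq_square)
    finally have "1 / 2 - (2 * n + 1) / (rho t)\<^sup>2 \<ge> - (c / rho t)" by simp
    moreover have "h (x t) (y t) (p t) \<ge> 0" using r0 rho_pos[OF t] by (simp add: r_def zero_le_divide_iff)
    ultimately have "h (x t) (y t) (p t) * (1 / 2 - (2 * n + 1) / (rho t)\<^sup>2) \<ge> h (x t) (y t) (p t) * (- (c / rho t))"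
      by (rule mult_left_mono)
    then show ?thesis by (simp add: r_def mult.commute)
  qed
  \<comment> \<open>The two terms of \<open>?D\<close> carry the factors \<open>x y\<close> and
    \<open>y^2 - x^2\<close>, which cannot both be small.\<close>
  have area: "x t * y t + ((y t)\<^sup>2 - (x t)\<^sup>2) \<ge> RS\<^sup>2 / 2" if t: "t \<ge> t0" for t
  proof -
    have "x t * x t \<le> x t * y t" using Apos[OF t] by (intro mult_left_mono) auto
    moreover have "(x t)\<^sup>2 \<le> (y t)\<^sup>2" using Apos[OF t] by (intro power_mono) auto
    ultimately show ?thesis using lo[OF t] by (simp add: power2_eq_square)
  qed
  have rlt1: "r t0 < 1"
  proof (rule ccontr)
    assume "\<not> r t0 < 1"
    then have "(r t0)\<^sup>2 \<ge> 1" using one_le_power[of "r t0" 2] by auto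
    moreover have "(Q t0 / rho t0)\<^sup>2 > 0" using Apos[of t0] rho_pos[of t0] by simp
    ultimately show False using r_Q[OF order_refl] by linarith
  qed
  \<comment> \<open>A barrier for \<open>r\<close> strictly below 1: as long as \<open>r\<close> is
    not close to -1 either, \<open>Q / rho\<close> stays away from zero.\<close>
  define c0 where "c0 = max 0 (r t0)"
  have c0: "0 \<le> c0" "c0 < 1" using rlt1 by (auto simp: c0_def)
  have r_c0: "r t \<le> c0" if t: "t \<ge> t0" for t
  proof (rule barrier_le[OF t r'])
    fix s assume s: "t0 \<le> s" "s \<le> t" "c0 < r s"
    have rs1: "r s \<le> 1" using r_Q[of s] s power2_le_imp_le[of "r s" 1] zero_le_power2[of "Q s / rho s"] by auto
    have "0 \<le> c - c * r s" using rs1 c_pos by simp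
    then have "0 \<le> x s * y s * (c + h (x s) (y s) (p s) * (1 / 2 - (2 * n + 1) / (rho s)\<^sup>2))"
      using fac[of s] s c0 Apos[of s] by (intro mult_nonneg_nonneg) auto
    moreover have "n * ((y s)\<^sup>2 - (x s)\<^sup>2) * Q s / (rho s)\<^sup>2 \<le> 0"
    proof -
      have "(x s)\<^sup>2 \<le> (y s)\<^sup>2" using Apos[of s] s by (intro power_mono) auto
      then show ?thesis using Apos[of s] s by (intro divide_nonpos_nonneg mult_nonneg_nonpos mult_nonneg_nonneg) auto
    qed
    ultimately show "Q s / rho s * ?D s \<le> 0"
      using Apos[of s] rho_pos[of s] s by (intro mult_nonpos_nonneg divide_nonpos_pos) auto
  qed (auto simp: c0_def)
  \<comment> \<open>For \<open>r >= - eta\<close> this choice gives \<open>h >= - c / 2\<close>, so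
    that the bracket in \<open>?D\<close> stays at least \<open>c / 2\<close> even for negative
    \<open>h\<close>.\<close>
  define eta where "eta = min (1 / 2) (c / (2 * Rm))"
  have eta: "0 < eta" "eta \<le> 1 / 2" "eta * Rm \<le> c / 2"
    using c_pos Rm_pos by (auto simp: eta_def min_def field_simps)
  define c4 where "c4 = min (c * (1 - c0)) (c / 2)"
  have c4: "c4 > 0" using c_pos c0 by (simp add: c4_def)
  define c1 where "c1 = sqrt (1 - (max c0 (1 / 2))\<^sup>2)"
  have c1: "c1 > 0" "c1\<^sup>2 = 1 - (max c0 (1 / 2))\<^sup>2"
  proof -
    have "(max c0 (1 / 2))\<^sup>2 < 1\<^sup>2" using c0 by (intro power_strict_mono) auto
    then show "c1 > 0" "c1\<^sup>2 = 1 - (max c0 (1 / 2))\<^sup>2" by (auto simp: c1_def)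
  qed
  define c5 where "c5 = min c4 (c1 / Rm)"
  have c5: "c5 > 0" using c4 c1 Rm_pos by (simp add: c5_def)
  define d where "d = c1 * (c5 * (RS\<^sup>2 / 2))"
  have d: "d > 0" using c1 c5 RS_pos by (simp add: d_def)
  have key: "Q t / rho t * ?D t \<le> - d" if t: "t \<ge> t0" and rt: "r t \<ge> - eta" for t
  proof -
    have "(r t)\<^sup>2 \<le> (max c0 (1 / 2))\<^sup>2"
      using rt r_c0[OF t] eta by (intro abs_le_square_iff[THEN iffD1]) auto
    then have "(Q t / rho t)\<^sup>2 \<ge> c1\<^sup>2" using r_Q[OF t] c1 by simp
    then have "c1 \<le> \<bar>Q t / rho t\<bar>" using c1 abs_le_square_iff[of c1 "Q t / rho t"] by simp
    then have Qc: "Q t / rho t \<le> - c1" using Apos[OF t] rho_pos[OF t] by (simp add: abs_divide)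
    have f1: "c + h (x t) (y t) (p t) * (1 / 2 - (2 * n + 1) / (rho t)\<^sup>2) \<ge> c4"
    proof (cases "r t \<ge> 0")
      case True
      have "c - c * r t \<ge> c * (1 - c0)" using r_c0[OF t] c_pos by (simp add: algebra_simps)
      then show ?thesis using fac[OF t True] by (simp add: c4_def)
    next
      case False
      let ?h = "h (x t) (y t) (p t)"
      have hr: "?h = r t * rho t" using rho_pos[OF t] by (simp add: r_def)
      have h0: "?h \<le> 0" using False rho_pos[OF t] by (simp add: hr mult_nonpos_nonneg)
      have "- ?h = (- r t) * rho t" by (simp add: hr)
      also have "\<dots> \<le> eta * Rm" using rt rho_Rm[OF t] rho_pos[OF t] eta by (intro mult_mono) auto
      finally have "- ?h \<le> c / 2" using eta by simp
      moreover have "?h * (1 / 2 - (2 * n + 1) / (rho t)\<^sup>2) \<ge> ?h * (1 / 2)"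
        using h0 by (intro mult_left_mono_neg) auto
      ultimately have "c + ?h * (1 / 2 - (2 * n + 1) / (rho t)\<^sup>2) \<ge> c / 2" using c_pos by simp
      moreover have "c4 \<le> c / 2" by (simp add: c4_def)
      ultimately show ?thesis by linarith
    qed
    have sq: "(x t)\<^sup>2 \<le> (y t)\<^sup>2" using Apos[OF t] by (intro power_mono) auto
    have f2: "- (n * ((y t)\<^sup>2 - (x t)\<^sup>2) * Q t / (rho t)\<^sup>2) \<ge> c5 * ((y t)\<^sup>2 - (x t)\<^sup>2)"
    proof -
      have "c5 \<le> c1 / Rm" by (simp add: c5_def)
      also have "\<dots> \<le> c1 / rho t" using rho_Rm[OF t] rho_pos[OF t] c1 by (intro divide_left_mono) auto
      also have "\<dots> \<le> (- Q t / rho t) / rho t" using Qc rho_pos[OF t] by (intro divide_right_mono) auto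
      also have "\<dots> \<le> n * ((- Q t / rho t) / rho t)"
      proof -
        have "0 \<le> (- Q t / rho t) / rho t"
          using Apos[OF t] rho_pos[OF t] by (intro divide_nonneg_nonneg) auto
        then have "1 * ((- Q t / rho t) / rho t) \<le> n * ((- Q t / rho t) / rho t)"
          using n_ge_1 by (intro mult_right_mono) auto
        then show ?thesis by simp
      qed
      finally have "c5 * ((y t)\<^sup>2 - (x t)\<^sup>2) \<le> n * ((- Q t / rho t) / rho t) * ((y t)\<^sup>2 - (x t)\<^sup>2)"
        using sq by (intro mult_right_mono) auto
      then show ?thesis by (simp add: power2_eq_square mult.commute mult.left_commute)
    qed
    have f3: "c5 * (x t * y t) \<le> x t * y t * (c + h (x t) (y t) (p t) * (1 / 2 - (2 * n + 1) / (rho t)\<^sup>2))"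
    proof -
      have "x t * y t * c5 \<le> x t * y t * (c + h (x t) (y t) (p t) * (1 / 2 - (2 * n + 1) / (rho t)\<^sup>2))"
        using f1 Apos[OF t] by (intro mult_left_mono) (auto simp: c5_def)
      then show ?thesis by (simp add: mult.commute)
    qed
    have "c5 * (RS\<^sup>2 / 2) \<le> c5 * (x t * y t + ((y t)\<^sup>2 - (x t)\<^sup>2))"
      using area[OF t] c5 by (intro mult_left_mono) auto
    also have "\<dots> \<le> ?D t" using f2 f3 by (simp add: distrib_left)
    finally have D: "c5 * (RS\<^sup>2 / 2) \<le> ?D t" .
    have D0: "0 \<le> c5 * (RS\<^sup>2 / 2)" using c5 by simp
    have "c1 * (c5 * (RS\<^sup>2 / 2)) \<le> (- (Q t / rho t)) * ?D t"
      using Qc D D0 c1 by (intro mult_mono) auto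
    then have "d \<le> - (Q t / rho t * ?D t)" unfolding d_def by (simp only: mult_minus_left)
    then show ?thesis by linarith
  qed
  \<comment> \<open>If \<open>r >= - eta\<close> held forever, falling at rate \<open>d\<close>
    would take \<open>r\<close> below -1.\<close>
  obtain t1 where t1: "t1 \<ge> t0" "r t1 < - eta"
  proof (rule ccontr)
    assume "\<not> thesis"
    then have ge: "r t \<ge> - eta" if "t \<ge> t0" for t using that(1) \<open>\<And>t1. t0 \<le> t1 \<Longrightarrow> r t1 < - eta \<Longrightarrow> thesis\<close> by force
    define T where "T = t0 + 2 / d + 1"
    have T: "t0 \<le> T" using d by (simp add: T_def)
    have "- r t0 - d * t0 \<le> - r T - d * T"
    proof (rule DERIV_nonneg_mono[OF T, where f' = "\<lambda>t. - (Q t / rho t * ?D t) - d"])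
      fix s assume "t0 \<le> s"
      then show "((\<lambda>t. - r t - d * t) has_real_derivative - (Q s / rho s * ?D s) - d) (at s)"
        by (intro DERIV_diff DERIV_minus r' DERIV_cmult_Id)
    next
      fix s assume "t0 < s"
      then have "Q s / rho s * ?D s \<le> - d" by (intro key ge) auto
      then show "0 \<le> - (Q s / rho s * ?D s) - d" by linarith
    qed
    moreover have "d * T = d * t0 + 2 + d" using d by (simp add: T_def algebra_simps)
    moreover have "r t0 \<le> 1" using rlt1 by simp
    moreover have "r T \<ge> - 1" using ge[OF T] eta by simp
    ultimately show False using d by simp
  qed
  have r_eta: "r t \<le> - eta" if "t \<ge> t1" for t
  proof (rule barrier_le[OF that])
    fix s assume "t1 \<le> s"
    then show "(r has_real_derivative Q s / rho s * ?D s) (at s)" using r' t1 by auto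
    assume "r s > - eta"
    then show "Q s / rho s * ?D s \<le> 0" using key[of s] \<open>t1 \<le> s\<close> t1 d by auto
  qed (use t1 in auto)
  \<comment> \<open>The quotient stays below 1, whereas \<open>- h >= eta RS\<close> makes it grow
    at a rate of at least \<open>g\<close>.\<close>
  define z where "z t = x t / y t" for t
  have z: "0 < z t" "z t < 1" if "t \<ge> t0" for t using Apos[OF that] by (auto simp: z_def)
  define g where "g = eta * RS * z t1"
  have g: "g > 0" using eta RS_pos z[of t1] t1 by (simp add: g_def)
  have z': "(z has_real_derivative - z t * h (x t) (y t) (p t)) (at t)" if "t \<ge> t0" for t
    unfolding z_def using ratio' Apos[OF that] by simp
  have hneg: "- h (x t) (y t) (p t) \<ge> eta * RS" if "t \<ge> t1" for t
  proof -
    have tt: "t \<ge> t0" using that t1 by auto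
    have "eta * RS \<le> (- r t) * rho t"
      using r_eta[OF that] rho_RS[OF tt] eta RS_pos by (intro mult_mono) auto
    then show ?thesis using rho_pos[OF tt] by (simp add: r_def)
  qed
  have zmono: "z t1 \<le> z t" if "t \<ge> t1" for t
  proof (rule DERIV_nonneg_mono[OF that z'])
    fix s assume "t1 < s" "s < t"
    have "0 \<le> eta * RS" using eta RS_pos by simp
    then have "0 \<le> - h (x s) (y s) (p s)" using hneg[of s] \<open>t1 < s\<close> by linarith
    then have "0 \<le> z s * - h (x s) (y s) (p s)" using z[of s] \<open>t1 < s\<close> t1 by (intro mult_nonneg_nonneg) auto
    then show "0 \<le> - z s * h (x s) (y s) (p s)" by simp
  qed (use t1 in auto)
  define T where "T = t1 + 1 / g"
  have T: "t1 \<le> T" using g by (simp add: T_def)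
  have "z t1 - g * t1 \<le> z T - g * T"
  proof (rule DERIV_nonneg_mono[OF T, where f' = "\<lambda>t. - z t * h (x t) (y t) (p t) - g"])
    fix s assume "t1 < s" "s < T"
    have "z t1 * (eta * RS) \<le> z s * (- h (x s) (y s) (p s))"
      using zmono[of s] hneg[of s] \<open>t1 < s\<close> z[of s] t1 eta RS_pos by (intro mult_mono) auto
    then show "0 \<le> - z s * h (x s) (y s) (p s) - g" by (simp add: g_def mult.commute)
  qed (use t1 in \<open>auto intro!: derivative_eq_intros z'\<close>)
  moreover have "g * T = g * t1 + 1" using g by (simp add: T_def algebra_simps)
  ultimately show False using z[of T] z[of t1] T t1 by auto
qed

lemma le_divide_mult: "0 < k \<Longrightarrow> 0 < d \<Longrightarrow> z \<le> a / (k * d) \<Longrightarrow> z * d \<le> a / k" for a d k z :: real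
  by (simp add: field_simps)

lemma ode_continuous:
  assumes "\<And>t. a \<le> t \<Longrightarrow> t \<le> b \<Longrightarrow> ode x y p t"
  shows "continuous_on {a..b} x" "continuous_on {a..b} y" "continuous_on {a..b} p"
  by (intro continuous_at_imp_continuous_on ballI DERIV_isCont[OF x'[OF assms]] DERIV_isCont[OF y'[OF assms]]
      DERIV_isCont[OF p'[OF assms]]; simp)+

text \<open>The leading part is \<open>- x y (sin^2 p + n cos^2 p)\<close>, at most
  \<open>- x y\<close> because \<open>n >= 1\<close>; the two remainders carry an extra factor
  \<open>x\<close> and are at most \<open>x y / 4\<close> each. Since \<open>x y dt\<close> is arc
  length and \<open>x sin p\<close> is bounded by \<open>x\<close>, this limits the length of curve
  that fits close to the axis.\<close>

lemma neck_xs'_le: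
  assumes pos: "0 < x" "0 < y" and y: "r0 / 2 \<le> y" and R: "x\<^sup>2 + y\<^sup>2 \<le> R\<^sup>2"
    and x: "x \<le> x1" and c1: "x1 \<le> 1" "x1 * (c + 1) \<le> 1 / 4" "x1 * (R\<^sup>2 / 2 + n) \<le> r0 / 8"
  shows "- (x * y) * (sin p)\<^sup>2 + x * cos p * K x y p \<le> - (x * y) / 2"
proof -
  have a1: "x * cos p * (c + x / 2 * cos p) \<le> 1 / 4"
  proof -
    have "\<bar>c + x / 2 * cos p\<bar> \<le> c + 1"
      using c_pos pos x c1 abs_cos_le_one[of p] mult_mono[of "x / 2" 1 "\<bar>cos p\<bar>" 1]
      by (intro order_trans[OF abs_triangle_ineq]) (simp add: abs_mult)
    then have "\<bar>x * cos p * (c + x / 2 * cos p)\<bar> \<le> x1 * 1 * (c + 1)"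
      unfolding abs_mult using pos x c_pos by (intro mult_mono) auto
    then show ?thesis using c1 by simp
  qed
  have a2: "x * (y\<^sup>2 / 2 - n) * (sin p * cos p) \<le> y / 4"
  proof -
    have "\<bar>sin p * cos p\<bar> \<le> 1 * 1" unfolding abs_mult by (intro mult_mono) auto
    moreover have "\<bar>y\<^sup>2 / 2 - n\<bar> \<le> R\<^sup>2 / 2 + n"
    proof -
      have "y\<^sup>2 \<le> R\<^sup>2" using R zero_le_power2[of x] by linarith
      then show ?thesis using zero_le_power2[of y] by (simp add: abs_le_iff)
    qed
    ultimately have "\<bar>x * (y\<^sup>2 / 2 - n) * (sin p * cos p)\<bar> \<le> x1 * (R\<^sup>2 / 2 + n) * 1"
      unfolding abs_mult using pos x by (intro mult_mono) (auto simp: abs_mult)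
    then show ?thesis using c1 y by simp
  qed
  have sc: "(sin p)\<^sup>2 + n * (cos p)\<^sup>2 \<ge> 1"
  proof -
    have "1 * (cos p)\<^sup>2 \<le> n * (cos p)\<^sup>2" using n_ge_1 by (intro mult_right_mono) auto
    then show ?thesis using sin_cos_squared_add[of p] by linarith
  qed
  have "- (x * y) * (sin p)\<^sup>2 + x * cos p * K x y p
     = (x * y) * (- ((sin p)\<^sup>2 + n * (cos p)\<^sup>2) + x * cos p * (c + x / 2 * cos p)) + x * (x * (y\<^sup>2 / 2 - n) * (sin p * cos p))"
    by (simp add: K_def field_simps power2_eq_square)
  also have "\<dots> \<le> (x * y) * (- 1 + 1 / 4) + x * (y / 4)"
    using a1 a2 sc pos by (intro add_mono mult_left_mono) auto
  also have "\<dots> = - (x * y) / 2" by simp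
  finally show ?thesis .
qed

text \<open>A trajectory with \<open>q < 0\<close> that comes close to the axis \<open>x = 0\<close> inside the critical radius stays above the
  diagonal: \<open>w q\<close> controls the tangential part, and \<open>x sin p\<close> decreases at a definite rate near the axis.\<close>

lemma neck:
  assumes r0: "r0 > 0"
  shows "\<exists>\<delta>>0. \<forall>x y p T t1. T \<le> t1 \<longrightarrow> (\<forall>t. T \<le> t \<and> t \<le> t1 \<longrightarrow> ode x y p t \<and> 0 < x t \<and> 0 < y t \<and> q (x t) (y t) (p t) < 0)
     \<longrightarrow> x T < \<delta> \<longrightarrow> r0\<^sup>2 \<le> (x T)\<^sup>2 + (y T)\<^sup>2 \<longrightarrow> (x T)\<^sup>2 + (y T)\<^sup>2 \<le> (RS + \<delta>)\<^sup>2 \<longrightarrow> x t1 < y t1"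
proof -
  define R where "R = RS + 1"
  have R: "R \<ge> 1" using RS_pos by (simp add: R_def)
  \<comment> \<open>The third and fourth entries are what \<open>neck_xs'_le\<close> asks for,
    \<open>r0 / 32\<close> keeps \<open>y\<close> above \<open>r0 / 2\<close> in
    \<open>ylow\<close>, and \<open>RS / 4\<close> bounds \<open>h\<close> while the curve moves
    away from the axis.\<close>
  define x1 where "x1 = Min {1, r0 / 32, 1 / (4 * (c + 1)), r0 / (8 * (R\<^sup>2 / 2 + n)), RS / 4}"
  have Rn: "R\<^sup>2 / 2 + n > 0" using n_ge_1 by (simp add: add_nonneg_pos)
  have x1: "x1 > 0" "x1 \<le> 1" "x1 \<le> r0 / 32" "x1 \<le> RS / 4" "x1 * (c + 1) \<le> 1 / 4" "x1 * (R\<^sup>2 / 2 + n) \<le> r0 / 8"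
  proof -
    show "x1 > 0" using r0 c_pos Rn RS_pos by (simp add: x1_def)
    show "x1 \<le> 1" "x1 \<le> r0 / 32" "x1 \<le> RS / 4" unfolding x1_def by (rule Min_le; simp)+
    have "x1 \<le> 1 / (4 * (c + 1))" unfolding x1_def by (rule Min_le; simp)
    then show "x1 * (c + 1) \<le> 1 / 4" using c_pos by (intro le_divide_mult) auto
    have "x1 \<le> r0 / (8 * (R\<^sup>2 / 2 + n))" unfolding x1_def by (rule Min_le; simp)
    then show "x1 * (R\<^sup>2 / 2 + n) \<le> r0 / 8" using Rn by (intro le_divide_mult) auto
  qed
  \<comment> \<open>Where \<open>y >= r0 / 2\<close> and the radius is at most \<open>R\<close>,
    \<open>w >= k0 x^n\<close> holds; for \<open>sin p <= 0\<close> this will make the derivative of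
    \<open>w q\<close> at least \<open>k1 x^n\<close> times that of \<open>x\<close>.\<close>
  define k0 where "k0 = (r0 / 2) ^ n * exp (- (R\<^sup>2) / 4)"
  define k1 where "k1 = k0 * (c * RS / 2)"
  have k: "k0 > 0" "k1 > 0" using r0 c_pos RS_pos by (auto simp: k0_def k1_def)
  define Wm where "Wm = R ^ n * R ^ n"
  define C1 where "C1 = RS + 1 + c"
  have W: "Wm > 0" "C1 > 0" using R RS_pos c_pos by (auto simp: Wm_def C1_def)
  \<comment> \<open>\<open>A * \<delta>\<close> will bound the sum of all losses, while
    \<open>Bc\<close> is the gain of \<open>w q\<close> as \<open>x\<close> grows to
    \<open>x1\<close>. The choice of \<delta> makes the gain prevail.\<close>
  define A where "A = Wm * R + k1 + 4 * Wm * C1"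
  have A: "A > 0" using W k R by (simp add: A_def add_pos_pos)
  define Bc where "Bc = k1 * x1 ^ Suc n / Suc n"
  have Bc: "Bc > 0" using k x1 by (simp add: Bc_def)
  define \<delta> where "\<delta> = Min {1, x1, c * RS / (4 * (RS + 1)), Bc / (2 * A)}"
  have d: "\<delta> > 0" "\<delta> \<le> 1" "\<delta> \<le> x1" "(RS + 1) * \<delta> \<le> c * RS / 4" "A * \<delta> < Bc"
  proof -
    show "\<delta> > 0" using x1 c_pos RS_pos Bc A by (simp add: \<delta>_def)
    show "\<delta> \<le> 1" "\<delta> \<le> x1" unfolding \<delta>_def by (rule Min_le; simp)+
    have "\<delta> \<le> c * RS / (4 * (RS + 1))" unfolding \<delta>_def by (rule Min_le; simp)
    then have "\<delta> * (RS + 1) \<le> c * RS / 4" using RS_pos by (intro le_divide_mult) auto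
    then show "(RS + 1) * \<delta> \<le> c * RS / 4" by (simp add: mult.commute)
    have "\<delta> \<le> Bc / (2 * A)" unfolding \<delta>_def by (rule Min_le; simp)
    then have "\<delta> * A \<le> Bc / 2" using A by (intro le_divide_mult) auto
    then show "A * \<delta> < Bc" using Bc by (simp add: mult.commute)
  qed
  show ?thesis
  proof (intro exI[of _ \<delta>] conjI d(1) allI impI)
    fix x y p :: "real \<Rightarrow> real" and T t1
    assume T: "T \<le> t1" and all: "\<forall>t. T \<le> t \<and> t \<le> t1 \<longrightarrow> ode x y p t \<and> 0 < x t \<and> 0 < y t \<and> q (x t) (y t) (p t) < 0"
      and xT: "x T < \<delta>" and lo: "r0\<^sup>2 \<le> (x T)\<^sup>2 + (y T)\<^sup>2" and hi: "(x T)\<^sup>2 + (y T)\<^sup>2 \<le> (RS + \<delta>)\<^sup>2"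
    have o: "ode x y p t" "0 < x t" "0 < y t" "q (x t) (y t) (p t) < 0" if "T \<le> t" "t \<le> t1" for t
      using all that by auto
    have rho: "(x t)\<^sup>2 + (y t)\<^sup>2 \<le> (RS + \<delta>)\<^sup>2" if "T \<le> t" "t \<le> t1" for t
    proof -
      have "(x t)\<^sup>2 + (y t)\<^sup>2 \<le> (x T)\<^sup>2 + (y T)\<^sup>2"
      proof (rule rho_antimono[where p = p])
        fix s assume "T \<le> s" "s \<le> t"
        then show "ode x y p s \<and> 0 < x s \<and> 0 < y s \<and> q (x s) (y s) (p s) \<le> 0"
          using o[of s] that by auto
      qed (use that in auto)
      then show ?thesis using hi by simp
    qed
    have rhoR: "(x t)\<^sup>2 + (y t)\<^sup>2 \<le> R\<^sup>2" if "T \<le> t" "t \<le> t1" for t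
    proof -
      have "(RS + \<delta>)\<^sup>2 \<le> R\<^sup>2" using RS_pos d unfolding R_def by (intro power_mono) auto
      then show ?thesis using rho[OF that] by linarith
    qed
    have cx: "continuous_on {T..t1} x" "continuous_on {T..t1} y"
      using ode_continuous[of T t1 x y p] o by auto
    define V where "V t = x t * sin (p t)" for t
    have V': "(V has_real_derivative - (x t * y t) * (sin (p t))\<^sup>2 + x t * cos (p t) * K (x t) (y t) (p t)) (at t)"
      if "T \<le> t" "t \<le> t1" for t
      unfolding V_def by (rule xs'[OF o(1)[OF that]])
    have Vabs: "\<bar>V t\<bar> \<le> x t" if "T \<le> t" "t \<le> t1" for t
      using o(2)[OF that] abs_sin_le_one[of "p t"] by (simp add: V_def abs_mult)
    have Vle: "- (x t * y t) * (sin (p t))\<^sup>2 + x t * cos (p t) * K (x t) (y t) (p t) \<le> - (x t * y t) / 2"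
      if "T \<le> t" "t \<le> t1" "x t \<le> x1" "r0 / 2 \<le> y t" for t
      by (rule neck_xs'_le[of _ _ r0 R x1]) (use that o rhoR x1 in auto)
    have yT: "y T \<ge> 3 * r0 / 4"
    proof -
      have "(x T)\<^sup>2 \<le> (r0 / 16)\<^sup>2" using o(2)[of T] T xT d x1 by (intro power_mono) auto
      moreover have "(3 * r0 / 4)\<^sup>2 = 9 / 16 * r0\<^sup>2" "(r0 / 16)\<^sup>2 = r0\<^sup>2 / 256"
        by (simp_all add: power2_eq_square)
      ultimately have "(3 * r0 / 4)\<^sup>2 \<le> (y T)\<^sup>2"
        using lo zero_le_power2[of r0] by linarith
      moreover have "0 \<le> y T" using o(3)[of T] T by simp
      ultimately show ?thesis by (rule power2_le_imp_le)
    qed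
    \<comment> \<open>\<open>y\<close> falls at most at the speed \<open>x y\<close>, while
      \<open>2 V\<close> falls at least that fast; so \<open>y - 2 V\<close> is nondecreasing, and
      \<open>V\<close> varies by at most \<open>2 x1\<close>.\<close>
    have ylow: "y t \<ge> 3 * r0 / 4 - 4 * x1"
      if t: "T \<le> t" "t \<le> t1" and le: "\<And>s. T \<le> s \<Longrightarrow> s < t \<Longrightarrow> x s \<le> x1 \<and> r0 / 2 \<le> y s" and xt: "x t \<le> x1" for t
    proof -
      have "y T - 2 * V T \<le> y t - 2 * V t"
      proof (rule DERIV_nonneg_mono[OF t(1)])
        fix s assume s: "T \<le> s" "s \<le> t"
        then show "((\<lambda>t. y t - 2 * V t) has_real_derivative x s * y s * cos (p s) - 2 * (- (x s * y s) * (sin (p s))\<^sup>2 + x s * cos (p s) * K (x s) (y s) (p s))) (at s)"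
          using t by (intro DERIV_diff DERIV_cmult y' V' o) auto
      next
        fix s assume s: "T < s" "s < t"
        have "x s * y s * cos (p s) \<ge> x s * y s * (-1)"
          using o(2,3)[of s] s t by (intro mult_left_mono) auto
        then show "0 \<le> x s * y s * cos (p s) - 2 * (- (x s * y s) * (sin (p s))\<^sup>2 + x s * cos (p s) * K (x s) (y s) (p s))"
          using Vle[of s] le[of s] s t by auto
      qed
      moreover have "\<bar>V T\<bar> \<le> x1" "\<bar>V t\<bar> \<le> x1" using Vabs[of T] Vabs[OF t] xT d T xt by auto
      ultimately show ?thesis using yT by linarith
    qed
    show "x t1 < y t1"
    proof (rule ccontr)
      assume n: "\<not> x t1 < y t1"
      have ex: "\<exists>t2. T < t2 \<and> t2 \<le> t1 \<and> x t2 = x1 \<and> (\<forall>s. T \<le> s \<longrightarrow> s < t2 \<longrightarrow> x s < x1 \<and> r0 / 2 < y s)"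
      proof -
        \<comment> \<open>\<open>g\<close> reaches zero when \<open>x\<close> gets to
          \<open>x1\<close> or \<open>y\<close> down to \<open>r0 / 2\<close>; \<open>ylow\<close>
          rules out the second, so the curve leaves the strip through \<open>x = x1\<close>.\<close>
        define g where "g t = max (x t - x1) (r0 / 2 - y t)" for t
        have "continuous_on {T..t1} g" unfolding g_def by (intro continuous_intros cx)
        moreover have "g T < 0" using xT d yT r0 by (simp add: g_def)
        moreover have "g t1 \<ge> 0" using n x1 r0 by (auto simp: g_def max_def)
        ultimately obtain t2 where t2: "T < t2" "t2 \<le> t1" "g t2 = 0" and lt: "\<And>s. T \<le> s \<Longrightarrow> s < t2 \<Longrightarrow> g s < 0"
          using first_hit[of T t1 g 0] T by auto
        have lt': "x s < x1 \<and> r0 / 2 < y s" if "T \<le> s" "s < t2" for s using lt[OF that] by (auto simp: g_def)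
        have "x t2 \<le> x1" using t2(3) by (auto simp: g_def max_def split: if_splits)
        then have "y t2 \<ge> 3 * r0 / 4 - 4 * x1" using t2 lt' by (intro ylow) (auto simp: less_imp_le)
        then have "r0 / 2 - y t2 < 0" using x1 r0 by auto
        then have "x t2 = x1" using t2(3) by (auto simp: g_def max_def split: if_splits)
        then show ?thesis using t2 lt' by blast
      qed
      then obtain t2 where t2: "T < t2" "t2 \<le> t1" "x t2 = x1"
        and lt: "\<And>s. T \<le> s \<Longrightarrow> s < t2 \<Longrightarrow> x s < x1 \<and> r0 / 2 < y s" by auto
      define b where "b = 2 * Wm * (C1 * \<delta>)"
      have b0: "b > 0" using W d by (simp add: b_def)
      let ?B = "\<lambda>t. 2 * n + 1 - ((x t)\<^sup>2 + (y t)\<^sup>2) / 2 - c * h (x t) (y t) (p t)"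
      let ?w = "\<lambda>t. w (x t) (y t)"
      let ?V' = "\<lambda>t. - (x t * y t) * (sin (p t))\<^sup>2 + x t * cos (p t) * K (x t) (y t) (p t)"
      \<comment> \<open>\<open>Z\<close> is nondecreasing up to \<open>t2\<close>: for
        \<open>sin p <= 0\<close> the growth of \<open>w q\<close> pays for the power of
        \<open>x\<close>; for \<open>sin p > 0\<close> the possible loss of \<open>w q\<close>, of
        order \<delta>, is paid by \<open>- b V\<close>. But \<open>Z T\<close> is nearly zero,
        while \<open>q < 0\<close> forces \<open>Z t2 < - Bc + b\<close>.\<close>
      define Z where "Z t = ?w t * q (x t) (y t) (p t) - k1 * (x t ^ Suc n / Suc n) - b * V t" for t
      have "Z T \<le> Z t2"
      proof (rule DERIV_nonneg_mono[of T t2 Z "\<lambda>t. ?w t * (x t * y t) * ?B t - k1 * (x t ^ n * - (x t * y t * sin (p t))) - b * ?V' t"])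
        show "T \<le> t2" using t2 by simp
        fix t assume t: "T \<le> t" "t \<le> t2"
        then have oo: "ode x y p t" using o t2 by auto
        have "((\<lambda>t. x t ^ Suc n / Suc n) has_real_derivative x t ^ n * - (x t * y t * sin (p t))) (at t)"
        proof -
          have "((\<lambda>t. x t ^ Suc n) has_real_derivative Suc n * (x t ^ n * - (x t * y t * sin (p t)))) (at t)"
            using DERIV_power[OF x'[OF oo], of "Suc n"] by (simp add: mult_ac)
          from DERIV_cdivide[OF this, of "Suc n"] show ?thesis by (simp del: of_nat_Suc power_Suc)
        qed
        then show "(Z has_real_derivative ?w t * (x t * y t) * ?B t - k1 * (x t ^ n * - (x t * y t * sin (p t))) - b * ?V' t) (at t)"
          unfolding Z_def using t t2 by (intro DERIV_diff DERIV_cmult V' wq' oo) auto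
      next
        fix t assume t: "T < t" "t < t2"
        have tt: "T \<le> t" "t \<le> t1" using t t2 by auto
        note ot = o[OF tt]
        have xl: "x t \<le> x1" "r0 / 2 \<le> y t" using lt[of t] t by auto
        have xy: "0 < x t * y t" using ot by simp
        have Vt: "?V' t \<le> - (x t * y t) / 2" by (rule Vle[OF tt xl])
        have wl: "?w t \<ge> x t ^ n * k0"
        proof -
          have "k0 \<le> y t ^ n * exp (- ((x t)\<^sup>2 + (y t)\<^sup>2) / 4)"
            unfolding k0_def using xl r0 rhoR[OF tt] by (intro mult_mono power_mono) auto
          then have "x t ^ n * k0 \<le> x t ^ n * (y t ^ n * exp (- ((x t)\<^sup>2 + (y t)\<^sup>2) / 4))"
            using ot by (intro mult_left_mono) auto
          then show ?thesis by (simp add: w_def mult.assoc)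
        qed
        have wu: "?w t \<le> Wm"
        proof -
          have "(x t)\<^sup>2 \<le> R\<^sup>2" "(y t)\<^sup>2 \<le> R\<^sup>2" using rhoR[OF tt] zero_le_power2[of "x t"] zero_le_power2[of "y t"] by linarith+
          then have "x t \<le> R" "y t \<le> R" using R by (auto intro: power2_le_imp_le)
          then have "?w t \<le> R ^ n * R ^ n * 1" unfolding w_def using ot R by (intro mult_mono power_mono) auto
          then show ?thesis by (simp add: Wm_def)
        qed
        have wp: "?w t > 0" using ot by (intro w_pos)
        have rq: "((x t)\<^sup>2 + (y t)\<^sup>2) / 2 \<le> RS\<^sup>2 / 2 + (RS + 1) * \<delta>"
        proof -
          have "(RS + \<delta>)\<^sup>2 / 2 \<le> RS\<^sup>2 / 2 + (RS + 1) * \<delta>"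
            using d mult_right_mono[of \<delta> 2 \<delta>] by (simp add: power2_eq_square algebra_simps)
          moreover have "((x t)\<^sup>2 + (y t)\<^sup>2) / 2 \<le> (RS + \<delta>)\<^sup>2 / 2"
            using rho[OF tt] by (intro divide_right_mono) auto
          ultimately show ?thesis by (rule order_trans[rotated])
        qed
        show "0 \<le> ?w t * (x t * y t) * ?B t - k1 * (x t ^ n * - (x t * y t * sin (p t))) - b * ?V' t"
        proof (cases "sin (p t) \<le> 0")
          case True
          \<comment> \<open>The curve moves away from the axis, so \<open>h <= x <= RS / 4\<close>;
            of the amount \<open>c RS\<close> in the sphere equation, this and the excess radius
            \<delta> consume a quarter each.\<close>
          have "h (x t) (y t) (p t) \<le> x t * 1 + y t * 0"
            unfolding h_def using ot True by (intro add_mono mult_left_mono) auto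
          then have "c * h (x t) (y t) (p t) \<le> c * (RS / 4)" using xl x1 c_pos by (intro mult_left_mono) auto
          then have B: "?B t \<ge> c * RS / 2" using rq d(4) RS_eq by linarith
          have "k1 * (x t ^ n * - (x t * y t * sin (p t))) \<le> k1 * (x t ^ n * (x t * y t))"
          proof -
            have "x t * y t * (- sin (p t)) \<le> x t * y t * 1" using xy sin_ge_minus_one[of "p t"] by (intro mult_left_mono) auto
            then show ?thesis using k ot by (intro mult_left_mono) auto
          qed
          also have "\<dots> = x t ^ n * k0 * (x t * y t) * (c * RS / 2)" by (simp add: k1_def)
          also have "\<dots> \<le> ?w t * (x t * y t) * ?B t"
            using wl B xy wp k ot c_pos RS_pos by (intro mult_mono) auto
          finally have "k1 * (x t ^ n * - (x t * y t * sin (p t))) \<le> ?w t * (x t * y t) * ?B t" .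
          moreover have "b * ?V' t \<le> 0" using Vt xy b0 by (intro mult_nonneg_nonpos) auto
          ultimately show ?thesis by linarith
        next
          case False
          have "h (x t) (y t) (p t) \<le> RS + \<delta>"
            using abs_h_le[of "x t" "y t" "p t"] real_sqrt_le_mono[OF rho[OF tt]] RS_pos d by simp
          then have "c * h (x t) (y t) (p t) \<le> c * (RS + \<delta>)" using c_pos by (intro mult_left_mono) auto
          moreover have "c * (RS + \<delta>) = c * RS + c * \<delta>" "C1 * \<delta> = (RS + 1) * \<delta> + c * \<delta>"
            by (simp_all add: C1_def algebra_simps)
          ultimately have B: "?B t \<ge> - (C1 * \<delta>)" using rq RS_eq by linarith
          have "?w t * (x t * y t) * ?B t \<ge> ?w t * (x t * y t) * (- (C1 * \<delta>))"
            using B wp xy by (intro mult_left_mono) auto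
          moreover have "?w t * (x t * y t) * (C1 * \<delta>) \<le> Wm * (x t * y t) * (C1 * \<delta>)"
            using wu xy W d by (intro mult_right_mono) auto
          ultimately have 1: "?w t * (x t * y t) * ?B t \<ge> - (Wm * (x t * y t) * (C1 * \<delta>))" by simp
          have "b * ?V' t \<le> b * (- (x t * y t) / 2)" using Vt b0 by (intro mult_left_mono) auto
          moreover have "b * (- (x t * y t) / 2) = - (Wm * (x t * y t) * (C1 * \<delta>))" by (simp add: b_def)
          ultimately have 2: "b * ?V' t \<le> - (Wm * (x t * y t) * (C1 * \<delta>))" by linarith
          have "0 \<le> k1 * (x t ^ n * (x t * y t * sin (p t)))" using False k ot by (intro mult_nonneg_nonneg) auto
          then show ?thesis using 1 2 by simp
        qed
      qed
      moreover have "Z T \<ge> - (Wm * R * \<delta>) - k1 * \<delta> - b"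
      proof -
        have oT: "0 < x T" "0 < y T" "x T < 1" using o[of T] T xT d by auto
        have "(x T)\<^sup>2 \<le> R\<^sup>2" "(y T)\<^sup>2 \<le> R\<^sup>2" using rhoR[OF order_refl T] zero_le_power2[of "x T"] zero_le_power2[of "y T"] by linarith+
        then have yR: "y T \<le> R" using R by (auto intro: power2_le_imp_le)
        have xn: "x T ^ n \<le> \<delta>" using power_decreasing[of 1 n "x T"] n_ge_1 oT xT by simp
        have "x T ^ Suc n \<le> x T ^ 1" using oT by (intro power_decreasing) auto
        then have xn1: "x T ^ Suc n \<le> \<delta>" using xT by simp
        have "?w T \<le> \<delta> * R ^ n * 1" unfolding w_def using oT yR R xn d by (intro mult_mono power_mono) auto
        also have "\<dots> \<le> \<delta> * Wm"
        proof -
          have "R ^ n * 1 \<le> R ^ n * R ^ n" using R by (intro mult_left_mono one_le_power) auto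
          then show ?thesis using d by (simp add: Wm_def mult.assoc)
        qed
        finally have wT: "?w T \<le> \<delta> * Wm" .
        have "\<bar>q (x T) (y T) (p T)\<bar> \<le> R"
          using abs_q_le[of "x T" "y T" "p T"] real_sqrt_le_mono[OF rhoR[of T]] T R by simp
        then have "\<bar>?w T * q (x T) (y T) (p T)\<bar> \<le> \<delta> * Wm * R"
          unfolding abs_mult using wT w_pos[OF oT(1,2)] W d by (intro mult_mono) auto
        moreover have "k1 * (x T ^ Suc n / Suc n) \<le> k1 * \<delta>"
        proof -
          have "x T ^ Suc n / Suc n \<le> x T ^ Suc n / 1" using oT by (intro divide_left_mono) auto
          then show ?thesis using xn1 k by (intro mult_left_mono) auto
        qed
        moreover have "b * V T \<le> b * 1" using Vabs[of T] T oT b0 by (intro mult_left_mono) auto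
        ultimately show ?thesis unfolding Z_def by (simp add: mult_ac abs_le_iff)
      qed
      moreover have "Z t2 < - Bc + b"
      proof -
        have "?w t2 * q (x t2) (y t2) (p t2) < 0" using o[of t2] t2 by (intro mult_pos_neg w_pos) auto
        moreover have "b * V t2 \<ge> b * (- 1)" using Vabs[of t2] t2 x1 b0 by (intro mult_left_mono) auto
        ultimately show ?thesis unfolding Z_def t2(3) Bc_def by simp
      qed
      ultimately have "Bc < Wm * R * \<delta> + k1 * \<delta> + 2 * b" by linarith
      also have "\<dots> = A * \<delta>" by (simp add: A_def b_def algebra_simps)
      finally show False using d by simp
    qed
  qed
qed

section \<open>Leaving the diagonal perpendicularly\<close>

lemma RS_strict: "RS < s \<Longrightarrow> 2 * n + 1 < s\<^sup>2 / 2 + c * s"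
proof -
  assume s: "RS < s"
  have "RS\<^sup>2 < s\<^sup>2" using s RS_pos by (intro power_strict_mono) auto
  moreover have "c * RS < c * s" using s c_pos by simp
  ultimately show ?thesis using RS_eq by simp
qed

lemma start_values:
  "q b b (pi / 4) = 0" "h b b (pi / 4) = sqrt 2 * b"
  "b * b - K b b (pi / 4) * h b b (pi / 4) = b\<^sup>2 * (2 * n + 1 - (sqrt 2 * b)\<^sup>2 / 2 - c * (sqrt 2 * b))"
proof -
  show "q b b (pi / 4) = 0" by (simp add: q_def cos_45 sin_45)
  show hh: "h b b (pi / 4) = sqrt 2 * b" by (simp add: h_def cos_45 sin_45)
  have s2: "sqrt 2 * sqrt 2 = (2::real)" by simp
  have "K b b (pi / 4) = c * b\<^sup>2 + (b\<^sup>2 / 2 - n) * b * sqrt 2"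
    by (simp add: K_def cos_45 sin_45 field_simps power2_eq_square)
  then have "K b b (pi / 4) * sqrt 2 = c * b\<^sup>2 * sqrt 2 + (b\<^sup>2 / 2 - n) * b * (sqrt 2 * sqrt 2)"
    by (simp only: distrib_right mult.assoc)
  also have "\<dots> = c * b\<^sup>2 * sqrt 2 + 2 * (b\<^sup>2 / 2 - n) * b" by simp
  finally have "K b b (pi / 4) * sqrt 2 = c * b\<^sup>2 * sqrt 2 + 2 * (b\<^sup>2 / 2 - n) * b" .
  then have "K b b (pi / 4) * (sqrt 2 * b) = c * b\<^sup>2 * sqrt 2 * b + 2 * (b\<^sup>2 / 2 - n) * b * b" by algebra
  moreover have "(sqrt 2 * b)\<^sup>2 = 2 * b\<^sup>2" by (simp add: power_mult_distrib)
  ultimately show "b * b - K b b (pi / 4) * h b b (pi / 4) = b\<^sup>2 * (2 * n + 1 - (sqrt 2 * b)\<^sup>2 / 2 - c * (sqrt 2 * b))"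
    unfolding hh by (simp add: power2_eq_square algebra_simps)
qed

text \<open>The left side is the derivative of \<open>q\<close> at the start: outside the sphere
  radius the distance to the origin begins to decrease.\<close>

lemma start_q'_neg:
  assumes "b > 0" "RS < sqrt 2 * b"
  shows "b * b - K b b (pi / 4) * h b b (pi / 4) < 0"
proof -
  have "b\<^sup>2 * (2 * n + 1 - (sqrt 2 * b)\<^sup>2 / 2 - c * (sqrt 2 * b)) < 0"
    using RS_strict[OF assms(2)] assms(1) by (intro mult_pos_neg) auto
  then show ?thesis by (simp only: start_values(3))
qed

lemma q_cont:
  fixes x y p :: "real \<Rightarrow> real"
  assumes "continuous_on S x" "continuous_on S y" "continuous_on S p"
  shows "continuous_on S (\<lambda>t. q (x t) (y t) (p t))"
  unfolding q_def by (intro continuous_intros assms)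

lemma clamped_ode_continuous:
  assumes "\<And>t. clamped_ode M x y p t"
  shows "continuous_on S x" "continuous_on S y" "continuous_on S p"
  using assms unfolding clamped_ode_def
  by (intro continuous_at_imp_continuous_on ballI DERIV_isCont; blast)+

text \<open>Clipping only inserts nonnegative factors, so \<open>q <= 0\<close> keeps the radius
  from growing for the clamped field too. Hence the clamp stays inactive and the original equation
  holds.\<close>

lemma clamped_ode_arc:
  assumes M: "M \<ge> 0" "2 * b\<^sup>2 \<le> M\<^sup>2" and clamped_ode: "\<And>t. clamped_ode M x y p t" and i: "x 0 = b" "y 0 = b" "b > 0"
    and q: "\<And>t. 0 < t \<Longrightarrow> t \<le> T \<Longrightarrow> q (x t) (y t) (p t) \<le> 0" and t: "0 \<le> t" "t \<le> T"
  shows "ode x y p t" "0 < x t" "0 < y t" "(x t)\<^sup>2 + (y t)\<^sup>2 \<le> 2 * b\<^sup>2"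
proof -
  show pos: "0 < x t" "0 < y t" using clamped_ode_pos[OF M(1) clamped_ode] i by auto
  have d: "((\<lambda>t. - ((x t)\<^sup>2 + (y t)\<^sup>2)) has_real_derivative - (2 * (x s * (- (clip M (x s) * clip M (y s) * sin (p s))) + y s * (clip M (x s) * clip M (y s) * cos (p s))))) (at s)" for s
    using clamped_ode[of s] unfolding clamped_ode_def by (auto intro!: derivative_eq_intros)
  have "- ((x 0)\<^sup>2 + (y 0)\<^sup>2) \<le> - ((x t)\<^sup>2 + (y t)\<^sup>2)"
  proof (rule DERIV_nonneg_mono[OF t(1) d])
    fix s assume s: "0 < s" "s < t"
    have "x s * (- (clip M (x s) * clip M (y s) * sin (p s))) + y s * (clip M (x s) * clip M (y s) * cos (p s))
        = clip M (x s) * clip M (y s) * q (x s) (y s) (p s)"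
      by (simp add: q_def algebra_simps)
    also have "\<dots> \<le> 0" using q[of s] s t clip_nonneg by (intro mult_nonneg_nonpos) auto
    finally show "0 \<le> - (2 * (x s * (- (clip M (x s) * clip M (y s) * sin (p s))) + y s * (clip M (x s) * clip M (y s) * cos (p s))))" by simp
  qed
  then show r: "(x t)\<^sup>2 + (y t)\<^sup>2 \<le> 2 * b\<^sup>2" using i by simp
  have "(x t)\<^sup>2 \<le> M\<^sup>2" "(y t)\<^sup>2 \<le> M\<^sup>2" using r M zero_le_power2[of "x t"] zero_le_power2[of "y t"] by linarith+
  then have "x t \<le> M" "y t \<le> M" using M by (auto intro: power2_le_imp_le)
  then show "ode x y p t" using clamped_ode_imp_ode[OF clamped_ode] pos by auto
qed

text \<open>The sphere equation for \<open>h0\<close> cancels the inhomogeneous term, so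
  \<open>(q, h - h0)\<close> satisfies a linear differential inequality and Gronwall applies in both
  time directions. The coefficients are bounded without a lower bound on the radius, because
  \<open>x y\<close> and \<open>y^2 - x^2\<close> occur divided by its square. \<open>h0\<close> may
  be either root of the equation.\<close>

lemma sphere_unique:
  assumes o: "\<And>t. a \<le> t \<Longrightarrow> t \<le> s \<Longrightarrow> ode x y p t \<and> 0 < x t \<and> 0 < y t \<and> (x t)\<^sup>2 + (y t)\<^sup>2 \<le> R\<^sup>2"
    and R: "R \<ge> 0" and t0: "a \<le> t0" "t0 \<le> s" "q (x t0) (y t0) (p t0) = 0"
    and h0: "h (x t0) (y t0) (p t0) = h0" "h0\<^sup>2 / 2 + c * h0 = 2 * n + 1" and t: "a \<le> t" "t \<le> s"
  shows "q (x t) (y t) (p t) = 0" "h (x t) (y t) (p t) = h0"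
proof -
  let ?q = "\<lambda>t. q (x t) (y t) (p t)" and ?h = "\<lambda>t. h (x t) (y t) (p t)" and ?K = "\<lambda>t. K (x t) (y t) (p t)"
  define C where "C = R\<^sup>2 * (c + R) + n * R + n * R + (c * R\<^sup>2 + (R\<^sup>2 / 2 + n) * R + (R\<^sup>2 / 2 + n) * R)"
  define e where "e t = (?q t, ?h t - h0)" for t
  define e' where "e' t = (x t * y t - ?K t * ?h t, ?K t * ?q t)" for t
  have hR: "\<bar>?h t\<bar> \<le> R" and qR: "\<bar>?q t\<bar> \<le> R" if "a \<le> t" "t \<le> s" for t
  proof -
    have "sqrt ((x t)\<^sup>2 + (y t)\<^sup>2) \<le> R" using o[OF that] R real_sqrt_le_mono[of "(x t)\<^sup>2 + (y t)\<^sup>2" "R\<^sup>2"] by simp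
    then show "\<bar>?h t\<bar> \<le> R" "\<bar>?q t\<bar> \<le> R" using abs_h_le[of "x t" "y t" "p t"] abs_q_le[of "x t" "y t" "p t"] by linarith+
  qed
  have h0R: "\<bar>h0\<bar> \<le> R" using hR[OF t0(1,2)] h0 by simp
  have bound: "norm (e' t) \<le> C * norm (e t)" if tt: "a \<le> t" "t \<le> s" for t
  proof -
    note ot = o[OF tt]
    have xy: "0 < x t" "0 < y t" using ot by auto
    define r2 where "r2 = (x t)\<^sup>2 + (y t)\<^sup>2"
    have r2: "r2 > 0" using xy by (simp add: r2_def add_pos_pos)
    have xyr: "2 * (x t * y t) \<le> r2" using sum_squares_bound[of "x t" "y t"] by (simp add: r2_def mult.assoc)
    have xyR: "x t * y t \<le> R\<^sup>2" 
    proof -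
      have "0 < x t * y t" using xy by simp
      then show ?thesis using xyr ot unfolding r2_def by linarith
    qed
    have dif: "\<bar>(y t)\<^sup>2 - (x t)\<^sup>2\<bar> \<le> r2" by (simp add: r2_def abs_le_iff)
    have xR: "x t \<le> R" "y t \<le> R"
    proof -
      have "(x t)\<^sup>2 \<le> R\<^sup>2" "(y t)\<^sup>2 \<le> R\<^sup>2" using ot zero_le_power2[of "x t"] zero_le_power2[of "y t"] by linarith+
      then show "x t \<le> R" "y t \<le> R" using R by (auto intro: power2_le_imp_le)
    qed
    have KR: "\<bar>?K t\<bar> \<le> c * R\<^sup>2 + (R\<^sup>2 / 2 + n) * R + (R\<^sup>2 / 2 + n) * R"
    proof -
      have 1: "\<bar>c * x t * y t\<bar> \<le> c * R\<^sup>2" using xyR xy c_pos by (simp add: abs_mult mult.assoc)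
      have b2: "\<bar>(z\<^sup>2 / 2 - n)\<bar> \<le> R\<^sup>2 / 2 + n" if "z\<^sup>2 \<le> R\<^sup>2" for z
        using that zero_le_power2[of z] by (simp add: abs_le_iff)
      have sq: "(x t)\<^sup>2 \<le> R\<^sup>2" "(y t)\<^sup>2 \<le> R\<^sup>2" using xR xy by (auto intro: power_mono)
      have 2: "\<bar>((x t)\<^sup>2 / 2 - n) * y t * cos (p t)\<bar> \<le> (R\<^sup>2 / 2 + n) * R * 1"
        unfolding abs_mult using b2[OF sq(1)] xR xy R by (intro mult_mono) auto
      have 3: "\<bar>((y t)\<^sup>2 / 2 - n) * x t * sin (p t)\<bar> \<le> (R\<^sup>2 / 2 + n) * R * 1"
        unfolding abs_mult using b2[OF sq(2)] xR xy R by (intro mult_mono) auto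
      show ?thesis unfolding K_def using 1 2 3
        by (intro order_trans[OF abs_triangle_ineq] add_mono) auto
    qed
    have ne: "\<bar>?q t\<bar> \<le> norm (e t)" "\<bar>?h t - h0\<bar> \<le> norm (e t)"
      using norm_fst_le[of "?q t" "?h t - h0"] norm_snd_le[of "?h t - h0" "?q t"] by (simp_all add: e_def)
    have q'eq: "x t * y t - ?K t * ?h t = x t * y t * ((h0 - ?h t) * (c + (h0 + ?h t) / 2))
        - 2 * n * (x t * y t / r2) * ?q t * ?q t + n * ?h t * (((y t)\<^sup>2 - (x t)\<^sup>2) / r2) * ?q t"
    proof -
      have k: "r2 * ?K t = r2 * x t * y t * (c + ?h t / 2) - n * (2 * x t * y t * ?h t + ((y t)\<^sup>2 - (x t)\<^sup>2) * ?q t)"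
        using K_qh[of "x t" "y t" "p t"] by (simp add: r2_def)
      have r: "r2 = (?q t)\<^sup>2 + (?h t)\<^sup>2" using rho_qh by (simp add: r2_def)
      have m: "2 * n + 1 - c * ?h t - (?h t)\<^sup>2 / 2 = (h0 - ?h t) * (c + (h0 + ?h t) / 2)"
        using h0(2) by (simp add: field_simps power2_eq_square)
      have "r2 * (x t * y t - ?K t * ?h t) = r2 * x t * y t - (r2 * ?K t) * ?h t" by (simp add: algebra_simps)
      also have "\<dots> = r2 * x t * y t * (1 - c * ?h t - (?h t)\<^sup>2 / 2) + 2 * n * x t * y t * (?h t)\<^sup>2 + n * ?h t * ((y t)\<^sup>2 - (x t)\<^sup>2) * ?q t"
        unfolding k by (simp add: algebra_simps power2_eq_square)
      also have "\<dots> = r2 * x t * y t * (1 - c * ?h t - (?h t)\<^sup>2 / 2) + 2 * n * x t * y t * (r2 - (?q t)\<^sup>2) + n * ?h t * ((y t)\<^sup>2 - (x t)\<^sup>2) * ?q t"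
        by (simp add: r)
      also have "\<dots> = r2 * (x t * y t * (2 * n + 1 - c * ?h t - (?h t)\<^sup>2 / 2))
        - 2 * n * (x t * y t) * ?q t * ?q t + n * ?h t * ((y t)\<^sup>2 - (x t)\<^sup>2) * ?q t"
        by (simp add: algebra_simps power2_eq_square)
      also have "\<dots> = r2 * (x t * y t * ((h0 - ?h t) * (c + (h0 + ?h t) / 2))
        - 2 * n * (x t * y t / r2) * ?q t * ?q t + n * ?h t * (((y t)\<^sup>2 - (x t)\<^sup>2) / r2) * ?q t)"
        unfolding m using r2 by (simp add: field_simps)
      finally show ?thesis using r2 by simp
    qed
    have A: "\<bar>x t * y t * ((h0 - ?h t) * (c + (h0 + ?h t) / 2))\<bar> \<le> R\<^sup>2 * (norm (e t) * (c + R))"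
    proof -
      have "\<bar>c + (h0 + ?h t) / 2\<bar> \<le> c + R" 
      proof -
        have "\<bar>h0 + ?h t\<bar> \<le> 2 * R" using h0R hR[OF tt] abs_triangle_ineq[of h0 "?h t"] by linarith
        then have "\<bar>(h0 + ?h t) / 2\<bar> \<le> R" by simp
        then show ?thesis using abs_triangle_ineq[of c "(h0 + ?h t) / 2"] c_pos by linarith
      qed
      moreover have "\<bar>h0 - ?h t\<bar> \<le> norm (e t)" using ne by simp
      moreover have "\<bar>x t * y t\<bar> \<le> R\<^sup>2" using xyR xy by simp
      ultimately show ?thesis unfolding abs_mult[of "x t * y t"] abs_mult[of "h0 - ?h t"]
        by (intro mult_mono) auto
    qed
    have B: "\<bar>2 * n * (x t * y t / r2) * ?q t * ?q t\<bar> \<le> n * R * norm (e t)"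
    proof -
      have "\<bar>2 * n * (x t * y t / r2)\<bar> \<le> real n * 1"
      proof -
        have "2 * (x t * y t) / r2 \<le> 1" using xyr r2 by simp
        then have "n * (2 * (x t * y t) / r2) \<le> real n * 1" by (intro mult_left_mono) auto
        then show ?thesis using xy r2 by (simp add: abs_mult mult_ac)
      qed
      then show ?thesis unfolding abs_mult[of _ "?q t"] using ne qR[OF tt] R by (intro mult_mono) auto
    qed
    have D: "\<bar>n * ?h t * (((y t)\<^sup>2 - (x t)\<^sup>2) / r2) * ?q t\<bar> \<le> n * R * 1 * norm (e t)"
    proof -
      have "\<bar>((y t)\<^sup>2 - (x t)\<^sup>2) / r2\<bar> \<le> 1" using dif r2 by (simp add: abs_divide)
      then show ?thesis unfolding abs_mult using ne hR[OF tt] R by (intro mult_mono) auto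
    qed
    have E: "\<bar>?K t * ?q t\<bar> \<le> (c * R\<^sup>2 + (R\<^sup>2 / 2 + n) * R + (R\<^sup>2 / 2 + n) * R) * norm (e t)"
      unfolding abs_mult using KR ne by (intro mult_mono) auto
    have "norm (e' t) \<le> \<bar>x t * y t - ?K t * ?h t\<bar> + \<bar>?K t * ?q t\<bar>"
      unfolding e'_def using norm_Pair_le[of "x t * y t - ?K t * ?h t" "?K t * ?q t"] by simp
    also have "\<dots> \<le> (R\<^sup>2 * (norm (e t) * (c + R)) + n * R * norm (e t) + n * R * 1 * norm (e t))
        + (c * R\<^sup>2 + (R\<^sup>2 / 2 + n) * R + (R\<^sup>2 / 2 + n) * R) * norm (e t)"
    proof (rule add_mono[OF _ E])
      have three: "\<bar>a1 - a2 + a3\<bar> \<le> b1 + b2 + b3" if "\<bar>a1\<bar> \<le> b1" "\<bar>a2\<bar> \<le> b2" "\<bar>a3\<bar> \<le> b3" for a1 a2 a3 b1 b2 b3 :: real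
        using that by linarith
      show "\<bar>x t * y t - ?K t * ?h t\<bar> \<le> R\<^sup>2 * (norm (e t) * (c + R)) + n * R * norm (e t) + n * R * 1 * norm (e t)"
        unfolding q'eq by (rule three[OF A B D])
    qed
    also have "\<dots> = C * norm (e t)"
      by (simp add: C_def algebra_simps)
    finally show ?thesis .
  qed
  have "norm (e t) \<le> norm (e t0) * exp (C * \<bar>t - t0\<bar>)"
  proof (rule gronwall[where e' = e'])
    fix r assume "r \<in> closed_segment t0 t"
    then have r: "a \<le> r" "r \<le> s" using t t0 by (auto simp: closed_segment_eq_real_ivl split: if_splits)
    then have o': "ode x y p r" using o by auto
    have "((\<lambda>t. ?h t - h0) has_real_derivative ?K r * ?q r - 0) (at r)"
      by (intro DERIV_diff h'[OF o'] DERIV_const)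
    then show "(e has_vector_derivative e' r) (at r)"
      unfolding e_def e'_def using q'[OF o']
      by (intro has_vector_derivative_Pair) (simp_all add: has_real_derivative_iff_has_vector_derivative)
    show "norm (e' r) \<le> C * norm (e r)" by (rule bound[OF r])
  qed
  moreover have "e t0 = 0" using t0 h0 by (simp add: e_def zero_prod_def)
  ultimately have "e t = 0" by simp
  then show "?q t = 0" "?h t = h0" by (auto simp: e_def zero_prod_def)
qed

text \<open>Here \<open>p - (y\<^sup>2 - x\<^sup>2) / 4\<close> increases at rate about \<open>c x y\<close>, so the curve turns back to the diagonal
  before it has left the region where \<open>x\<close> and \<open>y\<close> are large.\<close>

lemma large_start:
  "\<exists>b1>0. \<forall>b\<ge>b1. RS < sqrt 2 * b \<and> (\<forall>x y p. x 0 = b \<longrightarrow> y 0 = b \<longrightarrow> p 0 = pi / 4 \<longrightarrow> (\<forall>t. clamped_ode (2 * b) x y p t)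
      \<longrightarrow> (\<exists>\<tau>>0. (\<forall>t. 0 < t \<and> t \<le> \<tau> \<longrightarrow> q (x t) (y t) (p t) < 0) \<and> y \<tau> < x \<tau>))"
proof -
  \<comment> \<open>\<open>5 pi / (2 c)\<close> will bound the total fall of \<open>x\<close>; the
    added 1 makes the bound strict.\<close>
  define r where "r = 5 * pi / (2 * c) + 1"
  have r: "r > 0" using c_pos by (simp add: r_def add_pos_pos)
  \<comment> \<open>\<open>8 n / c\<close> and \<open>8 r^2 / c\<close> let half of
    \<open>c x y\<close> survive the other terms of \<open>lam'\<close>. The last entry makes
    \<open>w q\<close> decrease even in the worst case \<open>h = - rho\<close>.\<close>
  define X0 where "X0 = Max {1, 8 * n / c, 8 * r\<^sup>2 / c, 2 * c + 2 * (2 * n + 1)}"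
  have X0: "X0 \<ge> 1" "X0 \<ge> 8 * n / c" "X0 \<ge> 8 * r\<^sup>2 / c" "X0 \<ge> 2 * c + 2 * (2 * n + 1)"
    unfolding X0_def by (rule Max_ge; simp)+
  have X0_dec: "2 * n + 1 < X0\<^sup>2 / 2 - c * X0"
  proof -
    have "X0\<^sup>2 / 2 - c * X0 = X0 * (X0 / 2 - c)" by (simp add: power2_eq_square algebra_simps)
    also have "\<dots> \<ge> 2 * (X0 / 2 - c)" using X0 c_pos n_ge_1 by (intro mult_right_mono) auto
    finally show ?thesis using X0 n_ge_1 by simp
  qed
  define b1 where "b1 = X0 + r + RS"
  show ?thesis
  proof (rule exI[of _ b1], intro conjI allI impI)
    show "b1 > 0" using X0 r RS_pos by (simp add: b1_def)
    fix b assume b: "b1 \<le> b"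
    have bX: "b - r \<ge> X0" "b > 0" "RS < b" using b X0 r RS_pos by (auto simp: b1_def)
    show RSb: "RS < sqrt 2 * b"
    proof -
      have "1 * b \<le> sqrt 2 * b" using bX by (intro mult_right_mono) auto
      then show ?thesis using bX by linarith
    qed
    fix x y p :: "real \<Rightarrow> real"
    assume i: "x 0 = b" "y 0 = b" "p 0 = pi / 4" and clamped_ode: "\<forall>t. clamped_ode (2 * b) x y p t"
    let ?q = "\<lambda>t. q (x t) (y t) (p t)"
    have q00: "?q 0 = 0" unfolding i by (rule start_values(1))
    note cc = clamped_ode_continuous[of "2 * b" x y p, OF clamped_ode[rule_format]]
    have cq: "continuous_on S ?q" for S by (rule q_cont[OF cc])
    have arc: "ode x y p t" "0 < x t" "0 < y t" "(x t)\<^sup>2 + (y t)\<^sup>2 \<le> 2 * b\<^sup>2"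
      if "\<And>t. 0 < t \<Longrightarrow> t \<le> T \<Longrightarrow> ?q t \<le> 0" "0 \<le> t" "t \<le> T" for t T
    proof -
      have "2 * b\<^sup>2 \<le> (2 * b)\<^sup>2" by (simp add: power2_eq_square)
      from clamped_ode_arc[OF _ this clamped_ode[rule_format] i(1,2) bX(2) that] bX
      show "ode x y p t" "0 < x t" "0 < y t" "(x t)\<^sup>2 + (y t)\<^sup>2 \<le> 2 * b\<^sup>2" by auto
    qed
    define lam where "lam t = p t - ((y t)\<^sup>2 - (x t)\<^sup>2) / 4" for t
    have lam_le: "lam t \<le> 3 * pi / 2" if q0: "\<And>t. 0 < t \<Longrightarrow> t \<le> T \<Longrightarrow> ?q t \<le> 0" and yx: "x t \<le> y t" and t: "0 \<le> t" "t \<le> T" for t T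
    proof -
      have "p t < 3 * pi / 2"
      proof (rule p_bounds(2)[where p = p and x = x and y = y and T = T])
        fix s assume s: "0 \<le> s" "s \<le> T"
        show "0 < x s \<and> 0 < y s \<and> q (x s) (y s) (p s) \<le> 0"
          using arc(2,3)[of T s] q0 s q00 by (cases "s = 0") auto
      qed (use i t cc in auto)
      moreover have "(x t)\<^sup>2 \<le> (y t)\<^sup>2" using arc(2)[of T t] q0 t yx by (intro power_mono) auto
      then have "0 \<le> ((y t)\<^sup>2 - (x t)\<^sup>2) / 4" by simp
      ultimately show ?thesis unfolding lam_def by linarith
    qed
    have lam0: "lam 0 = pi / 4" by (simp add: lam_def i)
    have lam'_ge: "x t * y t * (c + (y t - x t) * (sin (p t) - cos (p t)) / 2) - n * (y t * cos (p t) + x t * sin (p t)) \<ge> c / 2 * (x t * y t)"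
      if q0: "\<And>t. 0 < t \<Longrightarrow> t \<le> T \<Longrightarrow> ?q t \<le> 0" and yx: "x t \<le> y t" and xX: "x t \<ge> b - r" and t: "0 \<le> t" "t \<le> T" for t T
    proof -
      note a = arc[OF q0 t]
      have qt: "?q t \<le> 0" using q0[of t] t q00 by (cases "t = 0") auto
      have "(b - r)\<^sup>2 \<le> (x t)\<^sup>2" using xX bX X0 by (intro power_mono) auto
      then have "(y t)\<^sup>2 \<le> (b + r)\<^sup>2"
        using a(4) zero_le_power2[of r] unfolding power2_diff power2_sum by linarith
      then have "y t \<le> b + r" by (rule power2_le_imp_le) (use bX r in simp)
      then have dy: "y t - x t \<le> 2 * r" using xX by simp
      have yX: "y t \<ge> X0" using yx xX bX by simp
      have "y t * (sin (p t) - cos (p t)) \<ge> - (y t - x t)" by (rule sin_minus_cos_ge[OF qt yx])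
      then have "(y t - x t) * (y t * (sin (p t) - cos (p t))) \<ge> (y t - x t) * (- (y t - x t))"
        using yx by (intro mult_left_mono) auto
      moreover have "(y t - x t) * (y t - x t) \<le> (2 * r) * (2 * r)" using dy yx r by (intro mult_mono) auto
      moreover have "(2 * r) * (2 * r) \<le> c / 2 * y t"
      proof -
        have "8 * r\<^sup>2 \<le> X0 * c" using X0(3) c_pos by (simp add: pos_divide_le_eq)
        also have "\<dots> \<le> y t * c" using yX c_pos by (intro mult_right_mono) auto
        finally show ?thesis by (simp add: power2_eq_square mult.commute)
      qed
      ultimately have "(y t - x t) * (y t * (sin (p t) - cos (p t))) \<ge> - (c / 2 * y t)" by linarith
      then have "x t / 2 * ((y t - x t) * (y t * (sin (p t) - cos (p t)))) \<ge> x t / 2 * (- (c / 2 * y t))"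
        using a(2) by (intro mult_left_mono) auto
      then have 1: "x t * y t * ((y t - x t) * (sin (p t) - cos (p t)) / 2) \<ge> - (c / 4 * (x t * y t))"
        by (simp add: algebra_simps)
      have "y t * cos (p t) + x t * sin (p t) \<le> y t * 1 + x t * 1" using a by (intro add_mono mult_left_mono) auto
      then have "n * (y t * cos (p t) + x t * sin (p t)) \<le> n * (2 * y t)" using yx by (intro mult_left_mono) auto
      also have "\<dots> \<le> c / 4 * (x t * y t)"
      proof -
        have "8 * n \<le> X0 * c" using X0(2) c_pos by (simp add: pos_divide_le_eq)
        also have "\<dots> \<le> x t * c" using xX bX c_pos by (intro mult_right_mono) auto
        finally have "8 * n * y t \<le> x t * c * y t" using a by (intro mult_right_mono) auto
        then show ?thesis by (simp add: algebra_simps)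
      qed
      finally have 2: "n * (y t * cos (p t) + x t * sin (p t)) \<le> c / 4 * (x t * y t)" .
      have "x t * y t * (c + (y t - x t) * (sin (p t) - cos (p t)) / 2) = c * (x t * y t) + x t * y t * ((y t - x t) * (sin (p t) - cos (p t)) / 2)"
        by (simp add: algebra_simps)
      then show ?thesis using 1 2 by linarith
    qed
    \<comment> \<open>While \<open>x >= b - r\<close>, the derivative of \<open>lam\<close> is at
      least \<open>c / 2\<close> times the speed \<open>x y\<close>, so
      \<open>x + (2 / c) lam\<close> is nondecreasing. As \<open>lam\<close> starts at
      \<open>pi / 4\<close> and stays below \<open>3 pi / 2\<close>, \<open>x\<close> falls by less
      than \<open>r\<close>.\<close>
    have xlow: "x t > b - r" if q0: "\<And>t. 0 < t \<Longrightarrow> t \<le> T \<Longrightarrow> ?q t \<le> 0" and yx: "\<And>t. 0 < t \<Longrightarrow> t \<le> T \<Longrightarrow> x t \<le> y t" and t: "0 \<le> t" "t \<le> T" for t T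
    proof (rule ccontr)
      assume n: "\<not> x t > b - r"
      have yx': "x t \<le> y t" if "0 \<le> t" "t \<le> T" for t using yx[of t] that i by (cases "t = 0") auto
      have "continuous_on {0..t} (\<lambda>t. - x t)" by (intro continuous_intros cc)
      then obtain s where s: "0 < s" "s \<le> t" "- x s = - (b - r)" and lt: "\<And>u. 0 \<le> u \<Longrightarrow> u < s \<Longrightarrow> - x u < - (b - r)"
        using first_hit[of 0 t "\<lambda>t. - x t" "- (b - r)"] t n i r by auto
      have "x 0 + 2 / c * lam 0 \<le> x s + 2 / c * lam s"
      proof (rule DERIV_nonneg_mono[of 0 s])
        show "0 \<le> s" using s by simp
        fix u assume u: "0 \<le> u" "u \<le> s"
        have "ode x y p u" by (rule arc[of T]) (use q0 u s t in auto)
        then show "((\<lambda>t. x t + 2 / c * lam t) has_real_derivative - (x u * y u * sin (p u)) + 2 / c * (x u * y u * (c + (y u - x u) * (sin (p u) - cos (p u)) / 2) - n * (y u * cos (p u) + x u * sin (p u)))) (at u)"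
          unfolding lam_def by (intro DERIV_add DERIV_cmult x' lam')
      next
        fix u assume u: "0 < u" "u < s"
        have a: "0 < x u" "0 < y u" using arc(2,3)[of T u] q0 u s t by auto
        let ?l = "x u * y u * (c + (y u - x u) * (sin (p u) - cos (p u)) / 2) - n * (y u * cos (p u) + x u * sin (p u))"
        have "?l \<ge> c / 2 * (x u * y u)" by (rule lam'_ge[of T]) (use q0 yx' lt[of u] u s t in auto)
        then have "2 / c * ?l \<ge> 2 / c * (c / 2 * (x u * y u))" using c_pos by (intro mult_left_mono) auto
        moreover have "2 / c * (c / 2 * (x u * y u)) = x u * y u" using c_pos by simp
        moreover have "x u * y u * sin (p u) \<le> x u * y u * 1" using a by (intro mult_left_mono) auto
        ultimately show "0 \<le> - (x u * y u * sin (p u)) + 2 / c * ?l" by linarith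
      qed
      moreover have "2 / c * lam s \<le> 2 / c * (3 * pi / 2)"
        using lam_le[of T s] q0 yx' s t c_pos by (intro mult_left_mono) auto
      ultimately have "b + 2 / c * (pi / 4) \<le> b - r + 2 / c * (3 * pi / 2)" using i lam0 s by simp
      then have "r \<le> 2 / c * (3 * pi / 2) - 2 / c * (pi / 4)" by linarith
      also have "\<dots> = 5 * pi / (2 * c)" using c_pos by (simp add: field_simps)
      finally show False by (simp add: r_def)
    qed
    show "\<exists>\<tau>>0. (\<forall>t. 0 < t \<and> t \<le> \<tau> \<longrightarrow> q (x t) (y t) (p t) < 0) \<and> y \<tau> < x \<tau>"
    proof (rule ccontr)
      assume no: "\<not> ?thesis"
      have yx: "x t \<le> y t" if "0 < t" "\<And>s. 0 < s \<Longrightarrow> s \<le> t \<Longrightarrow> ?q s < 0" for t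
        using no that by (metis not_less)
      have o0: "ode x y p 0" using arc(1)[of 0 0] by auto
      have "((\<lambda>t. ?q t) has_real_derivative x 0 * y 0 - K (x 0) (y 0) (p 0) * h (x 0) (y 0) (p 0)) (at 0)"
        by (rule q'[OF o0])
      moreover have "x 0 * y 0 - K (x 0) (y 0) (p 0) * h (x 0) (y 0) (p 0) < 0"
        unfolding i by (rule start_q'_neg[OF bX(2) RSb])
      ultimately obtain d where d: "d > 0" "\<And>s. 0 < s \<Longrightarrow> s < d \<Longrightarrow> ?q (0 + s) < ?q 0"
        using DERIV_neg_dec_right by blast
      have qd: "?q s < 0" if "0 < s" "s < d" for s using d(2)[OF that] q00 by simp
      \<comment> \<open>Without a crossing, \<open>x <= y\<close> lasts as long as
        \<open>q < 0\<close>; then \<open>xlow\<close> keeps the radius large, \<open>w q\<close>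
        decreases, and \<open>q\<close> cannot return to zero.\<close>
      have qneg: "?q t < 0" if t: "0 < t" for t
      proof (rule ccontr)
        assume n: "\<not> ?q t < 0"
        define a where "a = min (d / 2) t"
        have a: "0 < a" "a < d" "a \<le> t" using d t by (auto simp: a_def)
        obtain s where s: "a < s" "s \<le> t" "?q s = 0" and lt: "\<And>u. a \<le> u \<Longrightarrow> u < s \<Longrightarrow> ?q u < 0"
          using first_hit[of a t ?q 0] cq a qd[of a] n by auto
        have lt': "?q u < 0" if "0 < u" "u < s" for u using lt[of u] qd[of u] that a by (cases "u < a") auto
        have q0: "?q u \<le> 0" if "0 < u" "u \<le> s" for u using lt'[of u] s that by (cases "u = s") auto
        have yxs: "x u \<le> y u" if u: "0 < u" "u \<le> s" for u
        proof (cases "u = s")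
          case False
          then show ?thesis using yx[of u] lt' u by auto
        next
          case True
          have "closure {0<..<s} = {0..s}" using s a by simp
          moreover have "0 \<le> y u - x u" if "u \<in> closure {0<..<s}" for u
          proof (rule continuous_ge_on_closure[of "{0<..<s}" "\<lambda>u. y u - x u", OF _ that])
            show "continuous_on (closure {0<..<s}) (\<lambda>u. y u - x u)" by (intro continuous_intros cc)
            show "0 \<le> y v - x v" if "v \<in> {0<..<s}" for v using yx[of v] lt' that by auto
          qed
          ultimately show ?thesis using u by auto
        qed
        have "- (w (x 0) (y 0) * ?q 0) < - (w (x s) (y s) * ?q s)"
        proof (rule DERIV_pos_strict_mono[of 0 s])
          show "0 < s" using s a by simp
          fix u assume u: "0 \<le> u" "u \<le> s"
          have "ode x y p u" by (rule arc[of s]) (use q0 u in auto)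
          then show "((\<lambda>t. - (w (x t) (y t) * ?q t)) has_real_derivative - (w (x u) (y u) * (x u * y u) * (2 * n + 1 - ((x u)\<^sup>2 + (y u)\<^sup>2) / 2 - c * h (x u) (y u) (p u)))) (at u)"
            by (intro DERIV_minus wq')
        next
          fix u assume u: "0 < u" "u < s"
          have a: "0 < x u" "0 < y u" using arc(2,3)[of s u] q0 u by auto
          define \<rho> where "\<rho> = sqrt ((x u)\<^sup>2 + (y u)\<^sup>2)"
          have xu: "x u \<ge> X0" using xlow[of s u] q0 yxs u bX by auto
          have "x u \<le> \<rho>" unfolding \<rho>_def by simp
          then have \<rho>: "\<rho> \<ge> X0" using xu by simp
          have "X0 * (X0 / 2 - c) \<le> \<rho> * (\<rho> / 2 - c)" using \<rho> X0 c_pos n_ge_1 by (intro mult_mono) auto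
          then have "2 * n + 1 < \<rho>\<^sup>2 / 2 - c * \<rho>" using X0_dec by (simp add: power2_eq_square algebra_simps)
          moreover have "c * h (x u) (y u) (p u) \<ge> c * (- \<rho>)"
            using abs_h_le[of "x u" "y u" "p u"] c_pos by (intro mult_left_mono) (auto simp: \<rho>_def)
          moreover have "\<rho>\<^sup>2 = (x u)\<^sup>2 + (y u)\<^sup>2" by (simp add: \<rho>_def)
          ultimately have "2 * n + 1 - ((x u)\<^sup>2 + (y u)\<^sup>2) / 2 - c * h (x u) (y u) (p u) < 0" by simp
          moreover have "0 < w (x u) (y u) * (x u * y u)" using a w_pos by (intro mult_pos_pos) auto
          ultimately show "0 < - (w (x u) (y u) * (x u * y u) * (2 * n + 1 - ((x u)\<^sup>2 + (y u)\<^sup>2) / 2 - c * h (x u) (y u) (p u)))"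
            by (simp add: mult_pos_neg)
        qed
        then show False using s(3) q00 by simp
      qed
      have q0: "?q t \<le> 0" if "0 < t" for t using qneg[OF that] by simp
      have yx': "x t \<le> y t" if "0 \<le> t" for t using yx[of t] qneg that i by (cases "t = 0") auto
      \<comment> \<open>Now everything holds for all time, and \<open>lam\<close>, growing at least
        at rate \<open>c / 2\<close>, would exceed its bound \<open>3 pi / 2\<close> at
        \<open>T\<close>.\<close>
      define T where "T = (3 * pi / 2) / (c / 2) + 1"
      have T: "T > 0" using c_pos by (simp add: T_def add_pos_pos)
      have "lam 0 - c / 2 * 0 \<le> lam T - c / 2 * T"
      proof (rule DERIV_nonneg_mono[of 0 T])
        show "0 \<le> T" using T by simp
        fix u assume u: "0 \<le> u" "u \<le> T"
        have "ode x y p u" by (rule arc[of u]) (use q0 u in auto)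
        then show "((\<lambda>t. lam t - c / 2 * t) has_real_derivative x u * y u * (c + (y u - x u) * (sin (p u) - cos (p u)) / 2) - n * (y u * cos (p u) + x u * sin (p u)) - c / 2) (at u)"
          unfolding lam_def by (intro DERIV_diff DERIV_cmult_Id lam')
      next
        fix u assume u: "0 < u" "u < T"
        have xu: "x u \<ge> b - r" using xlow[of u u] q0 yx' u by auto
        then have "x u \<ge> 1" "y u \<ge> 1" using X0 bX yx'[of u] u by auto
        then have "1 * 1 \<le> x u * y u" by (intro mult_mono) auto
        then have "c / 2 * 1 \<le> c / 2 * (x u * y u)" using c_pos by (intro mult_left_mono) auto
        also have "\<dots> \<le> x u * y u * (c + (y u - x u) * (sin (p u) - cos (p u)) / 2) - n * (y u * cos (p u) + x u * sin (p u))"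
          by (rule lam'_ge[of u]) (use q0 yx' xu u in auto)
        finally show "0 \<le> x u * y u * (c + (y u - x u) * (sin (p u) - cos (p u)) / 2) - n * (y u * cos (p u) + x u * sin (p u)) - c / 2" by simp
      qed
      moreover have "lam T \<le> 3 * pi / 2" by (rule lam_le[of T]) (use q0 yx' T in auto)
      moreover have "c / 2 * T = 3 * pi / 2 + c / 2" using c_pos by (simp add: T_def field_simps)
      ultimately show False using lam0 c_pos pi_gt_zero by linarith
    qed
  qed
qed

end

section \<open>The shooting argument\<close>

locale shoot = profile +
  fixes M L b0 :: real and X Y P :: "real \<Rightarrow> real \<Rightarrow> real"
  assumes b0: "RS < sqrt 2 * b0" "b0 < M" "2 * b0\<^sup>2 \<le> M\<^sup>2" and L_pos: "L > 0"
    and init: "X b 0 = b" "Y b 0 = b" "P b 0 = pi / 4"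
    and flow: "clamped_ode M (X b) (Y b) (P b) t"
    and dep: "\<bar>X b t - X b' t\<bar> \<le> 2 * \<bar>b - b'\<bar> * exp (L * \<bar>t\<bar>)" "\<bar>Y b t - Y b' t\<bar> \<le> 2 * \<bar>b - b'\<bar> * exp (L * \<bar>t\<bar>)"
      "\<bar>P b t - P b' t\<bar> \<le> 2 * \<bar>b - b'\<bar> * exp (L * \<bar>t\<bar>)"
begin

abbreviation "Q b t \<equiv> q (X b t) (Y b t) (P b t)"
abbreviation "S b t \<equiv> (X b t, Y b t, P b t)"

text \<open>The trajectory is followed strictly past the diagonal, with \<open>Q < 0\<close> up to
  and including that moment; this makes the condition open in \<open>b\<close>.\<close>

definition crosses :: "real \<Rightarrow> bool" where
  "crosses b \<longleftrightarrow> (\<exists>\<tau>>0. (\<forall>t. 0 < t \<and> t \<le> \<tau> \<longrightarrow> Q b t < 0) \<and> Y b \<tau> < X b \<tau>)"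

lemma cont: "continuous_on A (X b)" "continuous_on A (Y b)" "continuous_on A (P b)"
  by (rule clamped_ode_continuous[OF flow])+

lemma contQ: "continuous_on A (Q b)"
  by (rule q_cont[OF cont])

lemma b0_pos: "b0 > 0"
proof (rule ccontr)
  assume "\<not> b0 > 0"
  then have "sqrt 2 * b0 \<le> 0" by (intro mult_nonneg_nonpos) auto
  then show False using b0 RS_pos by simp
qed

lemma arc:
  assumes "0 < b" "b \<le> b0" "\<And>t. 0 < t \<Longrightarrow> t \<le> T \<Longrightarrow> Q b t \<le> 0" "0 \<le> t" "t \<le> T"
  shows "ode (X b) (Y b) (P b) t" "0 < X b t" "0 < Y b t" "(X b t)\<^sup>2 + (Y b t)\<^sup>2 \<le> 2 * b\<^sup>2"
proof -
  have M: "0 \<le> M" using b0 b0_pos by simp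
  have "b\<^sup>2 \<le> b0\<^sup>2" using assms by (intro power_mono) auto
  then have M2: "2 * b\<^sup>2 \<le> M\<^sup>2" using b0 by simp
  show "ode (X b) (Y b) (P b) t" "0 < X b t" "0 < Y b t" "(X b t)\<^sup>2 + (Y b t)\<^sup>2 \<le> 2 * b\<^sup>2"
    by (rule clamped_ode_arc[OF M M2 flow init(1,2) assms(1)]; use assms in auto)+
qed

lemma Q0: "Q b 0 = 0"
  unfolding init by (rule start_values)

text \<open>The arc is compact, so a tube of fixed radius around it lies in \<open>U\<close>, and
  the dependence on \<open>b\<close> is uniform up to time \<open>T\<close>.\<close>

lemma nearby:
  assumes U: "open U" and a: "0 \<le> a" "a \<le> T" and in_U: "\<And>t. a \<le> t \<Longrightarrow> t \<le> T \<Longrightarrow> S b t \<in> U"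
  shows "\<exists>e>0. \<forall>b'. \<bar>b' - b\<bar> < e \<longrightarrow> (\<forall>t. a \<le> t \<and> t \<le> T \<longrightarrow> S b' t \<in> U)"
proof -
  have comp: "compact (S b ` {a..T})"
    by (intro compact_continuous_image continuous_intros cont compact_Icc)
  have sub: "S b ` {a..T} \<subseteq> U" using in_U by auto
  obtain r where r: "r > 0" "(\<Union>u\<in>S b ` {a..T}. ball u r) \<subseteq> U"
    by (rule compact_subset_open_imp_ball_epsilon_subset[OF comp U sub])
  define e where "e = r / (6 * exp (L * T))"
  show ?thesis
  proof (intro exI[of _ e] conjI allI impI)
    show "e > 0" using r by (simp add: e_def)
    fix b' t assume b': "\<bar>b' - b\<bar> < e" and t: "a \<le> t \<and> t \<le> T"
    have "2 * \<bar>b - b'\<bar> * exp (L * \<bar>t\<bar>) \<le> 2 * \<bar>b - b'\<bar> * exp (L * T)"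
      using t a L_pos by (intro mult_left_mono) auto
    also have "\<dots> < 2 * e * exp (L * T)" using b' by (intro mult_strict_right_mono) auto
    also have "\<dots> = r / 3" by (simp add: e_def)
    finally have k: "2 * \<bar>b - b'\<bar> * exp (L * \<bar>t\<bar>) < r / 3" .
    have "dist (S b t) (S b' t) \<le> \<bar>X b t - X b' t\<bar> + \<bar>Y b t - Y b' t\<bar> + \<bar>P b t - P b' t\<bar>"
      unfolding dist_norm using norm_triple_le by simp
    also have "\<dots> < r" using dep[of b t b'] k by linarith
    finally have "S b' t \<in> ball (S b t) r" by simp
    then show "S b' t \<in> U" using r t by force
  qed
qed

lemma open_conds:
  "open {u :: real \<times> real \<times> real. fst u < fst (snd u)}" "open {u :: real \<times> real \<times> real. fst (snd u) < fst u}"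
  "open {u. q (fst u) (fst (snd u)) (snd (snd u)) < 0}" "open {u. 0 < q (fst u) (fst (snd u)) (snd (snd u))}"
  unfolding q_def by (intro open_Collect_less continuous_intros)+

text \<open>At \<open>t = 0\<close> both conditions are equalities, so \<open>nearby\<close> gives
  nothing there. But the derivative of \<open>Y - X\<close> and, outside the sphere radius, that of
  \<open>Q\<close> have strict signs at the start, uniformly for \<open>b'\<close> near
  \<open>b\<close>.\<close>

lemma near_zero:
  assumes b: "0 < b" "b \<le> b0"
  shows "\<exists>\<epsilon>>0. \<exists>e>0. \<forall>b'. \<bar>b' - b\<bar> < e \<longrightarrow> (\<forall>t. 0 < t \<and> t \<le> \<epsilon> \<longrightarrow> X b' t < Y b' t \<and> (RS < sqrt 2 * b \<longrightarrow> Q b' t < 0))"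
proof -
  let ?F = "\<lambda>u. if RS < sqrt 2 * b then fst u * fst (snd u) - K (fst u) (fst (snd u)) (snd (snd u)) * h (fst u) (fst (snd u)) (snd (snd u)) else -1"
  define U where "U = {u :: real \<times> real \<times> real. 0 < fst u \<and> fst u < M \<and> 0 < fst (snd u) \<and> fst (snd u) < M
     \<and> 0 < cos (snd (snd u)) + sin (snd (snd u)) \<and> ?F u < 0}"
  have U: "open U"
    unfolding U_def K_def h_def by (cases "RS < sqrt 2 * b") (auto intro!: open_Collect_conj open_Collect_less continuous_intros)
  have S0: "S b 0 \<in> U"
    unfolding U_def init using b b0 start_q'_neg[of b] by (auto simp: cos_45 sin_45)
  have "continuous_on UNIV (S b)" by (intro continuous_intros cont)
  then have "open (S b -` U)" using U by (simp add: open_vimage)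
  then obtain \<epsilon>0 where \<epsilon>0: "\<epsilon>0 > 0" "ball 0 \<epsilon>0 \<subseteq> S b -` U"
    using S0 openE[of "S b -` U" 0] by auto
  define \<epsilon> where "\<epsilon> = \<epsilon>0 / 2"
  have \<epsilon>: "\<epsilon> > 0" "\<And>t. 0 \<le> t \<Longrightarrow> t \<le> \<epsilon> \<Longrightarrow> S b t \<in> U"
    using \<epsilon>0 by (auto simp: \<epsilon>_def subset_iff dist_norm)
  obtain e where e: "e > 0" "\<And>b' t. \<bar>b' - b\<bar> < e \<Longrightarrow> 0 \<le> t \<Longrightarrow> t \<le> \<epsilon> \<Longrightarrow> S b' t \<in> U"
    using nearby[OF U, of 0 \<epsilon> b] \<epsilon> by auto
  show ?thesis
  proof (rule exI[of _ \<epsilon>], intro conjI \<epsilon>(1), rule exI[of _ e], intro conjI e(1) allI impI)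
    fix b' t assume b': "\<bar>b' - b\<bar> < e" and t: "0 < t \<and> t \<le> \<epsilon>"
    have inU: "S b' s \<in> U" if "0 \<le> s" "s \<le> t" for s using e(2)[OF b'] that t by auto
    have o: "ode (X b') (Y b') (P b') s" if "0 \<le> s" "s \<le> t" for s
      by (rule clamped_ode_imp_ode[OF flow]) (use inU[OF that] in \<open>auto simp: U_def\<close>)
    have "Y b' 0 - X b' 0 < Y b' t - X b' t"
    proof (rule DERIV_pos_strict_mono[of 0 t])
      fix s assume s: "0 \<le> s" "s \<le> t"
      then show "((\<lambda>t. Y b' t - X b' t) has_real_derivative X b' s * Y b' s * (cos (P b' s) + sin (P b' s))) (at s)"
        by (intro diff' o)
    next
      fix s assume "0 < s" "s < t"
      then show "0 < X b' s * Y b' s * (cos (P b' s) + sin (P b' s))" using inU[of s] by (auto simp: U_def)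
    qed (use t in auto)
    then show "X b' t < Y b' t" by (simp add: init)
    assume R: "RS < sqrt 2 * b"
    have "- Q b' 0 < - Q b' t"
    proof (rule DERIV_pos_strict_mono[of 0 t])
      fix s assume s: "0 \<le> s" "s \<le> t"
      then show "((\<lambda>t. - Q b' t) has_real_derivative - (X b' s * Y b' s - K (X b' s) (Y b' s) (P b' s) * h (X b' s) (Y b' s) (P b' s))) (at s)"
        by (intro DERIV_minus q' o)
    next
      fix s assume "0 < s" "s < t"
      then show "0 < - (X b' s * Y b' s - K (X b' s) (Y b' s) (P b' s) * h (X b' s) (Y b' s) (P b' s))"
        using inU[of s] R by (auto simp: U_def)
    qed (use t in auto)
    then show "Q b' t < 0" by (simp add: Q0)
  qed
qed

text \<open>\<open>near_zero\<close> handles the times close to 0 and \<open>nearby\<close> the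
  remaining compact interval.\<close>

lemma crosses_open:
  assumes b: "b \<le> b0" "RS < sqrt 2 * b" and E: "crosses b"
  shows "\<exists>e>0. \<forall>b'. \<bar>b' - b\<bar> < e \<longrightarrow> crosses b'"
proof -
  have bp: "b > 0"
  proof (rule ccontr)
    assume "\<not> b > 0"
    then have "sqrt 2 * b \<le> 0" by (intro mult_nonneg_nonpos) auto
    then show False using b RS_pos by simp
  qed
  obtain \<tau> where \<tau>: "\<tau> > 0" "\<And>t. 0 < t \<Longrightarrow> t \<le> \<tau> \<Longrightarrow> Q b t < 0" "Y b \<tau> < X b \<tau>"
    using E unfolding crosses_def by blast
  obtain \<epsilon> e1 where e1: "\<epsilon> > 0" "e1 > 0"
    "\<And>b' t. \<bar>b' - b\<bar> < e1 \<Longrightarrow> 0 < t \<Longrightarrow> t \<le> \<epsilon> \<Longrightarrow> Q b' t < 0"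
    using near_zero[OF bp b(1)] b(2) by blast
  define a where "a = min \<epsilon> \<tau>"
  have a: "0 < a" "a \<le> \<epsilon>" "a \<le> \<tau>" using e1 \<tau> by (auto simp: a_def)
  obtain e2 where e2: "e2 > 0" "\<And>b' t. \<bar>b' - b\<bar> < e2 \<Longrightarrow> a \<le> t \<Longrightarrow> t \<le> \<tau> \<Longrightarrow> Q b' t < 0"
    using nearby[OF open_conds(3), of a \<tau> b] a \<tau> by auto
  obtain e3 where e3: "e3 > 0" "\<And>b'. \<bar>b' - b\<bar> < e3 \<Longrightarrow> Y b' \<tau> < X b' \<tau>"
    using nearby[OF open_conds(2), of \<tau> \<tau> b] a \<tau> by auto
  show ?thesis
  proof (rule exI[of _ "Min {e1, e2, e3}"], intro conjI allI impI)
    show "0 < Min {e1, e2, e3}" using e1 e2 e3 by simp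
    fix b' assume b': "\<bar>b' - b\<bar> < Min {e1, e2, e3}"
    have "Q b' t < 0" if "0 < t" "t \<le> \<tau>" for t
      using e1(3)[of b' t] e2(2)[of b' t] b' that a by (cases "t \<le> a") auto
    then show "crosses b'" unfolding crosses_def using \<tau> e3(2)[of b'] b' by auto
  qed
qed

lemma first_diagonal_hit:
  assumes b: "0 < b" "b \<le> b0" and T: "0 < T" "Y b T \<le> X b T"
  obtains t1 where "0 < t1" "t1 \<le> T" "X b t1 = Y b t1" "\<And>t. 0 < t \<Longrightarrow> t < t1 \<Longrightarrow> X b t < Y b t"
proof -
  obtain \<epsilon> where \<epsilon>: "\<epsilon> > 0" "\<And>t. 0 < t \<Longrightarrow> t \<le> \<epsilon> \<Longrightarrow> X b t < Y b t"
    using near_zero[OF b] by force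
  have "\<epsilon> < T" using \<epsilon>(2)[of T] T by (auto simp: not_less[symmetric])
  moreover have "continuous_on {\<epsilon>..T} (\<lambda>t. X b t - Y b t)" by (intro continuous_intros cont)
  ultimately obtain t1 where t1: "\<epsilon> < t1" "t1 \<le> T" "X b t1 - Y b t1 = 0" "\<And>s. \<epsilon> \<le> s \<Longrightarrow> s < t1 \<Longrightarrow> X b s - Y b s < 0"
    using first_hit[of \<epsilon> T "\<lambda>t. X b t - Y b t" 0] \<epsilon>(2)[of \<epsilon>] \<epsilon>(1) T by auto
  show ?thesis
  proof (rule that[of t1])
    show "X b t < Y b t" if "0 < t" "t < t1" for t using t1(4)[of t] \<epsilon>(2)[of t] that by (cases "t \<le> \<epsilon>") auto
  qed (use t1 \<epsilon> in auto)
qed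

text \<open>\<open>b\<close> is the supremum of the values that do not cross, cut off below at the
  sphere. By openness it does not cross itself, unless it is the cut-off; that case is excluded in
  \<open>sphere_impossible\<close>.\<close>

lemma threshold:
  assumes E0: "crosses b0"
  obtains b where "RS \<le> sqrt 2 * b" "b < b0" "\<And>b'. b < b' \<Longrightarrow> b' \<le> b0 \<Longrightarrow> crosses b'" "RS < sqrt 2 * b \<Longrightarrow> \<not> crosses b"
proof -
  define bs where "bs = RS / sqrt 2"
  have bs: "sqrt 2 * bs = RS" by (simp add: bs_def)
  have iff: "RS < sqrt 2 * b \<longleftrightarrow> bs < b" "RS \<le> sqrt 2 * b \<longleftrightarrow> bs \<le> b" for b
    by (simp_all add: bs_def field_simps)
  have bs0: "bs < b0" using b0 iff by simp
  \<comment> \<open>\<open>bs\<close> is the starting value of the sphere; inserting it makes the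
    set nonempty.\<close>
  define A where "A = insert bs {b. bs \<le> b \<and> b \<le> b0 \<and> \<not> crosses b}"
  have ne: "A \<noteq> {}" and bd: "bdd_above A" unfolding A_def using bs0 by (auto intro!: bdd_aboveI[of _ b0])
  define b where "b = Sup A"
  have b1: "bs \<le> b" unfolding b_def by (rule cSup_upper[OF _ bd]) (simp add: A_def)
  have b2: "b \<le> b0" unfolding b_def by (rule cSup_least[OF ne]) (use bs0 in \<open>auto simp: A_def\<close>)
  have good: "crosses b'" if "b < b'" "b' \<le> b0" for b'
  proof (rule ccontr)
    assume "\<not> crosses b'"
    then have "b' \<in> A" using that b1 by (auto simp: A_def)
    then have "b' \<le> b" unfolding b_def by (rule cSup_upper[OF _ bd])
    then show False using that by simp
  qed
  have notE: "\<not> crosses b" if bb: "bs < b"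
  proof
    assume "crosses b"
    then obtain e where e: "e > 0" "\<And>b'. \<bar>b' - b\<bar> < e \<Longrightarrow> crosses b'"
      using crosses_open[OF b2 iff(1)[THEN iffD2, OF bb]] by blast
    have "max bs (b - e) < Sup A" using bb e unfolding b_def[symmetric] by simp
    then obtain a where a: "a \<in> A" "max bs (b - e) < a" using less_cSup_iff[OF ne bd] by blast
    have "a \<le> b" unfolding b_def by (rule cSup_upper[OF a(1) bd])
    then have "crosses a" using a e by auto
    then show False using a by (auto simp: A_def)
  qed
  have "b \<noteq> b0" using notE E0 bs0 by auto
  then show ?thesis using that[of b] b1 b2 good notE iff[of b] by auto
qed

context
  fixes b assumes b: "RS \<le> sqrt 2 * b" "b < b0" and good: "\<And>b'. b < b' \<Longrightarrow> b' \<le> b0 \<Longrightarrow> crosses b'"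
begin

lemma b_pos: "b > 0"
proof (rule ccontr)
  assume "\<not> b > 0"
  then have "sqrt 2 * b \<le> 0" by (intro mult_nonneg_nonpos) auto
  then show False using b RS_pos by simp
qed

text \<open>For \<open>b'\<close> near \<open>b\<close> the trajectory is still strictly above the
  diagonal up to \<open>T\<close>, so for \<open>b' > b\<close> it crosses only afterwards, and
  \<open>Q < 0\<close> holds on all of \<open>(0, T]\<close>.\<close>

lemma late:
  assumes T: "0 < T" "\<And>t. 0 < t \<Longrightarrow> t \<le> T \<Longrightarrow> X b t < Y b t"
  shows "\<exists>e>0. \<forall>b'. b < b' \<longrightarrow> b' < b + e \<longrightarrow> b' \<le> b0 \<and> (\<exists>\<tau>>T. (\<forall>t. 0 < t \<and> t \<le> \<tau> \<longrightarrow> Q b' t < 0) \<and> Y b' \<tau> < X b' \<tau>)"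
proof -
  obtain \<epsilon> e1 where e1: "\<epsilon> > 0" "e1 > 0"
    "\<And>b' t. \<bar>b' - b\<bar> < e1 \<Longrightarrow> 0 < t \<Longrightarrow> t \<le> \<epsilon> \<Longrightarrow> X b' t < Y b' t"
    using near_zero[OF b_pos] b by force
  define a where "a = min \<epsilon> T"
  have a: "0 < a" "a \<le> \<epsilon>" "a \<le> T" using e1 T by (auto simp: a_def)
  obtain e2 where e2: "e2 > 0" "\<And>b' t. \<bar>b' - b\<bar> < e2 \<Longrightarrow> a \<le> t \<Longrightarrow> t \<le> T \<Longrightarrow> X b' t < Y b' t"
    using nearby[OF open_conds(1), of a T b] a T by auto
  show ?thesis
  proof (rule exI[of _ "Min {e1, e2, b0 - b}"], intro conjI allI impI)
    show "0 < Min {e1, e2, b0 - b}" using e1 e2 b by simp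
    fix b' assume b': "b < b'" "b' < b + Min {e1, e2, b0 - b}"
    then show le: "b' \<le> b0" by simp
    obtain \<tau> where \<tau>: "\<tau> > 0" "\<And>t. 0 < t \<Longrightarrow> t \<le> \<tau> \<Longrightarrow> Q b' t < 0" "Y b' \<tau> < X b' \<tau>"
      using good[OF b'(1) le] unfolding crosses_def by blast
    have "X b' t < Y b' t" if "0 < t" "t \<le> T" for t
      using e1(3)[of b' t] e2(2)[of b' t] b' that a by (cases "t \<le> a") auto
    then have "\<tau> > T" using \<tau> by force
    then show "\<exists>\<tau>>T. (\<forall>t. 0 < t \<and> t \<le> \<tau> \<longrightarrow> Q b' t < 0) \<and> Y b' \<tau> < X b' \<tau>" using \<tau> by blast
  qed
qed

lemma Q_limit_le:
  assumes T: "0 < T" "\<And>t. 0 < t \<Longrightarrow> t \<le> T \<Longrightarrow> X b t < Y b t"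
  shows "Q b T \<le> 0"
proof (rule ccontr)
  assume "\<not> Q b T \<le> 0"
  then obtain e1 where e1: "e1 > 0" "\<And>b'. \<bar>b' - b\<bar> < e1 \<Longrightarrow> 0 < Q b' T"
    using nearby[OF open_conds(4), of T T b] T by auto
  obtain e2 where e2: "e2 > 0" "\<And>b'. b < b' \<Longrightarrow> b' < b + e2 \<Longrightarrow> (\<exists>\<tau>>T. (\<forall>t. 0 < t \<and> t \<le> \<tau> \<longrightarrow> Q b' t < 0))"
    using late[OF T] by blast
  define b' where "b' = b + min e1 e2 / 2"
  have "b < b'" "b' < b + e2" using e1 e2 by (auto simp: b'_def)
  then obtain \<tau> where "\<tau> > T" "\<forall>t. 0 < t \<and> t \<le> \<tau> \<longrightarrow> Q b' t < 0" using e2(2) by blast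
  then have "Q b' T < 0" using T by auto
  moreover have "0 < Q b' T" using e1 e2 by (intro e1(2)) (auto simp: b'_def)
  ultimately show False by simp
qed

lemma Q_nonpos:
  assumes "\<And>t. 0 < t \<Longrightarrow> t < T \<Longrightarrow> X b t < Y b t" "0 < t" "t < T"
  shows "Q b t \<le> 0"
  using Q_limit_le[of t] assms by auto

lemma Q_nonpos':
  assumes "\<And>t. 0 < t \<Longrightarrow> t < T \<Longrightarrow> X b t < Y b t" "0 < t" "t \<le> T"
  shows "Q b t \<le> 0"
proof -
  have "closure {0<..<T} = {0..T}" using assms by simp
  moreover have "Q b u \<le> 0" if "u \<in> closure {0<..<T}" for u
    by (rule continuous_le_on_closure[of "{0<..<T}" "Q b", OF _ that]) (use Q_nonpos[OF assms(1)] contQ in auto)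
  ultimately show ?thesis using assms by auto
qed

lemma arc_b:
  assumes "\<And>t. 0 < t \<Longrightarrow> t < T \<Longrightarrow> X b t < Y b t" "0 \<le> t" "t \<le> T"
  shows "ode (X b) (Y b) (P b) t" "0 < X b t" "0 < Y b t" "(X b t)\<^sup>2 + (Y b t)\<^sup>2 \<le> 2 * b\<^sup>2"
  using arc[where b = b and T = T and t = t] b_pos b Q_nonpos'[of T] assms by auto

lemma sphere_case:
  assumes eq: "RS = sqrt 2 * b" and T: "\<And>t. 0 < t \<Longrightarrow> t < T \<Longrightarrow> X b t < Y b t" and t: "0 \<le> t" "t \<le> T"
  shows "Q b t = 0" "h (X b t) (Y b t) (P b t) = RS"
proof -
  have "ode (X b) (Y b) (P b) s \<and> 0 < X b s \<and> 0 < Y b s \<and> (X b s)\<^sup>2 + (Y b s)\<^sup>2 \<le> (sqrt 2 * b)\<^sup>2" if "0 \<le> s" "s \<le> T" for s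
    using arc_b[OF T that] by (simp add: power_mult_distrib)
  from sphere_unique[OF this _ order_refl _ _ _ _ t] t
  show "Q b t = 0" "h (X b t) (Y b t) (P b t) = RS"
    using Q0[of b] b_pos RS_eq start_values(2) eq by (auto simp: init)
qed

text \<open>\<open>Y - X\<close> is positive before \<open>t1\<close> and zero at \<open>t1\<close>,
  so its derivative there is not positive.\<close>

lemma hit_slope:
  assumes t1: "0 < t1" "X b t1 = Y b t1" "\<And>t. 0 < t \<Longrightarrow> t < t1 \<Longrightarrow> X b t < Y b t"
  shows "cos (P b t1) + sin (P b t1) \<le> 0"
proof (rule ccontr)
  assume "\<not> ?thesis"
  then have pos: "0 < X b t1 * Y b t1 * (cos (P b t1) + sin (P b t1))"
    using arc_b[OF t1(3), of t1 t1] t1 by auto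
  have "ode (X b) (Y b) (P b) t1" using arc_b[OF t1(3), of t1 t1] t1 by auto
  from DERIV_pos_inc_left[OF diff'[OF this] pos] obtain d where d: "d > 0"
    "\<And>k. 0 < k \<Longrightarrow> k < d \<Longrightarrow> Y b (t1 - k) - X b (t1 - k) < Y b t1 - X b t1" by auto
  define k where "k = min (d / 2) (t1 / 2)"
  have "0 < k" "k < d" "k < t1" using d t1 by (auto simp: k_def)
  then show False using d(2)[of k] t1(3)[of "t1 - k"] t1(2) by auto
qed

text \<open>On the diagonal \<open>h\<close> is \<open>X\<close> times \<open>cos + sin\<close>,
  hence nonpositive at a first hit, whereas the sphere solution has
  \<open>h = RS > 0\<close>.\<close>

lemma sphere_never_hits:
  assumes eq: "RS = sqrt 2 * b" and t: "0 < t"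
  shows "X b t < Y b t"
proof (rule ccontr)
  assume "\<not> X b t < Y b t"
  then obtain t1 where t1: "0 < t1" "X b t1 = Y b t1" "\<And>t. 0 < t \<Longrightarrow> t < t1 \<Longrightarrow> X b t < Y b t"
    using first_diagonal_hit[OF b_pos _ t] b by (metis less_imp_le not_less)
  have "h (X b t1) (Y b t1) (P b t1) = RS" using sphere_case[OF eq t1(3), of t1 t1] t1 by auto
  then have "X b t1 * (cos (P b t1) + sin (P b t1)) = RS" using t1(2) by (simp add: h_def algebra_simps)
  moreover have "X b t1 * (cos (P b t1) + sin (P b t1)) \<le> 0"
    using hit_slope[OF t1] arc_b[OF t1(3), of t1 t1] t1(1) by (intro mult_nonneg_nonpos) auto
  ultimately show False using RS_pos by simp
qed

text \<open>At an interior zero \<open>Q\<close> has a local maximum, so its derivative vanishes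
  too, and by \<open>K_qh\<close> these two conditions say that \<open>h\<close> satisfies the
  sphere equation. By uniqueness \<open>h\<close> would have had this value from the start, but the
  starting radius exceeds \<open>RS\<close>.\<close>

lemma Q_strict:
  assumes R: "RS < sqrt 2 * b" and T: "\<And>t. 0 < t \<Longrightarrow> t < T \<Longrightarrow> X b t < Y b t" and t: "0 < t" "t < T"
  shows "Q b t < 0"
proof (rule ccontr)
  assume "\<not> Q b t < 0"
  then have Qt: "Q b t = 0" using Q_nonpos[OF T t] by simp
  note a = arc_b[OF T, of t]
  have o: "ode (X b) (Y b) (P b) t" "0 < X b t" "0 < Y b t" using a t by auto
  let ?h = "h (X b t) (Y b t) (P b t)" and ?K = "K (X b t) (Y b t) (P b t)"
  have "X b t * Y b t - ?K * ?h = 0"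
  proof (rule DERIV_local_max[OF q'[OF o(1)]])
    show "0 < min t (T - t)" using t by simp
    show "\<forall>s. \<bar>t - s\<bar> < min t (T - t) \<longrightarrow> Q b s \<le> Q b t"
      using Q_nonpos[OF T] Qt by auto
  qed
  then have xy: "X b t * Y b t = ?K * ?h" by simp
  have r: "(X b t)\<^sup>2 + (Y b t)\<^sup>2 = ?h\<^sup>2" using rho_qh[of "X b t" "Y b t" "P b t"] Qt by simp
  have hne: "?h \<noteq> 0" using xy o by auto
  have "?h\<^sup>2 * ?K = ?h\<^sup>2 * (X b t * Y b t) * (c + ?h / 2) - n * (2 * (X b t * Y b t) * ?h)"
    using K_qh[of "X b t" "Y b t" "P b t"] Qt unfolding r by (simp add: mult.assoc)
  then have "?h * (?K * ?h) = ?h * ((X b t * Y b t) * (?h * (c + ?h / 2) - 2 * n))"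
    by (simp add: power2_eq_square algebra_simps)
  then have "X b t * Y b t * 1 = X b t * Y b t * (?h * (c + ?h / 2) - 2 * n)" using hne xy by simp
  then have "1 = ?h * (c + ?h / 2) - 2 * n" using o by simp
  then have h0: "?h\<^sup>2 / 2 + c * ?h = 2 * n + 1" by (simp add: power2_eq_square algebra_simps)
  have all: "ode (X b) (Y b) (P b) s \<and> 0 < X b s \<and> 0 < Y b s \<and> (X b s)\<^sup>2 + (Y b s)\<^sup>2 \<le> (sqrt 2 * b)\<^sup>2" if "0 \<le> s" "s \<le> t" for s
    using arc_b[OF T, of s] that t by (simp add: power_mult_distrib)
  have "h (X b 0) (Y b 0) (P b 0) = ?h"
    by (rule sphere_unique(2)[OF all _ _ order_refl Qt refl h0]) (use t b_pos in auto)
  then have "?h = sqrt 2 * b" by (simp add: init start_values)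
  then show False using RS_strict[OF R] h0 by simp
qed

text \<open>The strict inequalities at \<open>T\<close> are inherited by the trajectories for
  \<open>b'\<close> slightly above \<open>b\<close>. These cross after \<open>T\<close> with
  \<open>Q < 0\<close>, while \<open>neck\<close> keeps them above the diagonal. The threshold
  \<delta> of \<open>neck\<close> does not depend on the trajectory, so it can be fixed before
  \<open>T\<close> is chosen.\<close>

lemma neck_contradiction:
  assumes never: "\<And>t. 0 < t \<Longrightarrow> X b t < Y b t" and r0: "r0 > 0"
    and T: "\<And>\<delta>. \<delta> > 0 \<Longrightarrow> \<exists>T>0. X b T < \<delta> \<and> r0\<^sup>2 < (X b T)\<^sup>2 + (Y b T)\<^sup>2 \<and> (X b T)\<^sup>2 + (Y b T)\<^sup>2 < (RS + \<delta>)\<^sup>2"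
  shows False
proof -
  from neck[OF r0] obtain \<delta> where N: "\<delta> > 0 \<and> (\<forall>x y p T t1. T \<le> t1 \<longrightarrow> (\<forall>t. T \<le> t \<and> t \<le> t1 \<longrightarrow> ode x y p t \<and> 0 < x t \<and> 0 < y t \<and> q (x t) (y t) (p t) < 0)
     \<longrightarrow> x T < \<delta> \<longrightarrow> r0\<^sup>2 \<le> (x T)\<^sup>2 + (y T)\<^sup>2 \<longrightarrow> (x T)\<^sup>2 + (y T)\<^sup>2 \<le> (RS + \<delta>)\<^sup>2 \<longrightarrow> x t1 < y t1)" ..
  note \<delta> = conjunct1[OF N] and neck = conjunct2[OF N]
  obtain T where T: "T > 0" "X b T < \<delta>" "r0\<^sup>2 < (X b T)\<^sup>2 + (Y b T)\<^sup>2" "(X b T)\<^sup>2 + (Y b T)\<^sup>2 < (RS + \<delta>)\<^sup>2"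
    using T[OF \<delta>] by blast
  define U where "U = {u :: real \<times> real \<times> real. fst u < \<delta> \<and> r0\<^sup>2 < (fst u)\<^sup>2 + (fst (snd u))\<^sup>2 \<and> (fst u)\<^sup>2 + (fst (snd u))\<^sup>2 < (RS + \<delta>)\<^sup>2}"
  have "open U" unfolding U_def by (intro open_Collect_conj open_Collect_less continuous_intros)
  then obtain e1 where e1: "e1 > 0" "\<And>b'. \<bar>b' - b\<bar> < e1 \<Longrightarrow> S b' T \<in> U"
    using nearby[of U T T b] T by (auto simp: U_def)
  obtain e2 where e2: "e2 > 0" "\<And>b'. b < b' \<Longrightarrow> b' < b + e2 \<Longrightarrow> b' \<le> b0 \<and> (\<exists>\<tau>>T. (\<forall>t. 0 < t \<and> t \<le> \<tau> \<longrightarrow> Q b' t < 0) \<and> Y b' \<tau> < X b' \<tau>)"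
    using late[OF T(1)] never by blast
  define b' where "b' = b + min e1 e2 / 2"
  have b': "b < b'" "b' < b + e2" "\<bar>b' - b\<bar> < e1" using e1 e2 by (auto simp: b'_def)
  obtain \<tau> where \<tau>: "b' \<le> b0" "\<tau> > T" "\<And>t. 0 < t \<Longrightarrow> t \<le> \<tau> \<Longrightarrow> Q b' t < 0" "Y b' \<tau> < X b' \<tau>"
    using e2(2)[OF b'(1,2)] by blast
  have "X b' \<tau> < Y b' \<tau>"
  proof (rule neck[rule_format, of T \<tau> "X b'" "Y b'" "P b'"])
    fix t assume t: "T \<le> t \<and> t \<le> \<tau>"
    show "ode (X b') (Y b') (P b') t \<and> 0 < X b' t \<and> 0 < Y b' t \<and> Q b' t < 0"
      using arc[of b' \<tau> t] \<tau> b' b_pos t T by (auto simp: less_imp_le)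
  qed (use e1(2)[OF b'(3)] \<tau> in \<open>auto simp: U_def\<close>)
  then show False using \<tau> by simp
qed

text \<open>Otherwise the limit is the sphere itself, which runs into the axis at radius exactly
  \<open>RS\<close>, within the range of \<open>neck\<close>.\<close>

lemma sphere_impossible: "RS < sqrt 2 * b"
proof (rule ccontr)
  assume "\<not> ?thesis"
  then have eq: "RS = sqrt 2 * b" using b by simp
  note never = sphere_never_hits[OF eq]
  have sph: "Q b t = 0" "h (X b t) (Y b t) (P b t) = RS" "ode (X b) (Y b) (P b) t" "0 < X b t" "0 < Y b t" if "0 \<le> t" for t
    using sphere_case[OF eq, of t t] arc_b[of t t] never that by auto
  have rho: "(X b t)\<^sup>2 + (Y b t)\<^sup>2 = RS\<^sup>2" if "0 \<le> t" for t
    using rho_qh[of "X b t" "Y b t" "P b t"] sph[OF that] by simp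
  have small: "\<exists>T>0. X b T < \<delta>" if \<delta>: "\<delta> > 0" for \<delta>
  proof (rule ccontr)
    assume "\<not> ?thesis"
    then have ge: "X b t \<ge> \<delta>" if "t > 0" for t using that by (meson not_less)
    \<comment> \<open>On the sphere \<open>sin p = y / RS\<close>, so with
      \<open>x >= \<delta>\<close> and \<open>x <= y\<close> the fall of \<open>x\<close> has rate
      at least \<open>\<delta> RS / 2\<close>; at this \<open>T\<close> it would be
      negative.\<close>
    define T where "T = 2 * b / (\<delta> * RS) + 1"
    have T: "T > 0" using \<delta> RS_pos b_pos by (simp add: T_def add_pos_pos)
    have "- X b 0 - \<delta> * RS / 2 * 0 \<le> - X b T - \<delta> * RS / 2 * T"
    proof (rule DERIV_nonneg_mono[of 0 T])
      fix t assume "0 \<le> t" "t \<le> T"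
      then show "((\<lambda>t. - X b t - \<delta> * RS / 2 * t) has_real_derivative - (- (X b t * Y b t * sin (P b t))) - \<delta> * RS / 2) (at t)"
        by (intro DERIV_diff DERIV_minus DERIV_cmult_Id x' sph)
    next
      fix t assume t: "0 < t" "t < T"
      have "RS * sin (P b t) = Y b t"
      proof -
        have "RS * (RS * sin (P b t)) = RS * Y b t"
        proof -
          have "RS\<^sup>2 * sin (P b t) = ((X b t)\<^sup>2 + (Y b t)\<^sup>2) * sin (P b t)" using rho[of t] t by simp
          also have "\<dots> = Y b t * h (X b t) (Y b t) (P b t) - X b t * Q b t"
            by (simp add: h_def q_def algebra_simps power2_eq_square)
          finally show ?thesis using sph[of t] t by (simp add: power2_eq_square mult.commute mult.left_commute)
        qed
        then show ?thesis using RS_pos by simp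
      qed
      then have s: "sin (P b t) = Y b t / RS" using RS_pos by (simp add: field_simps)
      have "(X b t)\<^sup>2 \<le> (Y b t)\<^sup>2" using never[of t] sph[of t] t by (intro power_mono) auto
      then have y2: "(Y b t)\<^sup>2 \<ge> RS\<^sup>2 / 2" using rho[of t] t by simp
      have "X b t * Y b t * sin (P b t) = X b t * ((Y b t)\<^sup>2 / RS)" unfolding s by (simp add: power2_eq_square)
      also have "\<dots> \<ge> \<delta> * (RS\<^sup>2 / 2 / RS)"
        using ge[of t] t y2 \<delta> RS_pos by (intro mult_mono divide_right_mono) auto
      finally show "0 \<le> - (- (X b t * Y b t * sin (P b t))) - \<delta> * RS / 2"
        using RS_pos by (simp add: power2_eq_square)
    qed (use T in auto)
    then have "X b T \<le> b - \<delta> * RS / 2 * T" by (simp add: init)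
    also have "\<dots> = - (\<delta> * RS / 2)" using \<delta> RS_pos by (simp add: T_def field_simps)
    also have "\<dots> < 0" using \<delta> RS_pos by simp
    finally show False using sph[of T] T by auto
  qed
  show False
  proof (rule neck_contradiction[OF never, of "RS / 2"])
    fix \<delta> :: real assume \<delta>: "\<delta> > 0"
    obtain T where "T > 0" "X b T < \<delta>" using small[OF \<delta>] by blast
    moreover have "(RS / 2)\<^sup>2 < RS\<^sup>2" "RS\<^sup>2 < (RS + \<delta>)\<^sup>2"
      using RS_pos \<delta> by (auto intro!: power_strict_mono)
    ultimately show "\<exists>T>0. X b T < \<delta> \<and> (RS / 2)\<^sup>2 < (X b T)\<^sup>2 + (Y b T)\<^sup>2 \<and> (X b T)\<^sup>2 + (Y b T)\<^sup>2 < (RS + \<delta>)\<^sup>2"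
      using rho[of T] by auto
  qed (use RS_pos in auto)
qed

lemma must_hit: "\<exists>t>0. Y b t \<le> X b t"
proof (rule ccontr)
  assume "\<not> ?thesis"
  then have never: "X b t < Y b t" if "0 < t" for t using that by (auto simp: not_le)
  have a: "ode (X b) (Y b) (P b) t" "0 < X b t" "0 < Y b t" "(X b t)\<^sup>2 + (Y b t)\<^sup>2 \<le> 2 * b\<^sup>2" if "0 \<le> t" for t
    using arc_b[of t t] never that by auto
  have Qneg: "Q b t < 0" if "0 < t" for t
    using Q_strict[OF sphere_impossible, of "t + 1" t] never that by auto
  let ?r = "\<lambda>t. (X b t)\<^sup>2 + (Y b t)\<^sup>2"
  have anti: "?r t \<le> ?r s" if "0 < s" "s \<le> t" for s t
  proof (rule rho_antimono[where p = "P b"])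
    fix u assume "s \<le> u" "u \<le> t"
    then show "ode (X b) (Y b) (P b) u \<and> 0 < X b u \<and> 0 < Y b u \<and> Q b u \<le> 0"
      using a[of u] Qneg[of u] that by auto
  qed (use that in auto)
  obtain t2 where t2: "t2 \<ge> 1" "?r t2 < RS\<^sup>2"
  proof (rule ccontr)
    assume no: "\<not> thesis"
    show False
    proof (rule no_stay_outside[of 1 "X b" "Y b" "P b"])
      fix t :: real assume "1 \<le> t"
      then show "ode (X b) (Y b) (P b) t \<and> 0 < X b t \<and> X b t < Y b t \<and> Q b t < 0"
        using a[of t] Qneg[of t] never[of t] by auto
      show "RS\<^sup>2 \<le> ?r t" using no that \<open>1 \<le> t\<close> by force
    qed
  qed
  obtain e0 where e0: "e0 > 0" "\<And>t. t \<ge> 1 \<Longrightarrow> ?r t \<ge> e0"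
  proof (rule ccontr)
    assume no: "\<not> thesis"
    show False
    proof (rule no_collapse[of 1 "X b" "Y b" "P b"])
      fix t :: real assume "1 \<le> t"
      then show "ode (X b) (Y b) (P b) t \<and> 0 < X b t \<and> X b t < Y b t \<and> Q b t \<le> 0"
        using a[of t] Qneg[of t] never[of t] by auto
    next
      fix e :: real assume "e > 0"
      then show "\<exists>t\<ge>1. ?r t < e" using no that by (meson not_less)
    qed
  qed
  define \<rho> where "\<rho> = sqrt (?r t2)"
  have \<rho>: "\<rho> < RS" "\<rho> \<ge> 0" "\<rho>\<^sup>2 = ?r t2"
    using t2 RS_pos real_sqrt_less_mono[OF t2(2)] by (auto simp: \<rho>_def)
  \<comment> \<open>Once the radius is below \<open>RS\<close>, the bound \<open>h <= \<rho>\<close>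
    keeps the rate of \<open>w q\<close> positive for every direction of the normal.\<close>
  define \<epsilon> where "\<epsilon> = 2 * n + 1 - \<rho>\<^sup>2 / 2 - c * \<rho>"
  have \<epsilon>: "\<epsilon> > 0"
  proof -
    have "\<rho>\<^sup>2 \<le> RS\<^sup>2" using \<rho> by (intro power_mono) auto
    moreover have "c * \<rho> < c * RS" using \<rho> c_pos by simp
    ultimately show ?thesis using RS_eq unfolding \<epsilon>_def by simp
  qed
  show False
  proof (rule neck_contradiction[OF never, of "sqrt (e0 / 2)"])
    show "sqrt (e0 / 2) > 0" using e0 by simp
    fix \<delta> :: real assume \<delta>: "\<delta> > 0"
    \<comment> \<open>If \<open>x\<close> stayed above \<delta>, \<open>w q\<close> would grow with
      slope at least \<open>k\<close> and become nonnegative. So the trajectory approaches the axis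
      at a radius between \<open>sqrt e0\<close> and \<open>RS\<close>.\<close>
    have "\<exists>T\<ge>t2. X b T < \<delta>"
    proof (rule ccontr)
      assume "\<not> ?thesis"
      then have ge: "X b t \<ge> \<delta>" if "t \<ge> t2" for t using that by (auto simp: not_less)
      define k where "k = \<delta> ^ n * \<delta> ^ n * exp (- b\<^sup>2 / 2) * (\<delta> * \<delta>) * \<epsilon>"
      have k: "k > 0" using \<delta> \<epsilon> by (simp add: k_def)
      let ?f = "\<lambda>t. w (X b t) (Y b t) * Q b t"
      define T where "T = t2 + (- ?f t2) / k"
      have f0: "?f t2 < 0" using Qneg[of t2] a[of t2] t2 by (intro mult_pos_neg w_pos) auto
      have "0 \<le> (- ?f t2) / k" using f0 k by (intro divide_nonneg_pos) auto
      then have T: "T \<ge> t2" by (simp add: T_def)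
      have "?f t2 - k * t2 \<le> ?f T - k * T"
      proof (rule DERIV_nonneg_mono[OF T])
        fix t assume "t2 \<le> t"
        then show "((\<lambda>t. ?f t - k * t) has_real_derivative w (X b t) (Y b t) * (X b t * Y b t) * (2 * n + 1 - ?r t / 2 - c * h (X b t) (Y b t) (P b t)) - k) (at t)"
          using t2 by (intro DERIV_diff DERIV_cmult_Id wq' a) auto
      next
        fix t assume t: "t2 < t"
        have xy: "X b t \<ge> \<delta>" "Y b t \<ge> \<delta>" using ge[of t] never[of t] t t2 by auto
        have "exp (- b\<^sup>2 / 2) \<le> exp (- ?r t / 4)" using a(4)[of t] t t2 by simp
        then have "\<delta> ^ n * \<delta> ^ n * exp (- b\<^sup>2 / 2) \<le> w (X b t) (Y b t)"
          unfolding w_def using xy \<delta> by (intro mult_mono power_mono) auto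
        moreover have "\<delta> * \<delta> \<le> X b t * Y b t" using xy \<delta> by (intro mult_mono) auto
        moreover have "\<epsilon> \<le> 2 * n + 1 - ?r t / 2 - c * h (X b t) (Y b t) (P b t)"
        proof -
          have r: "?r t \<le> \<rho>\<^sup>2" using anti[of t2 t] t t2 \<rho> by simp
          have "h (X b t) (Y b t) (P b t) \<le> sqrt (?r t)" using abs_h_le[of "X b t" "Y b t" "P b t"] by simp
          also have "\<dots> \<le> \<rho>" using r \<rho> by (simp add: real_le_lsqrt)
          finally have "c * h (X b t) (Y b t) (P b t) \<le> c * \<rho>" using c_pos by (intro mult_left_mono) auto
          moreover have "?r t / 2 \<le> \<rho>\<^sup>2 / 2" using r by simp
          ultimately show ?thesis unfolding \<epsilon>_def by linarith
        qed
        moreover have "0 < X b t * Y b t" "0 < w (X b t) (Y b t)" using xy \<delta> w_pos[of "X b t" "Y b t"] by auto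
        ultimately have "k \<le> w (X b t) (Y b t) * (X b t * Y b t) * (2 * n + 1 - ?r t / 2 - c * h (X b t) (Y b t) (P b t))"
          unfolding k_def using \<delta> \<epsilon> by (intro mult_mono[OF mult_mono]) (auto simp: less_imp_le)
        then show "0 \<le> w (X b t) (Y b t) * (X b t * Y b t) * (2 * n + 1 - ?r t / 2 - c * h (X b t) (Y b t) (P b t)) - k" by simp
      qed
      moreover have "k * T = k * t2 - ?f t2" using k by (simp add: T_def field_simps)
      moreover have "?f T < 0" using Qneg[of T] a[of T] t2 T by (intro mult_pos_neg w_pos) auto
      ultimately show False by simp
    qed
    then obtain T where T: "T \<ge> t2" "X b T < \<delta>" by blast
    have "?r T \<le> ?r t2" using anti[of t2 T] T t2 by auto
    also have "\<dots> < RS\<^sup>2" by (rule t2)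
    also have "\<dots> < (RS + \<delta>)\<^sup>2" using RS_pos \<delta> by (intro power_strict_mono) auto
    finally have "?r T < (RS + \<delta>)\<^sup>2" .
    moreover have "(sqrt (e0 / 2))\<^sup>2 < ?r T" using e0(2)[of T] e0(1) T t2 by simp
    ultimately show "\<exists>T>0. X b T < \<delta> \<and> (sqrt (e0 / 2))\<^sup>2 < ?r T \<and> ?r T < (RS + \<delta>)\<^sup>2"
      using T t2 by (intro exI[of _ T]) auto
  qed
qed

text \<open>If \<open>Q\<close> were still negative at the first hit, the hit would be transversal
  and the trajectory would continue below the diagonal with \<open>Q < 0\<close>, that is, cross.
  Hence \<open>Q = 0\<close> there, and \<open>p_bounds\<close> with \<open>hit_slope\<close> leaves
  only the angle \<open>5 pi / 4\<close>.\<close>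

lemma closing:
  assumes notE: "\<not> crosses b"
  obtains t1 where "0 < t1" "X b t1 = Y b t1" "P b t1 = 5 * pi / 4" "\<And>t. 0 < t \<Longrightarrow> t < t1 \<Longrightarrow> X b t < Y b t \<and> Q b t < 0"
    "\<And>t. 0 \<le> t \<Longrightarrow> t \<le> t1 \<Longrightarrow> ode (X b) (Y b) (P b) t \<and> 0 < X b t \<and> 0 < Y b t \<and> (X b t)\<^sup>2 + (Y b t)\<^sup>2 \<le> 2 * b\<^sup>2"
proof -
  obtain T where T: "0 < T" "Y b T \<le> X b T" using must_hit by blast
  obtain t1 where t1: "0 < t1" "X b t1 = Y b t1" "\<And>t. 0 < t \<Longrightarrow> t < t1 \<Longrightarrow> X b t < Y b t"
    using first_diagonal_hit[OF b_pos _ T] b by (metis less_imp_le)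
  have a: "ode (X b) (Y b) (P b) t" "0 < X b t" "0 < Y b t" "(X b t)\<^sup>2 + (Y b t)\<^sup>2 \<le> 2 * b\<^sup>2" if "0 \<le> t" "t \<le> t1" for t
    using arc_b[of t1 t] t1(3) that by auto
  have a1: "ode (X b) (Y b) (P b) t1" "0 < X b t1" using a[of t1] t1 by auto
  have Qneg: "Q b t < 0" if "0 < t" "t < t1" for t using Q_strict[OF sphere_impossible t1(3) that] .
  have Ql: "Q b t1 \<le> 0" using Q_nonpos'[OF t1(3), of t1] t1(1) by simp
  let ?C = "cos (P b t1) + sin (P b t1)"
  have C: "?C \<le> 0" by (rule hit_slope[OF t1])
  have Q1: "Q b t1 = 0"
  proof (rule ccontr)
    assume "Q b t1 \<noteq> 0"
    then have Q1: "Q b t1 < 0" using Ql by simp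
    then have "X b t1 * (cos (P b t1) - sin (P b t1)) < 0" using t1(2) by (simp add: q_def algebra_simps)
    then have cs: "cos (P b t1) - sin (P b t1) < 0" using a1 by (simp add: mult_less_0_iff)
    \<comment> \<open>At a tangential contact \<open>K = c x^2 > 0\<close> and
      \<open>cos - sin < 0\<close>, so \<open>cos + sin\<close> was positive just before. Then
      \<open>Y - X\<close> would have been nondecreasing up to its zero at \<open>t1\<close>, though
      it was positive there.\<close>
    have "?C \<noteq> 0"
    proof
      assume C0: "?C = 0"
      have "K (X b t1) (Y b t1) (P b t1) = c * X b t1 * X b t1 + ((X b t1)\<^sup>2 / 2 - n) * X b t1 * ?C"
        unfolding K_def t1(2)[symmetric] by (simp add: algebra_simps)
      then have Kpos: "K (X b t1) (Y b t1) (P b t1) > 0" using C0 c_pos a1 by simp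
      have "((\<lambda>t. cos (P b t) + sin (P b t)) has_real_derivative K (X b t1) (Y b t1) (P b t1) * (cos (P b t1) - sin (P b t1))) (at t1)"
        using p'[OF a1(1)] by (auto intro!: derivative_eq_intros simp: algebra_simps)
      from DERIV_neg_dec_left[OF this] Kpos cs obtain d where d: "d > 0"
        "\<And>k. 0 < k \<Longrightarrow> k < d \<Longrightarrow> ?C < cos (P b (t1 - k)) + sin (P b (t1 - k))"
        by (auto simp: mult_pos_neg)
      define k where "k = min (d / 2) (t1 / 2)"
      have k: "0 < k" "k < d" "k < t1" using d t1 by (auto simp: k_def)
      have "Y b (t1 - k) - X b (t1 - k) \<le> Y b t1 - X b t1"
      proof (rule DERIV_nonneg_mono[of "t1 - k" t1])
        fix s assume s: "t1 - k \<le> s" "s \<le> t1"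
        then show "((\<lambda>t. Y b t - X b t) has_real_derivative X b s * Y b s * (cos (P b s) + sin (P b s))) (at s)"
          using k by (intro diff' a) auto
      next
        fix s assume s: "t1 - k < s" "s < t1"
        have "0 < cos (P b s) + sin (P b s)" using d(2)[of "t1 - s"] s k C0 by auto
        then show "0 \<le> X b s * Y b s * (cos (P b s) + sin (P b s))" using a(2,3)[of s] s k
          by (intro mult_nonneg_nonneg) auto
      qed (use k in auto)
      then show False using t1(2) t1(3)[of "t1 - k"] k by auto
    qed
    then have "X b t1 * Y b t1 * ?C < 0" using C a1 t1(2) by (intro mult_pos_neg) auto
    from DERIV_neg_dec_right[OF diff'[OF a1(1)] this] obtain d where d: "d > 0"
      "\<And>k. 0 < k \<Longrightarrow> k < d \<Longrightarrow> Y b (t1 + k) - X b (t1 + k) < Y b t1 - X b t1" by auto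
    have "open {t. Q b t < 0}" by (intro open_Collect_less contQ continuous_intros)
    then obtain d2 where d2: "d2 > 0" "ball t1 d2 \<subseteq> {t. Q b t < 0}" using Q1 openE[of "{t. Q b t < 0}" t1] by auto
    define \<tau> where "\<tau> = t1 + min d d2 / 2"
    have "crosses b"
      unfolding crosses_def
    proof (intro exI[of _ \<tau>] conjI allI impI)
      show "0 < \<tau>" using t1 d d2 by (auto simp: \<tau>_def add_pos_pos)
      show "Y b \<tau> < X b \<tau>" using d(2)[of "min d d2 / 2"] d d2 t1(2) by (auto simp: \<tau>_def)
      fix t assume t: "0 < t \<and> t \<le> \<tau>"
      show "Q b t < 0"
      proof (cases "t < t1")
        case False
        then have "t \<in> ball t1 d2" using t d2 d by (auto simp: \<tau>_def dist_norm)
        then show ?thesis using d2 by auto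
      qed (use Qneg t in auto)
    qed
    then show False using notE by simp
  qed
  have pb: "0 < P b t1" "P b t1 < 3 * pi / 2"
  proof -
    have pos: "X b t > 0 \<and> Y b t > 0 \<and> Q b t \<le> 0" if "0 \<le> t" "t \<le> t1" for t
      using a[of t] Q_nonpos'[OF t1(3), of t] Q0[of b] that by (cases "t = 0") auto
    show "0 < P b t1" "P b t1 < 3 * pi / 2"
      using p_bounds[of t1 "P b" "X b" "Y b" t1, OF cont(3) init(3) pos] t1(1) by auto
  qed
  have "P b t1 = 5 * pi / 4"
  proof -
    have "X b t1 * (cos (P b t1) - sin (P b t1)) = 0" using Q1 t1(2) by (simp add: q_def algebra_simps)
    then have eq: "cos (P b t1) = sin (P b t1)" using a1 by simp
    have "sin (P b t1 - pi / 4) = 0" by (simp add: sin_diff eq cos_45 sin_45)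
    then obtain i :: int where i: "P b t1 - pi / 4 = of_int i * pi" unfolding sin_zero_iff_int2 by blast
    have "(-1) * pi < of_int i * pi" "of_int i * pi < 2 * pi" using i pb pi_gt_zero by linarith+
    then have "-1 < (of_int i :: real)" "(of_int i :: real) < 2"
      using mult_less_cancel_right_pos[OF pi_gt_zero] by blast+
    then have "i = 0 \<or> i = 1" by linarith
    moreover have "i \<noteq> 0"
    proof
      assume "i = 0"
      then have e: "P b t1 = pi / 4" using i by simp
      show False using C unfolding e cos_45 sin_45 by simp
    qed
    ultimately show ?thesis using i by simp
  qed
  then show ?thesis using that[of t1] t1 Qneg a by auto
qed

end

end

section \<open>Closing up by reflection in the diagonal\<close>

lemma periodic_int:
  fixes f :: "real \<Rightarrow> 'a"
  assumes "\<And>t. f (t + a) = f t"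
  shows "f (t + of_int k * a) = f t"
proof (induction k arbitrary: t rule: int_induct[where k = 0])
  case (step1 i)
  have "f (t + of_int (i + 1) * a) = f ((t + a) + of_int i * a)" by (simp add: algebra_simps)
  then show ?case using step1.IH[of "t + a"] assms by simp
next
  case (step2 i)
  have "f (t + of_int (i - 1) * a) = f ((t - a) + of_int i * a)" by (simp add: algebra_simps)
  then show ?case using step2.IH[of "t - a"] assms[of "t - a"] by simp
qed simp

lemma reduce_mod:
  fixes T t :: real
  assumes "T > 0"
  obtains k :: int where "- T < t + of_int k * (2 * T)" "t + of_int k * (2 * T) \<le> T"
proof -
  define m where "m = \<lceil>(t - T) / (2 * T)\<rceil>"
  have "(t - T) / (2 * T) \<le> of_int m" "of_int m < (t - T) / (2 * T) + 1"
    unfolding m_def by linarith+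
  then have "t - T \<le> of_int m * (2 * T)" "of_int m * (2 * T) < t - T + 2 * T"
    using assms by (simp_all add: field_simps)
  then show ?thesis using that[of "- m"] by simp
qed

context profile
begin

text \<open>Swapping the coordinates mirrors the curve, and reversing time restores the orientation
  of the normal. The angle \<open>d\<close> is \<open>pi / 2\<close> at the first meeting with the
  diagonal and \<open>5 pi / 2\<close> at the second.\<close>

lemma clamped_ode_reflection:
  assumes "\<And>t. clamped_ode M x y p t" "sin d = 1" "cos d = 0"
  shows "clamped_ode M (\<lambda>t. y (a - t)) (\<lambda>t. x (a - t)) (\<lambda>t. d - p (a - t)) t"
proof -
  have *: "((\<lambda>t. f (a - t)) has_real_derivative - f') (at t)" if "(f has_real_derivative f') (at (a - t))" for f f'
  proof -
    have "((\<lambda>t. a - t) has_real_derivative - 1) (at t)" by (auto intro!: derivative_eq_intros)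
    from DERIV_chain2[where f = f and g = "\<lambda>t. a - t", OF that this] show ?thesis by simp
  qed
  have sc: "sin (d - z) = cos z" "cos (d - z) = sin z" for z by (simp_all add: sin_diff cos_diff assms)
  have Ksym: "K v u (d - z) = K u v z" for u v z by (simp add: K_def sc algebra_simps)
  show ?thesis
    using assms(1)[of "a - t"] unfolding clamped_ode_def sc Ksym
    by (auto dest!: * simp: mult.commute mult.left_commute intro!: derivative_eq_intros)
qed

lemma closed_profile:
  obtains x y p :: "real \<Rightarrow> real" and T where "T > 0"
    "\<And>t. ode x y p t" "\<And>t. 0 < x t" "\<And>t. 0 < y t"
    "\<And>t. x (t + 2 * T) = x t" "\<And>t. y (t + 2 * T) = y t" "\<And>t. p (t + 2 * T) = p t + 2 * pi"
    "\<And>s t. x s = x t \<Longrightarrow> y s = y t \<Longrightarrow> \<exists>k::int. s = t + of_int k * (2 * T)"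
proof -
  obtain b0 where b0: "b0 > 0" "RS < sqrt 2 * b0" and large: "\<And>x y p. x 0 = b0 \<Longrightarrow> y 0 = b0 \<Longrightarrow> p 0 = pi / 4 \<Longrightarrow> (\<And>t. clamped_ode (2 * b0) x y p t)
      \<Longrightarrow> (\<exists>\<tau>>0. (\<forall>t. 0 < t \<and> t \<le> \<tau> \<longrightarrow> q (x t) (y t) (p t) < 0) \<and> y \<tau> < x \<tau>)"
    using large_start by (metis order_refl)
  define M where "M = 2 * b0"
  have M: "M \<ge> 0" using b0 by (simp add: M_def)
  obtain X Y P L where F': "L > 0 \<and> (\<forall>b. X b 0 = b \<and> Y b 0 = b \<and> P b 0 = pi / 4) \<and> (\<forall>b t. clamped_ode M (X b) (Y b) (P b) t)
     \<and> (\<forall>b b' t. \<bar>X b t - X b' t\<bar> \<le> 2 * \<bar>b - b'\<bar> * exp (L * \<bar>t\<bar>) \<and> \<bar>Y b t - Y b' t\<bar> \<le> 2 * \<bar>b - b'\<bar> * exp (L * \<bar>t\<bar>)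
          \<and> \<bar>P b t - P b' t\<bar> \<le> 2 * \<bar>b - b'\<bar> * exp (L * \<bar>t\<bar>))"
    using clamped_ode_flow[OF M] by (elim exE) (rule that)
  have F: "L > 0" "X b 0 = b \<and> Y b 0 = b \<and> P b 0 = pi / 4" "clamped_ode M (X b) (Y b) (P b) t"
     "\<bar>X b t - X b' t\<bar> \<le> 2 * \<bar>b - b'\<bar> * exp (L * \<bar>t\<bar>)" "\<bar>Y b t - Y b' t\<bar> \<le> 2 * \<bar>b - b'\<bar> * exp (L * \<bar>t\<bar>)"
     "\<bar>P b t - P b' t\<bar> \<le> 2 * \<bar>b - b'\<bar> * exp (L * \<bar>t\<bar>)" for b b' t
    using F' by auto
  interpret shoot n c M L b0 X Y P
    by unfold_locales (use b0 F in \<open>auto simp: M_def power2_eq_square\<close>)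
  have "crosses b0"
    unfolding crosses_def using large[of "X b0" "Y b0" "P b0"] F by (auto simp: M_def)
  then obtain b where b: "RS \<le> sqrt 2 * b" "b < b0" "\<And>b'. b < b' \<Longrightarrow> b' \<le> b0 \<Longrightarrow> crosses b'" "RS < sqrt 2 * b \<Longrightarrow> \<not> crosses b"
    using threshold by blast
  have bp: "b > 0" by (rule b_pos[OF b(1-3)])
  have notE: "\<not> crosses b" by (rule b(4)[OF sphere_impossible[OF b(1-3)]])
  obtain T where T: "0 < T" "X b T = Y b T" "P b T = 5 * pi / 4" "\<And>t. 0 < t \<Longrightarrow> t < T \<Longrightarrow> X b t < Y b t \<and> Q b t < 0"
    "\<And>t. 0 \<le> t \<Longrightarrow> t \<le> T \<Longrightarrow> ode (X b) (Y b) (P b) t \<and> 0 < X b t \<and> 0 < Y b t \<and> (X b t)\<^sup>2 + (Y b t)\<^sup>2 \<le> 2 * b\<^sup>2"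
    using closing[OF b(1-3) notE] by blast
  define x y p where "x = X b" and "y = Y b" and "p = P b"
  have clamped_ode: "clamped_ode M x y p t" for t unfolding x_def y_def p_def by (rule F(3))
  have i0: "x 0 = b" "y 0 = b" "p 0 = pi / 4" using F(2) by (auto simp: x_def y_def p_def)
  have pos: "0 < x t" "0 < y t" for t using clamped_ode_pos[OF M clamped_ode] i0 bp by auto
  have r0: "x t = y (- t)" "y t = x (- t)" "p t = pi / 2 - p (- t)" for t
  proof -
    have "clamped_ode M (\<lambda>t. y (0 - t)) (\<lambda>t. x (0 - t)) (\<lambda>t. pi / 2 - p (0 - t)) t" for t
      by (rule clamped_ode_reflection[OF clamped_ode]) auto
    from clamped_ode_unique[OF M clamped_ode this, of 0 t] i0
    show "x t = y (- t)" "y t = x (- t)" "p t = pi / 2 - p (- t)" by auto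
  qed
  have sc: "sin (5 * pi / 2) = 1" "cos (5 * pi / 2) = 0"
  proof -
    have "5 * pi / 2 = pi / 2 + 2 * pi" by simp
    then show "sin (5 * pi / 2) = 1" "cos (5 * pi / 2) = 0" by (simp_all only: sin_periodic cos_periodic sin_pi_half cos_pi_half)
  qed
  have rT: "x t = y (2 * T - t)" "y t = x (2 * T - t)" "p t = 5 * pi / 2 - p (2 * T - t)" for t
  proof -
    have "clamped_ode M (\<lambda>t. y (2 * T - t)) (\<lambda>t. x (2 * T - t)) (\<lambda>t. 5 * pi / 2 - p (2 * T - t)) t" for t
      by (rule clamped_ode_reflection[OF clamped_ode sc])
    from clamped_ode_unique[OF M clamped_ode this, of T t] T(2,3)
    show "x t = y (2 * T - t)" "y t = x (2 * T - t)" "p t = 5 * pi / 2 - p (2 * T - t)"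
      by (auto simp: x_def y_def p_def)
  qed
  \<comment> \<open>The reflections about the times 0 and \<open>T\<close> compose to the shift by
    \<open>2 T\<close>; the angles \<open>5 pi / 2\<close> and \<open>pi / 2\<close> differ by the
    full turn of the normal.\<close>
  have per: "x (t + 2 * T) = x t" "y (t + 2 * T) = y t" "p (t + 2 * T) = p t + 2 * pi" for t
    using rT[of "t + 2 * T"] r0[of t] by auto
  have perk: "x (t + of_int k * (2 * T)) = x t" "y (t + of_int k * (2 * T)) = y t" for t k
    using periodic_int[of x "2 * T"] periodic_int[of y "2 * T"] per by auto
  have "(x t)\<^sup>2 + (y t)\<^sup>2 \<le> 2 * b\<^sup>2" for t
  proof -
    obtain k where k: "- T < t + of_int k * (2 * T)" "t + of_int k * (2 * T) \<le> T"
      using reduce_mod[OF T(1)] by blast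
    define s where "s = t + of_int k * (2 * T)"
    have "(x s)\<^sup>2 + (y s)\<^sup>2 \<le> 2 * b\<^sup>2"
      using T(5)[of s] T(5)[of "- s"] r0[of s] k by (cases "0 \<le> s") (auto simp: s_def x_def y_def)
    then show ?thesis by (simp add: s_def perk)
  qed
  then have le: "x t \<le> M" "y t \<le> M" for t
  proof -
    assume a: "\<And>t. (x t)\<^sup>2 + (y t)\<^sup>2 \<le> 2 * b\<^sup>2"
    have "b\<^sup>2 \<le> b0\<^sup>2" using b bp by (intro power_mono) auto
    moreover have "M\<^sup>2 = 4 * b0\<^sup>2" by (simp add: M_def power_mult_distrib)
    ultimately have "2 * b\<^sup>2 \<le> M\<^sup>2" using zero_le_power2[of b0] by linarith
    then have "(x t)\<^sup>2 \<le> M\<^sup>2" "(y t)\<^sup>2 \<le> M\<^sup>2" using a[of t] zero_le_power2[of "x t"] zero_le_power2[of "y t"] by linarith+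
    then show "x t \<le> M" "y t \<le> M" using M by (auto intro: power2_le_imp_le)
  qed
  have ode: "ode x y p t" for t by (rule clamped_ode_imp_ode[OF clamped_ode pos(1) le(1) pos(2) le(2)])
  have rho: "(x t)\<^sup>2 + (y t)\<^sup>2 < (x s)\<^sup>2 + (y s)\<^sup>2" if "0 \<le> s" "s < t" "t \<le> T" for s t
  proof -
    have "- ((x s)\<^sup>2 + (y s)\<^sup>2) < - ((x t)\<^sup>2 + (y t)\<^sup>2)"
    proof (rule DERIV_pos_strict_mono[OF that(2)])
      fix u show "((\<lambda>t. - ((x t)\<^sup>2 + (y t)\<^sup>2)) has_real_derivative - (2 * x u * y u * q (x u) (y u) (p u))) (at u)"
        by (intro DERIV_minus rho' ode)
    next
      fix u assume "s < u" "u < t"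
      then have "q (x u) (y u) (p u) < 0" using T(4)[of u] that by (auto simp: x_def y_def p_def)
      then have "2 * x u * y u * q (x u) (y u) (p u) < 0" using pos by (intro mult_pos_neg) auto
      then show "0 < - (2 * x u * y u * q (x u) (y u) (p u))" by simp
    qed
    then show ?thesis by simp
  qed
  have half: "x t \<le> y t" if "0 \<le> t" "t \<le> T" for t
    using T(2,4) i0 that by (cases "t = 0"; cases "t = T") (auto simp: x_def y_def less_imp_le)
  have half': "y t < x t" if "- T < t" "t < 0" for t
    using T(4)[of "- t"] r0[of t] that by (auto simp: x_def y_def)
  have inj0: "s = t" if "x s = x t" "y s = y t" "0 \<le> s" "s \<le> T" "0 \<le> t" "t \<le> T" for s t
    using rho[of s t] rho[of t s] that by (cases s t rule: linorder_cases) auto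
  \<comment> \<open>On \<open>[0, T]\<close> the radius is strictly decreasing and
    \<open>x <= y\<close>; the mirrored half, for times in \<open>(- T, 0)\<close>, has
    \<open>y < x\<close>. So each half is injective and the two are disjoint.\<close>
  have inj1: "s = t" if "x s = x t" "y s = y t" "- T < s" "s \<le> T" "- T < t" "t \<le> T" for s t
  proof (cases "0 \<le> s"; cases "0 \<le> t")
    assume "0 \<le> s" "0 \<le> t" then show ?thesis using inj0 that by auto
  next
    assume "0 \<le> s" "\<not> 0 \<le> t" then show ?thesis using half[of s] half'[of t] that by auto
  next
    assume "\<not> 0 \<le> s" "0 \<le> t" then show ?thesis using half[of t] half'[of s] that by auto
  next
    assume "\<not> 0 \<le> s" "\<not> 0 \<le> t"
    then show ?thesis using inj0[of "- s" "- t"] r0[of s] r0[of t] that by auto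
  qed
  show ?thesis
  proof (rule that[of T x y p, OF T(1) ode pos per])
    fix s t assume st: "x s = x t" "y s = y t"
    obtain j where j: "- T < s + of_int j * (2 * T)" "s + of_int j * (2 * T) \<le> T"
      using reduce_mod[OF T(1)] by blast
    obtain k where k: "- T < t + of_int k * (2 * T)" "t + of_int k * (2 * T) \<le> T"
      using reduce_mod[OF T(1)] by blast
    have "s + of_int j * (2 * T) = t + of_int k * (2 * T)"
      by (rule inj1) (use st perk j k in auto)
    then have "s = t + of_int (k - j) * (2 * T)" by (simp add: algebra_simps)
    then show "\<exists>k::int. s = t + of_int k * (2 * T)" by blast
  qed
qed

end

section \<open>Smooth maps\<close>

lemma Ck_on_cong:
  assumes "open U" "\<And>x. x \<in> U \<Longrightarrow> f x = g x" "Ck_on k U f"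
  shows "Ck_on k U g"
  using assms(2,3)
proof (induction k arbitrary: f g)
  case 0
  then show ?case using continuous_on_cong[of U U f g] by simp
next
  case (Suc k)
  have d: "(g has_derivative frechet_derivative f (at x)) (at x)" if "x \<in> U" for x
  proof (rule has_derivative_transform_within_open[OF _ assms(1) that])
    show "(f has_derivative frechet_derivative f (at x)) (at x)"
      using Suc.prems(2) that frechet_derivative_works[of f "at x"] by auto
  qed (use Suc.prems in auto)
  have "Ck_on k U (\<lambda>x. frechet_derivative g (at x) v)" for v
  proof (rule Suc.IH)
    show "frechet_derivative f (at x) v = frechet_derivative g (at x) v" if "x \<in> U" for x
      using frechet_derivative_at[OF d[OF that]] by simp
    show "Ck_on k U (\<lambda>x. frechet_derivative f (at x) v)" using Suc.prems(2) by simp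
  qed
  then show ?case using d by (auto simp: differentiable_def)
qed

lemma Ck_on_SucI:
  assumes "open U" "\<And>x. x \<in> U \<Longrightarrow> (f has_derivative D x) (at x)" "\<And>v. Ck_on k U (\<lambda>x. D x v)"
  shows "Ck_on (Suc k) U f"
proof -
  have "Ck_on k U (\<lambda>x. frechet_derivative f (at x) v)" for v
    by (rule Ck_on_cong[OF assms(1) _ assms(3)[of v]])
      (use frechet_derivative_at[OF assms(2)] in simp)
  then show ?thesis using assms(2) by (auto simp: differentiable_def)
qed

lemma Ck_on_SucD:
  assumes "Ck_on (Suc k) U f"
  shows "x \<in> U \<Longrightarrow> (f has_derivative frechet_derivative f (at x)) (at x)"
    "Ck_on k U (\<lambda>x. frechet_derivative f (at x) v)"
  using assms frechet_derivative_works[of f "at x"] by auto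

lemma Ck_on_Suc_imp: "Ck_on (Suc k) U f \<Longrightarrow> Ck_on k U f"
proof (induction k arbitrary: f)
  case 0
  then show ?case
    by (auto intro!: continuous_at_imp_continuous_on differentiable_imp_continuous_within)
next
  case (Suc k)
  then show ?case by (metis Ck_on.simps(2))
qed

lemma Ck_on_subset: "Ck_on k U f \<Longrightarrow> V \<subseteq> U \<Longrightarrow> Ck_on k V f"
  by (induction k arbitrary: f) (auto intro: continuous_on_subset)

lemma Ck_on_const: "open U \<Longrightarrow> Ck_on k U (\<lambda>x. a)"
  by (induction k arbitrary: a) auto

lemma Ck_on_bounded_linear: "open U \<Longrightarrow> bounded_linear f \<Longrightarrow> Ck_on k U f"
proof (cases k)
  case (Suc m)
  assume "open U" "bounded_linear f"
  then show ?thesis unfolding Suc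
    by (intro Ck_on_SucI[where D = "\<lambda>x. f"]) (auto intro: bounded_linear_imp_has_derivative Ck_on_const)
qed (auto intro: linear_continuous_on)

lemma Ck_on_linear_compose: "open U \<Longrightarrow> bounded_linear L \<Longrightarrow> Ck_on k U f \<Longrightarrow> Ck_on k U (\<lambda>x. L (f x))"
proof (induction k arbitrary: f)
  case 0
  then show ?case by (auto intro: bounded_linear.continuous_on)
next
  case (Suc k)
  show ?case
    by (rule Ck_on_SucI[OF Suc.prems(1)])
      (auto intro!: bounded_linear.has_derivative[OF Suc.prems(2)] Ck_on_SucD(1)[OF Suc.prems(3)]
         Suc.IH[OF Suc.prems(1,2)] Ck_on_SucD(2)[OF Suc.prems(3)])
qed

lemma Ck_on_add: "open U \<Longrightarrow> Ck_on k U f \<Longrightarrow> Ck_on k U g \<Longrightarrow> Ck_on k U (\<lambda>x. f x + g x)"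
proof (induction k arbitrary: f g)
  case (Suc k)
  show ?case
    by (rule Ck_on_SucI[OF Suc.prems(1)])
      (auto intro!: has_derivative_add Ck_on_SucD(1)[OF Suc.prems(2)] Ck_on_SucD(1)[OF Suc.prems(3)]
         Suc.IH[OF Suc.prems(1)] Ck_on_SucD(2)[OF Suc.prems(2)] Ck_on_SucD(2)[OF Suc.prems(3)])
qed (auto intro: continuous_intros)

lemma Ck_on_sum: "open U \<Longrightarrow> (\<And>i. i \<in> I \<Longrightarrow> Ck_on k U (f i)) \<Longrightarrow> Ck_on k U (\<lambda>x. \<Sum>i\<in>I. f i x)"
  by (induction I rule: infinite_finite_induct) (auto intro: Ck_on_const Ck_on_add)

lemma Ck_on_bilinear:
  assumes "bounded_bilinear b"
  shows "open U \<Longrightarrow> Ck_on k U f \<Longrightarrow> Ck_on k U g \<Longrightarrow> Ck_on k U (\<lambda>x. b (f x) (g x))"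
proof (induction k arbitrary: f g)
  case 0
  then show ?case by (auto intro: bounded_bilinear.continuous_on[OF assms])
next
  case (Suc k)
  show ?case
    by (rule Ck_on_SucI[OF Suc.prems(1)])
      (auto intro!: bounded_bilinear.FDERIV[OF assms] Ck_on_SucD(1)[OF Suc.prems(2)] Ck_on_SucD(1)[OF Suc.prems(3)]
         Ck_on_add Suc.IH[OF Suc.prems(1)] Ck_on_SucD(2)[OF Suc.prems(2)] Ck_on_SucD(2)[OF Suc.prems(3)]
         Ck_on_Suc_imp[OF Suc.prems(2)] Ck_on_Suc_imp[OF Suc.prems(3)] Suc.prems(1))
qed

text \<open>\<open>Ck_on\<close> speaks of derivatives in fixed directions only, so the chain rule
  is expanded over \<open>Basis\<close>: the direction fed to the derivative of \<open>g\<close>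
  would otherwise vary with the point.\<close>

lemma Ck_on_compose:
  assumes "open U" "open V"
  shows "Ck_on k U f \<Longrightarrow> Ck_on k V g \<Longrightarrow> f ` U \<subseteq> V \<Longrightarrow> Ck_on k U (\<lambda>x. g (f x))"
proof (induction k arbitrary: f g)
  case 0
  then show ?case by (auto intro: continuous_on_compose2)
next
  case (Suc k)
  let ?D = "\<lambda>x v. \<Sum>b\<in>Basis. (frechet_derivative f (at x) v \<bullet> b) *\<^sub>R frechet_derivative g (at (f x)) b"
  show ?case
  proof (rule Ck_on_SucI[OF assms(1)])
    fix x assume x: "x \<in> U"
    have df: "(f has_derivative frechet_derivative f (at x)) (at x)" by (rule Ck_on_SucD(1)[OF Suc.prems(1) x])
    have dg: "(g has_derivative frechet_derivative g (at (f x))) (at (f x))"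
      using Ck_on_SucD(1)[OF Suc.prems(2)] Suc.prems(3) x by auto
    have "linear (frechet_derivative g (at (f x)))" using dg by (rule has_derivative_linear)
    then have "(\<Sum>b\<in>Basis. (w \<bullet> b) *\<^sub>R frechet_derivative g (at (f x)) b)
        = frechet_derivative g (at (f x)) (\<Sum>b\<in>Basis. (w \<bullet> b) *\<^sub>R b)" for w
      by (simp only: linear_sum linear_cmul)
    then have "?D x = (\<lambda>v. frechet_derivative g (at (f x)) (frechet_derivative f (at x) v))"
      by (simp only: euclidean_representation)
    then show "((\<lambda>x. g (f x)) has_derivative ?D x) (at x)"
      using has_derivative_compose[OF df dg] by simp
  next
    fix v
    show "Ck_on k U (\<lambda>x. ?D x v)"
    proof (intro Ck_on_sum[OF assms(1)] Ck_on_bilinear[OF bounded_bilinear_scaleR assms(1)])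
      fix b :: 'b
      show "Ck_on k U (\<lambda>x. frechet_derivative f (at x) v \<bullet> b)"
        by (rule Ck_on_linear_compose[OF assms(1) bounded_linear_inner_left Ck_on_SucD(2)[OF Suc.prems(1)]])
      show "Ck_on k U (\<lambda>x. frechet_derivative g (at (f x)) b)"
        by (rule Suc.IH[OF Ck_on_Suc_imp[OF Suc.prems(1)] Ck_on_SucD(2)[OF Suc.prems(2)] Suc.prems(3)])
    qed
  qed
qed

lemma Ck_on_real_SucI:
  fixes f :: "real \<Rightarrow> 'b::euclidean_space"
  assumes "open U" "\<And>t. t \<in> U \<Longrightarrow> (f has_vector_derivative f' t) (at t)" "Ck_on k U f'"
  shows "Ck_on (Suc k) U f"
  by (rule Ck_on_SucI[OF assms(1), where D = "\<lambda>t v. v *\<^sub>R f' t"])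
    (use assms in \<open>auto simp: has_vector_derivative_def intro: Ck_on_linear_compose[OF _ bounded_linear_scaleR_right]\<close>)

lemma smooth_onI: "(\<And>k. Ck_on k U f) \<Longrightarrow> smooth_on U f"
  by (simp add: smooth_on_def)

lemma smooth_onD: "smooth_on U f \<Longrightarrow> Ck_on k U f"
  by (simp add: smooth_on_def)

lemma smooth_on_subset: "smooth_on U f \<Longrightarrow> V \<subseteq> U \<Longrightarrow> smooth_on V f"
  by (auto simp: smooth_on_def intro: Ck_on_subset)

lemma smooth_on_const: "open U \<Longrightarrow> smooth_on U (\<lambda>x. a)"
  by (simp add: smooth_on_def Ck_on_const)

lemma smooth_on_linear: "open U \<Longrightarrow> bounded_linear L \<Longrightarrow> smooth_on U L"
  by (simp add: smooth_on_def Ck_on_bounded_linear)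

lemma smooth_on_linear_compose: "open U \<Longrightarrow> bounded_linear L \<Longrightarrow> smooth_on U f \<Longrightarrow> smooth_on U (\<lambda>x. L (f x))"
  by (simp add: smooth_on_def Ck_on_linear_compose)

lemma smooth_on_add: "open U \<Longrightarrow> smooth_on U f \<Longrightarrow> smooth_on U g \<Longrightarrow> smooth_on U (\<lambda>x. f x + g x)"
  by (simp add: smooth_on_def Ck_on_add)

lemma smooth_on_bilinear:
  "bounded_bilinear b \<Longrightarrow> open U \<Longrightarrow> smooth_on U f \<Longrightarrow> smooth_on U g \<Longrightarrow> smooth_on U (\<lambda>x. b (f x) (g x))"
  by (simp add: smooth_on_def Ck_on_bilinear)

lemma smooth_on_compose:
  "open U \<Longrightarrow> open V \<Longrightarrow> smooth_on U f \<Longrightarrow> smooth_on V g \<Longrightarrow> f ` U \<subseteq> V \<Longrightarrow> smooth_on U (\<lambda>x. g (f x))"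
  unfolding smooth_on_def by (auto intro: Ck_on_compose)

lemma smooth_on_id: "open U \<Longrightarrow> smooth_on U (\<lambda>x. x)"
  by (rule smooth_on_linear[OF _ bounded_linear_ident])

lemma smooth_on_fst: "open U \<Longrightarrow> smooth_on U f \<Longrightarrow> smooth_on U (\<lambda>x. fst (f x))"
  by (rule smooth_on_linear_compose[OF _ bounded_linear_fst])

lemma smooth_on_snd: "open U \<Longrightarrow> smooth_on U f \<Longrightarrow> smooth_on U (\<lambda>x. snd (f x))"
  by (rule smooth_on_linear_compose[OF _ bounded_linear_snd])

lemma smooth_on_scaleR: "open U \<Longrightarrow> smooth_on U f \<Longrightarrow> smooth_on U g \<Longrightarrow> smooth_on U (\<lambda>x. f x *\<^sub>R g x)"
  by (rule smooth_on_bilinear[OF bounded_bilinear_scaleR])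

lemma smooth_on_mult: "open U \<Longrightarrow> smooth_on U f \<Longrightarrow> smooth_on U g \<Longrightarrow> smooth_on U (\<lambda>x. f x * g x :: real)"
  by (rule smooth_on_bilinear[OF bounded_bilinear_mult])

lemma smooth_on_inner: "open U \<Longrightarrow> smooth_on U f \<Longrightarrow> smooth_on U g \<Longrightarrow> smooth_on U (\<lambda>x. f x \<bullet> g x)"
  by (rule smooth_on_bilinear[OF bounded_bilinear_inner])

lemma smooth_on_minus: "open U \<Longrightarrow> smooth_on U f \<Longrightarrow> smooth_on U (\<lambda>x. - f x)"
  by (rule smooth_on_linear_compose[OF _ bounded_linear_minus[OF bounded_linear_ident]])

lemma smooth_on_diff: "open U \<Longrightarrow> smooth_on U f \<Longrightarrow> smooth_on U g \<Longrightarrow> smooth_on U (\<lambda>x. f x - g x)"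
  using smooth_on_add[OF _ _ smooth_on_minus, of U f g] by simp

lemma smooth_on_Pair:
  assumes "open U" "smooth_on U f" "smooth_on U g"
  shows "smooth_on U (\<lambda>x. (f x, g x))"
proof -
  have "smooth_on U (\<lambda>x. (f x, 0) + (0, g x))"
    by (intro smooth_on_add assms smooth_on_linear_compose[OF assms(1) _ assms(2), of "\<lambda>u. (u, 0)"]
        smooth_on_linear_compose[OF assms(1) _ assms(3), of "\<lambda>u. (0, u)"]
        bounded_linear_Pair bounded_linear_ident bounded_linear_zero)
  then show ?thesis by simp
qed

lemma smooth_on_inverse_real: "smooth_on {x :: real. x \<noteq> 0} inverse"
proof (rule smooth_onI)
  have op: "open {x :: real. x \<noteq> 0}" by (intro open_Collect_neq continuous_intros)
  fix k show "Ck_on k {x :: real. x \<noteq> 0} inverse"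
  proof (induction k)
    case 0
    then show ?case by (auto intro!: continuous_intros)
  next
    case (Suc k)
    have "Ck_on k {x :: real. x \<noteq> 0} (\<lambda>x. - (inverse x * inverse x))"
      by (intro Ck_on_linear_compose[OF op bounded_linear_minus[OF bounded_linear_ident]] Ck_on_bilinear[OF bounded_bilinear_mult] op Suc)
    then show ?case
      by (intro Ck_on_real_SucI[OF op])
        (auto intro!: derivative_eq_intros simp: has_real_derivative_iff_has_vector_derivative[symmetric])
  qed
qed

lemma smooth_on_inverse:
  fixes f :: "'a::euclidean_space \<Rightarrow> real"
  assumes "open U" "smooth_on U f" "\<And>x. x \<in> U \<Longrightarrow> f x \<noteq> 0"
  shows "smooth_on U (\<lambda>x. inverse (f x))"
  by (rule smooth_on_compose[OF assms(1) _ assms(2) smooth_on_inverse_real])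
    (use assms in \<open>auto intro!: open_Collect_neq continuous_intros\<close>)

lemma smooth_on_divide:
  fixes f g :: "'a::euclidean_space \<Rightarrow> real"
  assumes "open U" "smooth_on U f" "smooth_on U g" "\<And>x. x \<in> U \<Longrightarrow> g x \<noteq> 0"
  shows "smooth_on U (\<lambda>x. f x / g x)"
  unfolding divide_inverse by (intro smooth_on_mult smooth_on_inverse assms)

lemma smooth_on_sqrt_real: "smooth_on {0::real<..} sqrt"
proof (rule smooth_onI)
  fix k show "Ck_on k {0::real<..} sqrt"
  proof (induction k)
    case 0
    then show ?case by (auto intro!: continuous_intros)
  next
    case (Suc k)
    have "Ck_on k {0::real<..} (\<lambda>x. inverse (sqrt x))"
      by (rule Ck_on_compose[OF _ _ Suc smooth_onD[OF smooth_on_inverse_real]])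
        (auto intro!: open_Collect_neq continuous_intros)
    then have "Ck_on k {0::real<..} (\<lambda>x. inverse (sqrt x) * (1/2))"
      by (intro Ck_on_bilinear[OF bounded_bilinear_mult] Ck_on_const) auto
    then show ?case
      by (intro Ck_on_real_SucI)
        (auto intro!: derivative_eq_intros simp: has_real_derivative_iff_has_vector_derivative[symmetric])
  qed
qed

lemma smooth_on_sqrt:
  fixes f :: "'a::euclidean_space \<Rightarrow> real"
  assumes "open U" "smooth_on U f" "\<And>x. x \<in> U \<Longrightarrow> f x > 0"
  shows "smooth_on U (\<lambda>x. sqrt (f x))"
  by (rule smooth_on_compose[OF assms(1) _ assms(2) smooth_on_sqrt_real]) (use assms in auto)

lemma smooth_on_norm:
  assumes "open U" "smooth_on U f" "\<And>x. x \<in> U \<Longrightarrow> f x \<noteq> 0"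
  shows "smooth_on U (\<lambda>x. norm (f x))"
  unfolding norm_eq_sqrt_inner by (intro smooth_on_sqrt smooth_on_inner assms) (use assms in simp)

lemma smooth_on_sgn:
  assumes "open U" "smooth_on U f" "\<And>x. x \<in> U \<Longrightarrow> f x \<noteq> 0"
  shows "smooth_on U (\<lambda>x. sgn (f x))"
  unfolding sgn_div_norm by (intro smooth_on_scaleR smooth_on_inverse smooth_on_norm assms) (use assms in auto)

lemma smooth_on_sin_cos_real: "smooth_on UNIV (sin :: real \<Rightarrow> real)" "smooth_on UNIV (cos :: real \<Rightarrow> real)"
proof -
  have "Ck_on k UNIV (sin :: real \<Rightarrow> real) \<and> Ck_on k UNIV (cos :: real \<Rightarrow> real)" for k
  proof (induction k)
    case 0
    then show ?case
      using continuous_on_sin[OF continuous_on_id, of UNIV] continuous_on_cos[OF continuous_on_id, of UNIV] by simp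
  next
    case (Suc k)
    have "Ck_on k UNIV (\<lambda>x :: real. - sin x)"
      by (rule Ck_on_linear_compose[OF open_UNIV bounded_linear_minus[OF bounded_linear_ident]]) (use Suc in auto)
    then have "Ck_on (Suc k) UNIV (cos :: real \<Rightarrow> real)"
      by (intro Ck_on_real_SucI)
        (auto intro!: derivative_eq_intros simp: has_real_derivative_iff_has_vector_derivative[symmetric])
    moreover have "Ck_on (Suc k) UNIV (sin :: real \<Rightarrow> real)"
      by (intro Ck_on_real_SucI[of _ _ cos])
        (use Suc in \<open>auto intro!: derivative_eq_intros simp: has_real_derivative_iff_has_vector_derivative[symmetric]\<close>)
    ultimately show ?case by simp
  qed
  then show "smooth_on UNIV (sin :: real \<Rightarrow> real)" "smooth_on UNIV (cos :: real \<Rightarrow> real)"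
    by (auto simp: smooth_on_def)
qed

lemma smooth_on_sin: "open U \<Longrightarrow> smooth_on U f \<Longrightarrow> smooth_on U (\<lambda>x. sin (f x :: real))"
  and smooth_on_cos: "open U \<Longrightarrow> smooth_on U f \<Longrightarrow> smooth_on U (\<lambda>x. cos (f x :: real))"
  by (auto intro: smooth_on_compose[OF _ open_UNIV] smooth_on_sin_cos_real)

lemma smooth_on_arctan_real: "smooth_on UNIV arctan"
proof (rule smooth_onI)
  fix k show "Ck_on k UNIV arctan"
  proof (cases k)
    case 0
    then show ?thesis using continuous_on_arctan[OF continuous_on_id, of UNIV] by simp
  next
    case (Suc m)
    have pos: "1 + x * x \<noteq> 0" for x :: real
      using zero_le_square[of x] by linarith
    have "smooth_on UNIV (\<lambda>x :: real. inverse (1 + x * x))"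
      by (intro smooth_on_inverse smooth_on_add smooth_on_const smooth_on_mult smooth_on_id open_UNIV pos)
    then have "Ck_on m UNIV (\<lambda>x :: real. inverse (1 + x * x))" by (rule smooth_onD)
    then show ?thesis unfolding Suc
      by (intro Ck_on_real_SucI)
        (auto intro!: derivative_eq_intros simp: has_real_derivative_iff_has_vector_derivative[symmetric] power2_eq_square)
  qed
qed

lemma smooth_on_arctan: "open U \<Longrightarrow> smooth_on U f \<Longrightarrow> smooth_on U (\<lambda>x. arctan (f x))"
  by (rule smooth_on_compose[OF _ open_UNIV _ smooth_on_arctan_real]) auto

lemma smooth_on_continuous: "smooth_on U f \<Longrightarrow> continuous_on U f"
  using smooth_onD[of U f 0] by simp

lemma smooth_on_has_derivative:
  "smooth_on U f \<Longrightarrow> x \<in> U \<Longrightarrow> (f has_derivative frechet_derivative f (at x)) (at x)"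
  using Ck_on_SucD(1)[OF smooth_onD[of U f "Suc 0"]] .

lemma smooth_map_on_continuous:
  assumes "smooth_map_on S f"
  shows "continuous_on S f"
proof (rule continuous_on_eq_continuous_within[THEN iffD2], rule ballI)
  fix p assume "p \<in> S"
  then obtain U g where U: "open U" "p \<in> U" "smooth_on U g" "\<forall>x\<in>U \<inter> S. g x = f x"
    using assms unfolding smooth_map_on_def by blast
  have "continuous (at p) g" using smooth_on_continuous[OF U(3)] U(1,2) by (simp add: continuous_on_eq_continuous_at)
  then have "continuous (at p within S) g" by (rule continuous_at_imp_continuous_at_within)
  then have g: "(g \<longlongrightarrow> f p) (at p within S)" using U \<open>p \<in> S\<close> by (simp add: continuous_within)
  show "continuous (at p within S) f"
    unfolding continuous_within
  proof (rule Lim_transform_eventually[rotated])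
    show "\<forall>\<^sub>F x in at p within S. g x = f x"
      unfolding eventually_at_topological using U by blast
    show "(g \<longlongrightarrow> f p) (at p within S)" by (rule g)
  qed
qed

lemma smooth_map_onI:
  assumes "\<And>p. p \<in> S \<Longrightarrow> \<exists>U g. open U \<and> p \<in> U \<and> smooth_on U g \<and> (\<forall>x\<in>U \<inter> S. g x = f x)"
  shows "smooth_map_on S f"
  using assms unfolding smooth_map_on_def by blast

lemma smooth_on_imp_map: "open U \<Longrightarrow> smooth_on U f \<Longrightarrow> S \<subseteq> U \<Longrightarrow> smooth_map_on S f"
  unfolding smooth_map_on_def by blast

text \<open>The inverse function theorem on the line. Smoothness of the inverse is bootstrapped from
  its derivative \<open>inverse (f' (g u))\<close>, one order at a time.\<close>

lemma local_inverse_pos: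
  fixes f f' :: "real \<Rightarrow> real"
  assumes d: "\<And>t. (f has_real_derivative f' t) (at t)" and f': "smooth_on UNIV f'" and pos: "f' t0 > 0"
  obtains a b I g where "a < t0" "t0 < b" "open I" "f t0 \<in> I" "smooth_on I g"
    "\<And>u. u \<in> I \<Longrightarrow> a < g u \<and> g u < b \<and> f (g u) = u" "\<And>t. a < t \<Longrightarrow> t < b \<Longrightarrow> f t \<in> I \<and> g (f t) = t"
proof -
  have "continuous_on UNIV f'" by (rule smooth_on_continuous[OF f'])
  then have "open {t. 0 < f' t}" by (intro open_Collect_less continuous_intros)
  then obtain e where e: "e > 0" "cball t0 e \<subseteq> {t. 0 < f' t}"
    using open_contains_cball[of "{t. 0 < f' t}"] pos by auto
  define a b where "a = t0 - e" and "b = t0 + e"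
  have ab: "a < t0" "t0 < b" and fp: "f' t > 0" if "a \<le> t" "t \<le> b" for t
    using e that by (auto simp: a_def b_def subset_iff dist_real_def abs_le_iff)
  have mono: "f s < f t" if "a \<le> s" "s < t" "t \<le> b" for s t
    by (rule DERIV_pos_strict_mono[OF that(2) d]) (use that fp in auto)
  have ab': "a < t0" "t0 < b" using e by (auto simp: a_def b_def)
  have cont: "continuous_on A f" for A
    by (intro continuous_at_imp_continuous_on ballI DERIV_isCont[OF d])
  have inj: "inj_on f {a..b}"
    by (rule linorder_inj_onI) (use mono in \<open>force+\<close>)
  define g where "g = inv_into {a..b} f"
  have gf: "g (f t) = t" if "a \<le> t" "t \<le> b" for t
    unfolding g_def using inj that by (intro inv_into_f_f) auto
  define I where "I = {f a<..<f b}"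
  have g: "a < g u \<and> g u < b \<and> f (g u) = u" if u: "u \<in> I" for u
  proof -
    obtain t where t: "a \<le> t" "t \<le> b" "f t = u"
      using IVT'[of f a u b] cont[of "{a..b}"] u ab' by (auto simp: I_def)
    moreover have "t \<noteq> a" "t \<noteq> b" using t u by (auto simp: I_def)
    ultimately show ?thesis using gf[of t] by auto
  qed
  have fI: "f t \<in> I" if "a < t" "t < b" for t using mono[of a t] mono[of t b] that by (auto simp: I_def)
  have "continuous_on (f ` {a..b}) g" by (rule continuous_on_inv[OF cont compact_Icc]) (use gf in auto)
  moreover have "I \<subseteq> f ` {a..b}" 
  proof
    fix u assume "u \<in> I"
    from g[OF this] show "u \<in> f ` {a..b}" by (intro image_eqI[of _ _ "g u"]) auto
  qed
  ultimately have cg: "continuous_on I g" by (rule continuous_on_subset)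
  have opI: "open I" by (simp add: I_def)
  have dg: "(g has_real_derivative inverse (f' (g u))) (at u)" if u: "u \<in> I" for u
  proof (rule DERIV_inverse_function[where a = "f a" and b = "f b"])
    show "(f has_real_derivative f' (g u)) (at (g u))" by (rule d)
    show "f' (g u) \<noteq> 0" using fp[of "g u"] g[OF u] by auto
    show "isCont g u" using cg u opI by (simp add: continuous_on_eq_continuous_at)
  qed (use u g in \<open>auto simp: I_def\<close>)
  have "smooth_on I g"
  proof (rule smooth_onI)
    fix k show "Ck_on k I g"
    proof (induction k)
      case (Suc k)
      have "Ck_on k I (\<lambda>u. f' (g u))"
        by (rule Ck_on_compose[OF opI open_UNIV Suc smooth_onD[OF f']]) auto
      then have "Ck_on k I (\<lambda>u. inverse (f' (g u)))"
      proof (rule Ck_on_compose[OF opI _ _ smooth_onD[OF smooth_on_inverse_real], rotated])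
        show "open {x :: real. x \<noteq> 0}" by (intro open_Collect_neq continuous_intros)
        have "f' (g u) \<noteq> 0" if "u \<in> I" for u using fp[of "g u"] g[OF that] by auto
        then show "(\<lambda>u. f' (g u)) ` I \<subseteq> {x. x \<noteq> 0}" by auto
      qed
      then show ?case
        by (intro Ck_on_real_SucI[OF opI]) (use dg in \<open>auto simp: has_real_derivative_iff_has_vector_derivative\<close>)
    qed (use cg in simp)
  qed
  then show ?thesis using that[of a b I g] ab' opI fI g gf by auto
qed

lemma local_inverse:
  fixes f f' :: "real \<Rightarrow> real"
  assumes d: "\<And>t. (f has_real_derivative f' t) (at t)" and f': "smooth_on UNIV f'" and nz: "f' t0 \<noteq> 0"
  obtains a b I g where "a < t0" "t0 < b" "open I" "f t0 \<in> I" "smooth_on I g"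
    "\<And>u. u \<in> I \<Longrightarrow> a < g u \<and> g u < b \<and> f (g u) = u" "\<And>t. a < t \<Longrightarrow> t < b \<Longrightarrow> f t \<in> I \<and> g (f t) = t"
proof (cases "f' t0 > 0")
  case True
  obtain a b I g where *: "a < t0" "t0 < b" "open I" "f t0 \<in> I" "smooth_on I g"
    "\<And>u. u \<in> I \<Longrightarrow> a < g u \<and> g u < b \<and> f (g u) = u" "\<And>t. a < t \<Longrightarrow> t < b \<Longrightarrow> f t \<in> I \<and> g (f t) = t"
    using local_inverse_pos[OF d f' True] by blast
  show ?thesis by (rule that[OF *])
next
  case False
  have d': "((\<lambda>t. - f t) has_real_derivative - f' t) (at t)" for t by (intro DERIV_minus d)
  have pos: "- f' t0 > 0" using False nz by simp
  obtain a b I g where *: "a < t0" "t0 < b" "open I" "- f t0 \<in> I" "smooth_on I g"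
    "\<And>u. u \<in> I \<Longrightarrow> a < g u \<and> g u < b \<and> - f (g u) = u" "\<And>t. a < t \<Longrightarrow> t < b \<Longrightarrow> - f t \<in> I \<and> g (- f t) = t"
    using local_inverse_pos[OF d' smooth_on_minus[OF open_UNIV f'] pos] by blast
  have op: "open (uminus ` I)" by (rule open_negations[OF *(3)])
  have "smooth_on (uminus ` I) (\<lambda>u. g (- u))"
    by (rule smooth_on_compose[OF op *(3) smooth_on_minus[OF op smooth_on_id[OF op]] *(5)]) auto
  then show ?thesis
    using that[of a b "uminus ` I" "\<lambda>u. g (- u)"] * op by (force simp: image_iff)
qed

section \<open>Charts and principal curvatures\<close>

text \<open>The numbers \<open>k j\<close> may coincide, in which case the principal space is the sum of several \<open>V j\<close>.\<close>

lemma mean_curvature_orthogonal_sum: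
  fixes S :: "'a::euclidean_space set" and V :: "'i \<Rightarrow> 'a set"
  assumes fin: "finite J" and sub: "\<And>j. j \<in> J \<Longrightarrow> subspace (V j)"
    and orth: "\<And>i j v w. i \<in> J \<Longrightarrow> j \<in> J \<Longrightarrow> i \<noteq> j \<Longrightarrow> v \<in> V i \<Longrightarrow> w \<in> V j \<Longrightarrow> v \<bullet> w = 0"
    and tan: "tangent_space S P = {\<Sum>j\<in>J. w j |w. \<forall>j\<in>J. w j \<in> V j}"
    and D: "\<And>w. \<forall>j\<in>J. w j \<in> V j \<Longrightarrow>
      frechet_derivative \<nu> (at P within S) (\<Sum>j\<in>J. w j) = (\<Sum>j\<in>J. k j *\<^sub>R w j)"
  shows "mean_curvature S \<nu> P = (\<Sum>j\<in>J. k j * real (dim (V j)))"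
proof -
  let ?E = "principal_space S \<nu> P"
  have dimE: "dim (?E \<kappa>) = (\<Sum>j\<in>{j\<in>J. k j = \<kappa>}. dim (V j))" for \<kappa>
  proof -
    let ?I = "{j\<in>J. k j = \<kappa>}"
    have "\<forall>j\<in>J. \<exists>B. 0 \<notin> B \<and> B \<subseteq> V j \<and> pairwise orthogonal B \<and> card B = dim (V j) \<and> span B = V j"
    proof
      fix j assume "j \<in> J"
      from orthogonal_basis_subspace[OF sub[OF this]]
      show "\<exists>B. 0 \<notin> B \<and> B \<subseteq> V j \<and> pairwise orthogonal B \<and> card B = dim (V j) \<and> span B = V j" by metis
    qed
    then obtain B where B: "\<And>j. j \<in> J \<Longrightarrow> 0 \<notin> B j" "\<And>j. j \<in> J \<Longrightarrow> B j \<subseteq> V j"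
      "\<And>j. j \<in> J \<Longrightarrow> pairwise orthogonal (B j)" "\<And>j. j \<in> J \<Longrightarrow> card (B j) = dim (V j)"
      "\<And>j. j \<in> J \<Longrightarrow> span (B j) = V j"
      by metis
    have ne: "i \<noteq> j \<Longrightarrow> v \<in> B i \<Longrightarrow> w \<in> B j \<Longrightarrow> v \<noteq> w \<and> v \<bullet> w = 0" if "i \<in> J" "j \<in> J" for i j v w
    proof
      assume a: "i \<noteq> j" "v \<in> B i" "w \<in> B j"
      show "v \<bullet> w = 0" using orth[OF that a(1)] a B(2)[OF that(1)] B(2)[OF that(2)] by blast
      then show "v \<noteq> w" using a(2) B(1)[OF that(1)] by auto
    qed
    have "finite (B j)" if "j \<in> J" for j
      using pairwise_orthogonal_independent[OF B(3)[OF that] B(1)[OF that]] by (rule independent_imp_finite)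
    moreover have "B i \<inter> B j = {}" if "i \<in> J" "j \<in> J" "i \<noteq> j" for i j using ne that by blast
    ultimately have "card (\<Union>j\<in>?I. B j) = (\<Sum>j\<in>?I. card (B j))"
      using fin by (intro card_UN_disjoint) auto
    then have card: "card (\<Union>j\<in>?I. B j) = (\<Sum>j\<in>?I. dim (V j))" using B(4) by simp
    have "pairwise orthogonal (\<Union>j\<in>?I. B j)"
    proof (rule pairwiseI)
      fix v w assume "v \<in> (\<Union>j\<in>?I. B j)" "w \<in> (\<Union>j\<in>?I. B j)" and vw: "v \<noteq> w"
      then obtain i j where ij: "i \<in> J" "j \<in> J" "v \<in> B i" "w \<in> B j" by blast
      show "orthogonal v w"
      proof (cases "i = j")
        case True
        then show ?thesis using B(3)[OF ij(1)] ij vw by (auto simp: pairwise_def)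
      next
        case False
        then show ?thesis using ne[OF ij(1,2) False ij(3,4)] by (simp add: orthogonal_def)
      qed
    qed
    then have ind: "independent (\<Union>j\<in>?I. B j)" using B(1) by (intro pairwise_orthogonal_independent) auto
    have sub1: "(\<Union>j\<in>?I. B j) \<subseteq> ?E \<kappa>"
    proof
      fix b assume "b \<in> (\<Union>j\<in>?I. B j)"
      then obtain j where j: "j \<in> J" "k j = \<kappa>" "b \<in> B j" by blast
      define w where "w i = (if i = j then b else 0)" for i
      have w: "\<forall>i\<in>J. w i \<in> V i" using B(2) j sub subspace_0 by (auto simp: w_def)
      have s: "(\<Sum>i\<in>J. w i) = b" "(\<Sum>i\<in>J. k i *\<^sub>R w i) = k j *\<^sub>R b"
        using fin j(1) by (simp_all add: w_def if_distrib sum.delta cong: if_cong)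
      then have "b \<in> tangent_space S P" unfolding tan using w by blast
      then show "b \<in> ?E \<kappa>" using D[OF w] s j(2) by (simp add: principal_space_def)
    qed
    have sub2: "?E \<kappa> \<subseteq> span (\<Union>j\<in>?I. B j)"
    proof
      fix z assume z: "z \<in> ?E \<kappa>"
      then obtain w where w: "\<forall>j\<in>J. w j \<in> V j" "z = (\<Sum>j\<in>J. w j)"
        unfolding principal_space_def tan by blast
      have "(\<Sum>j\<in>J. k j *\<^sub>R w j) = \<kappa> *\<^sub>R (\<Sum>j\<in>J. w j)"
        using D[OF w(1)] z w(2) by (simp add: principal_space_def)
      then have eq: "(\<Sum>j\<in>J. (k j - \<kappa>) *\<^sub>R w j) = 0"
        by (simp add: scaleR_left_diff_distrib sum_subtractf scaleR_sum_right)
      \<comment> \<open>The components are orthogonal, so the inner product of \<open>eq\<close>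
        with \<open>w j\<close> isolates its \<open>j\<close>-th term.\<close>
      have nz: "w j = 0" if j: "j \<in> J" "k j \<noteq> \<kappa>" for j
      proof -
        have "(\<Sum>i\<in>J. (k i - \<kappa>) *\<^sub>R w i) \<bullet> w j = (\<Sum>i\<in>J. if i = j then (k j - \<kappa>) * (w j \<bullet> w j) else 0)"
          unfolding inner_sum_left using w(1) orth j(1) by (intro sum.cong) auto
        then show ?thesis using eq j fin by simp
      qed
      have "z = (\<Sum>j\<in>?I. w j)"
        unfolding w(2) by (rule sum.mono_neutral_right) (use fin nz in auto)
      moreover have "w j \<in> span (\<Union>j\<in>?I. B j)" if "j \<in> ?I" for j
        using w(1) B(5)[of j] that span_mono[of "B j" "\<Union>j\<in>?I. B j"] by blast
      ultimately show "z \<in> span (\<Union>j\<in>?I. B j)" by (simp only: span_sum)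
    qed
    show ?thesis unfolding card[symmetric] by (rule basis_card_eq_dim[OF sub1 sub2 ind, symmetric])
  qed
  have pc: "principal_curvatures S \<nu> P \<subseteq> k ` J"
  proof
    fix \<kappa> assume "\<kappa> \<in> principal_curvatures S \<nu> P"
    then obtain v where v: "v \<in> ?E \<kappa>" "v \<noteq> 0" by (auto simp: principal_curvatures_def)
    then have "\<not> ?E \<kappa> \<subseteq> {0}" by blast
    then have "dim (?E \<kappa>) \<noteq> 0" by (simp add: dim_eq_0)
    then have "{j\<in>J. k j = \<kappa>} \<noteq> {}" unfolding dimE by (intro notI) simp
    then show "\<kappa> \<in> k ` J" by blast
  qed
  have "dim (?E \<kappa>) = 0" if "\<kappa> \<notin> principal_curvatures S \<nu> P" for \<kappa>
    using that by (auto simp: principal_curvatures_def)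
  then have "mean_curvature S \<nu> P = (\<Sum>\<kappa>\<in>k ` J. real (dim (?E \<kappa>)) * \<kappa>)"
    unfolding mean_curvature_def using fin pc by (intro sum.mono_neutral_left) auto
  also have "\<dots> = (\<Sum>\<kappa>\<in>k ` J. \<Sum>j\<in>{j\<in>J. k j = \<kappa>}. k j * real (dim (V j)))"
    unfolding dimE of_nat_sum sum_distrib_right by (intro sum.cong) auto
  also have "\<dots> = (\<Sum>j\<in>J. k j * real (dim (V j)))" by (rule sum.image_gen[OF fin, symmetric])
  finally show ?thesis .
qed

text \<open>The chart shears along \<open>b\<close>; it is invertible because \<open>\<Theta>\<close> is constant in that direction.\<close>

lemma slice_chart:
  fixes b :: "'a::euclidean_space"
  assumes b: "b \<in> Basis" and Q: "open Q" "\<And>z r. z \<in> Q \<Longrightarrow> z + r *\<^sub>R b \<in> Q"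
    and \<Theta>: "smooth_on Q \<Theta>" "\<And>z r. z \<in> Q \<Longrightarrow> \<Theta> (z + r *\<^sub>R b) = \<Theta> z"
    and U: "open U" "U \<subseteq> Q" and S: "\<And>z. z \<in> U \<Longrightarrow> z \<in> S \<longleftrightarrow> z \<bullet> b = \<Theta> z"
  shows "\<exists>V \<phi> \<psi>. open V \<and> diffeomorphism U V \<phi> \<psi> \<and> \<phi> ` (U \<inter> S) = {y \<in> V. y \<bullet> b = 0}"
proof -
  define \<phi> \<psi> where "\<phi> z = z - \<Theta> z *\<^sub>R b" and "\<psi> z = z + \<Theta> z *\<^sub>R b" for z
  have sm: "smooth_on Q \<phi>" "smooth_on Q \<psi>"
    unfolding \<phi>_def[abs_def] \<psi>_def[abs_def]
    by (intro smooth_on_add smooth_on_diff smooth_on_scaleR smooth_on_const smooth_on_id Q \<Theta>)+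
  define V where "V = Q \<inter> \<psi> -` U"
  have V: "open V" unfolding V_def
    by (rule continuous_open_preimage[OF smooth_on_continuous[OF sm(2)] Q(1) U(1)])
  have \<Theta>\<phi>: "\<phi> z \<in> Q" "\<Theta> (\<phi> z) = \<Theta> z" "\<psi> z \<in> Q" "\<Theta> (\<psi> z) = \<Theta> z" if "z \<in> Q" for z
    using Q(2)[OF that, of "- \<Theta> z"] \<Theta>(2)[OF that, of "- \<Theta> z"] Q(2)[OF that, of "\<Theta> z"] \<Theta>(2)[OF that, of "\<Theta> z"]
    by (auto simp: \<phi>_def \<psi>_def)
  have inv: "\<psi> (\<phi> z) = z" "\<phi> (\<psi> z) = z" if "z \<in> Q" for z
    using \<Theta>\<phi>[OF that] by (simp_all add: \<phi>_def[of "\<psi> z"] \<psi>_def[of "\<phi> z"]) (simp_all add: \<phi>_def \<psi>_def)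
  have UV: "\<phi> z \<in> V" if "z \<in> U" for z using that U(2) \<Theta>\<phi>[of z] inv[of z] by (auto simp: V_def)
  have bb: "b \<bullet> b = 1" using b by (simp add: inner_Basis)
  have hom: "homeomorphism U V \<phi> \<psi>"
  proof (rule homeomorphismI)
    show "continuous_on U \<phi>" "continuous_on V \<psi>"
      using smooth_on_continuous[OF sm(1)] smooth_on_continuous[OF sm(2)] U(2)
      by (auto simp: V_def intro: continuous_on_subset)
  qed (use UV inv U(2) in \<open>auto simp: V_def\<close>)
  have "diffeomorphism U V \<phi> \<psi>"
    unfolding diffeomorphism_def using hom sm Q(1) U(2) by (auto simp: V_def intro: smooth_on_imp_map)
  moreover have "\<phi> ` (U \<inter> S) = {y \<in> V. y \<bullet> b = 0}"
  proof (intro equalityI subsetI)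
    fix v assume "v \<in> \<phi> ` (U \<inter> S)"
    then obtain z where z: "z \<in> U" "z \<in> S" "v = \<phi> z" by blast
    then have "v \<bullet> b = 0" using S[OF z(1)] by (simp add: \<phi>_def inner_diff_left bb)
    then show "v \<in> {y \<in> V. y \<bullet> b = 0}" using UV z by simp
  next
    fix v assume v: "v \<in> {y \<in> V. y \<bullet> b = 0}"
    then have q: "v \<in> Q" "\<psi> v \<in> U" by (auto simp: V_def)
    have "\<psi> v \<bullet> b = \<Theta> (\<psi> v)" unfolding \<Theta>\<phi>(4)[OF q(1)] using v by (simp add: \<psi>_def inner_add_left bb)
    then have "\<psi> v \<in> S" using S[OF q(2)] by simp
    then show "v \<in> \<phi> ` (U \<inter> S)" using inv(2)[OF q(1)] q(2) by (intro image_eqI[of _ _ "\<psi> v"]) auto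
  qed
  ultimately show ?thesis using V by blast
qed

text \<open>The equation \<open>|B z| = G |A z|\<close> is solved for the single coordinate \<open>z \<bullet> b\<close> of \<open>B z\<close>.\<close>

lemma sphere_bundle_chart:
  fixes A :: "'a::euclidean_space \<Rightarrow> 'b::euclidean_space" and B :: "'a \<Rightarrow> 'c::euclidean_space"
  assumes lin: "bounded_linear A" "bounded_linear B" and b: "b \<in> Basis" "A b = 0" "\<And>z. B z \<bullet> B b = z \<bullet> b"
    and I: "open I" "smooth_on I G" "\<And>a. a \<in> I \<Longrightarrow> 0 < G a"
    and U: "open U" "P \<in> U" "\<And>z. z \<in> U \<Longrightarrow> A z \<noteq> 0 \<and> norm (A z) \<in> I"
    and S: "\<And>z. z \<in> U \<Longrightarrow> z \<in> S \<longleftrightarrow> norm (B z) = G (norm (A z))"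
    and P: "P \<in> S" "P \<bullet> b \<noteq> 0"
  shows "\<exists>U V \<phi> \<psi>. open U \<and> open V \<and> P \<in> U \<and> diffeomorphism U V \<phi> \<psi> \<and> \<phi> ` (U \<inter> S) = {y \<in> V. y \<bullet> b = 0}"
proof -
  \<comment> \<open>The sign of the coordinate at \<open>P\<close> selects the branch of the square
    root.\<close>
  define \<epsilon> where "\<epsilon> = sgn (P \<bullet> b)"
  have \<epsilon>: "\<epsilon> * \<epsilon> = 1" using P(2) by (simp add: \<epsilon>_def sgn_mult_self_eq)
  \<comment> \<open>The value that \<open>(z \<bullet> b)^2\<close> takes on \<open>S\<close>. It is
    itself constant in the direction \<open>b\<close>, since the subtracted bracket collects the
    other coordinates of \<open>B z\<close>.\<close>
  define \<Psi> where "\<Psi> z = (G (norm (A z)))\<^sup>2 - (B z \<bullet> B z - (z \<bullet> b)\<^sup>2)" for z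
  define Q0 where "Q0 = {z. A z \<noteq> 0} \<inter> (\<lambda>z. norm (A z)) -` I"
  define Q where "Q = Q0 \<inter> \<Psi> -` {0<..}"
  have cA: "continuous_on UNIV A" "continuous_on UNIV B" using lin by (auto intro: linear_continuous_on)
  have "open ((\<lambda>z. norm (A z)) -` I)"
    by (intro open_vimage I continuous_on_norm cA)
  then have Q0: "open Q0" unfolding Q0_def by (intro open_Int open_Collect_neq cA continuous_on_const)
  have smA: "smooth_on Q0 A" "smooth_on Q0 B" by (intro smooth_on_linear Q0 lin)+
  have "smooth_on Q0 (\<lambda>z. G (norm (A z)))"
    by (rule smooth_on_compose[OF Q0 I(1) smooth_on_norm[OF Q0 smA(1)] I(2)]) (auto simp: Q0_def)
  then have sm\<Psi>: "smooth_on Q0 \<Psi>"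
    unfolding \<Psi>_def[abs_def] power2_eq_square
    by (intro smooth_on_diff smooth_on_mult smooth_on_inner smooth_on_id smooth_on_const smA Q0)
  have Q: "open Q" unfolding Q_def
    by (rule continuous_open_preimage[OF smooth_on_continuous[OF sm\<Psi>] Q0]) simp
  have bb: "b \<bullet> b = 1" "B b \<bullet> B b = 1" using b by (simp_all add: inner_Basis)
  have tr: "A (z + r *\<^sub>R b) = A z" for z r
    using b(2) lin(1) by (simp add: linear_simps)
  have "B (z + r *\<^sub>R b) \<bullet> B (z + r *\<^sub>R b) - ((z + r *\<^sub>R b) \<bullet> b)\<^sup>2 = B z \<bullet> B z - (z \<bullet> b)\<^sup>2" for z r
    using b(3)[of z] bb lin(2)
    by (simp add: linear_simps inner_add_left inner_add_right inner_commute[of "B b" "B z"] power2_eq_square algebra_simps)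
  then have tr\<Psi>: "\<Psi> (z + r *\<^sub>R b) = \<Psi> z" for z r by (simp add: \<Psi>_def tr)
  define \<Theta> where "\<Theta> z = \<epsilon> * sqrt (\<Psi> z)" for z
  have sm\<Theta>: "smooth_on Q \<Theta>" unfolding \<Theta>_def[abs_def]
    by (intro smooth_on_mult smooth_on_const smooth_on_sqrt Q smooth_on_subset[OF sm\<Psi>]) (auto simp: Q_def)
  define U' where "U' = U \<inter> Q \<inter> {z. 0 < \<epsilon> * (z \<bullet> b)}"
  have U': "open U'" unfolding U'_def
    by (intro open_Int U Q open_Collect_less continuous_intros)
  have key: "z \<in> S \<longleftrightarrow> (z \<bullet> b)\<^sup>2 = \<Psi> z" if "z \<in> U" for z
  proof -
    have "0 < G (norm (A z))" using I(3) U(3)[OF that] by blast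
    then have "norm (B z) = G (norm (A z)) \<longleftrightarrow> (norm (B z))\<^sup>2 = (G (norm (A z)))\<^sup>2"
      by (simp add: power2_eq_iff_nonneg)
    then show ?thesis unfolding S[OF that] by (auto simp: \<Psi>_def power2_norm_eq_inner)
  qed
  have "(P \<bullet> b)\<^sup>2 = \<Psi> P" using key[OF U(2)] P(1) by simp
  then have "\<Psi> P > 0" using P(2) by (metis zero_less_power2)
  moreover have "0 < \<epsilon> * (P \<bullet> b)" using P(2) by (simp add: \<epsilon>_def abs_sgn[symmetric] mult.commute)
  ultimately have "P \<in> U'" using U(2) U(3)[OF U(2)] by (auto simp: U'_def Q_def Q0_def)
  moreover have "\<exists>V \<phi> \<psi>. open V \<and> diffeomorphism U' V \<phi> \<psi> \<and> \<phi> ` (U' \<inter> S) = {y \<in> V. y \<bullet> b = 0}"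
  proof (rule slice_chart[OF b(1) Q _ sm\<Theta> _ U'])
    show "z + r *\<^sub>R b \<in> Q" if "z \<in> Q" for z r using that by (simp add: Q_def Q0_def tr tr\<Psi>)
    show "\<Theta> (z + r *\<^sub>R b) = \<Theta> z" if "z \<in> Q" for z r by (simp add: \<Theta>_def tr\<Psi>)
    show "U' \<subseteq> Q" by (auto simp: U'_def)
    fix z assume z: "z \<in> U'"
    then have zU: "z \<in> U" "0 < \<Psi> z" "0 < \<epsilon> * (z \<bullet> b)" by (auto simp: U'_def Q_def)
    have "(z \<bullet> b)\<^sup>2 = (\<epsilon> * (z \<bullet> b))\<^sup>2" using \<epsilon> by (simp add: power_mult_distrib power2_eq_square)
    then have "(z \<bullet> b)\<^sup>2 = \<Psi> z \<longleftrightarrow> \<epsilon> * (z \<bullet> b) = sqrt (\<Psi> z)"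
      using zU by (metis less_eq_real_def real_sqrt_pow2 real_sqrt_unique)
    also have "\<dots> \<longleftrightarrow> z \<bullet> b = \<Theta> z"
      unfolding \<Theta>_def using \<epsilon> by (metis mult.assoc mult_1)
    finally show "z \<in> S \<longleftrightarrow> z \<bullet> b = \<Theta> z" using key[OF zU(1)] by simp
  qed
  ultimately show ?thesis using U' by blast
qed

text \<open>A local smooth extension shows that a derivative within \<open>S\<close> exists, so the
  one chosen by \<open>frechet_derivative\<close> is indeed a derivative.\<close>

lemma smooth_map_has_derivative:
  assumes "smooth_map_on S f" "p \<in> S"
  shows "(f has_derivative frechet_derivative f (at p within S)) (at p within S)"
proof -
  obtain U g where U: "open U" "p \<in> U" "smooth_on U g" "\<forall>x\<in>U \<inter> S. g x = f x"
    using assms unfolding smooth_map_on_def by blast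
  obtain e where e: "e > 0" "ball p e \<subseteq> U" using U by (meson openE)
  have "(g has_derivative frechet_derivative g (at p)) (at p within S)"
    by (rule has_derivative_at_withinI[OF smooth_on_has_derivative[OF U(3,2)]])
  then have "(f has_derivative frechet_derivative g (at p)) (at p within S)"
    by (rule has_derivative_transform_within[OF _ e(1) assms(2)]) (use e U in \<open>auto simp: dist_commute subset_iff\<close>)
  then show ?thesis using frechet_derivative_works differentiable_def by blast
qed

text \<open>Whatever linear map was chosen, its value on the velocity of a curve in \<open>S\<close>
  is forced by the chain rule. This is how the shape operator is computed.\<close>

lemma derivative_along_curve:
  fixes \<gamma> :: "real \<Rightarrow> 'a::euclidean_space" and f :: "'a \<Rightarrow> 'b::euclidean_space"
  assumes "smooth_map_on S f" "\<And>\<tau>. \<gamma> \<tau> \<in> S" "(\<gamma> has_vector_derivative v) (at 0)"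
  shows "((\<lambda>\<tau>. f (\<gamma> \<tau>)) has_vector_derivative frechet_derivative f (at (\<gamma> 0) within S) v) (at 0)"
proof -
  let ?D = "frechet_derivative f (at (\<gamma> 0) within S)"
  have D: "(f has_derivative ?D) (at (\<gamma> 0) within S)" by (rule smooth_map_has_derivative[OF assms(1,2)])
  have "(f has_derivative ?D) (at (\<gamma> 0) within range \<gamma>)"
    by (rule has_derivative_subset[OF D]) (use assms(2) in auto)
  then have "((\<lambda>\<tau>. f (\<gamma> \<tau>)) has_derivative (\<lambda>r. ?D (r *\<^sub>R v))) (at 0)"
    using has_derivative_in_compose[of \<gamma> "\<lambda>r. r *\<^sub>R v" 0 UNIV f ?D] assms(3)
    by (simp add: has_vector_derivative_def)
  moreover have "?D (r *\<^sub>R v) = r *\<^sub>R ?D v" for r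
    using has_derivative_linear[OF D] by (rule linear_cmul)
  ultimately show ?thesis by (simp add: has_vector_derivative_def)
qed

section \<open>The hypersurface swept out by a closed profile\<close>

text \<open>An embedded closed curve is locally a graph over a coordinate with nonzero derivative:
  the rest of a period is compact and misses the point by \<open>inj\<close>, so its image can be
  cut out of the neighbourhood \<open>W\<close>.\<close>

lemma local_graph:
  fixes f g f' :: "real \<Rightarrow> real"
  assumes d: "\<And>t. (f has_real_derivative f' t) (at t)" and f': "smooth_on UNIV f'" and nz: "f' t0 \<noteq> 0"
    and g: "continuous_on UNIV g" and T: "T > 0"
    and per: "\<And>t. f (t + 2 * T) = f t" "\<And>t. g (t + 2 * T) = g t"
    and inj: "\<And>s t. f s = f t \<Longrightarrow> g s = g t \<Longrightarrow> \<exists>k::int. s = t + of_int k * (2 * T)"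
  shows "\<exists>I W \<tau>. open I \<and> open W \<and> (f t0, g t0) \<in> W \<and> smooth_on I \<tau>
    \<and> (\<forall>a b. (a, b) \<in> W \<longrightarrow> a \<in> I \<and> ((\<exists>t. f t = a \<and> g t = b) \<longleftrightarrow> b = g (\<tau> a)))
    \<and> (\<forall>t. (f t, g t) \<in> W \<longrightarrow> (\<exists>k::int. t = \<tau> (f t) + of_int k * (2 * T)))"
proof -
  obtain a b I \<tau> where *: "a < t0" "t0 < b" "open I" "f t0 \<in> I" "smooth_on I \<tau>"
    "\<And>u. u \<in> I \<Longrightarrow> a < \<tau> u \<and> \<tau> u < b \<and> f (\<tau> u) = u" "\<And>t. a < t \<Longrightarrow> t < b \<Longrightarrow> f t \<in> I \<and> \<tau> (f t) = t"
    using local_inverse[OF d f' nz] by blast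
  have perk: "f (t + of_int k * (2 * T)) = f t" "g (t + of_int k * (2 * T)) = g t" for t k
    using periodic_int[of f "2 * T"] periodic_int[of g "2 * T"] per by auto
  define C where "C = {t0 - T..t0 + T} - {a<..<b}"
  define W where "W = (I \<times> UNIV) - (\<lambda>t. (f t, g t)) ` C"
  have "continuous_on UNIV f" by (intro continuous_at_imp_continuous_on ballI DERIV_isCont[OF d])
  then have "continuous_on C (\<lambda>t. (f t, g t))"
    using g by (intro continuous_on_Pair) (auto intro: continuous_on_subset)
  moreover have "compact C" unfolding C_def by (intro compact_diff) auto
  ultimately have "closed ((\<lambda>t. (f t, g t)) ` C)" by (intro compact_imp_closed compact_continuous_image)
  then have W: "open W" unfolding W_def by (intro open_Diff open_Times *) auto
  have "(f t0, g t0) \<noteq> (f t, g t)" if t: "t \<in> C" for t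
  proof
    assume "(f t0, g t0) = (f t, g t)"
    then obtain k :: int where k: "t = t0 + of_int k * (2 * T)" using inj[of t t0] by auto
    have "k = 0"
    proof (rule ccontr)
      assume "k \<noteq> 0"
      then have "1 \<le> \<bar>real_of_int k\<bar>" by linarith
      then have "2 * T \<le> \<bar>real_of_int k\<bar> * (2 * T)" using T mult_right_mono[of 1 "\<bar>real_of_int k\<bar>" "2 * T"] by simp
      also have "\<dots> = \<bar>t - t0\<bar>" using T by (simp add: k abs_mult)
      also have "\<dots> \<le> T" using t by (auto simp: C_def)
      finally show False using T by simp
    qed
    then show False using t k *(1,2) by (auto simp: C_def)
  qed
  then have mem: "(f t0, g t0) \<in> W" using *(4) by (auto simp: W_def)
  have red: "\<exists>k::int. a < t + of_int k * (2 * T) \<and> t + of_int k * (2 * T) < b" if "(f t, g t) \<in> W" for t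
  proof -
    obtain k :: int where k: "- T < (t - t0) + of_int k * (2 * T)" "(t - t0) + of_int k * (2 * T) \<le> T"
      using reduce_mod[OF T, of "t - t0"] by blast
    have "t + of_int k * (2 * T) \<notin> C"
    proof
      assume "t + of_int k * (2 * T) \<in> C"
      then have "(f t, g t) \<in> (\<lambda>t. (f t, g t)) ` C" by (rule rev_image_eqI) (simp add: perk)
      then show False using that by (simp add: W_def)
    qed
    moreover have "t + of_int k * (2 * T) \<in> {t0 - T..t0 + T}" using k by auto
    ultimately show ?thesis by (auto simp: C_def)
  qed
  have red': "\<exists>k::int. t + of_int k * (2 * T) = \<tau> (f t)" if W: "(f t, g t) \<in> W" for t
    using red[OF W] *(7) perk(1)[of t] by metis
  have gr: "a' \<in> I \<and> ((\<exists>t. f t = a' \<and> g t = b') \<longleftrightarrow> b' = g (\<tau> a'))" if W: "(a', b') \<in> W" for a' b'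
  proof -
    have I: "a' \<in> I" using W by (auto simp: W_def)
    have "b' = g (\<tau> a')" if "f t = a'" "g t = b'" for t
      using red'[of t] perk(2)[of t] W that by metis
    then show ?thesis using I *(6)[OF I] by blast
  qed
  have "\<tau> (f t0) = t0" using * by blast
  have "\<exists>k::int. t = \<tau> (f t) + of_int k * (2 * T)" if W: "(f t, g t) \<in> W" for t
  proof -
    obtain k :: int where "t + of_int k * (2 * T) = \<tau> (f t)" using red'[OF W] by blast
    then show ?thesis by (intro exI[of _ "- k"]) (simp add: algebra_simps)
  qed
  then show ?thesis
    by (intro exI[of _ I] exI[of _ W] exI[of _ \<tau>] conjI allI impI *(3,5) W mem) (use gr in blast)+
qed

text \<open>\<open>r\<close> is the curvature of the profile, the derivative of \<open>p\<close>
  divided by the speed \<open>x y\<close>. It is left free, so that the geometry applies to every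
  such closed embedded curve in the open quadrant whose normal makes one full turn.\<close>

locale profile_curve =
  fixes x y p r :: "real \<Rightarrow> real" and T :: real
  assumes T: "T > 0"
    and xd: "\<And>t. (x has_real_derivative - (x t * y t * sin (p t))) (at t)"
    and yd: "\<And>t. (y has_real_derivative x t * y t * cos (p t)) (at t)"
    and pd: "\<And>t. (p has_real_derivative x t * y t * r t) (at t)"
    and smooth: "smooth_on UNIV x" "smooth_on UNIV y" "smooth_on UNIV p"
    and pos: "\<And>t. 0 < x t" "\<And>t. 0 < y t"
    and per: "\<And>t. x (t + 2 * T) = x t" "\<And>t. y (t + 2 * T) = y t" "\<And>t. p (t + 2 * T) = p t + 2 * pi"
    and inj: "\<And>s t. x s = x t \<Longrightarrow> y s = y t \<Longrightarrow> \<exists>k::int. s = t + of_int k * (2 * T)"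
begin

lemma smooth_sin_cos: "smooth_on UNIV (\<lambda>t. sin (p t))" "smooth_on UNIV (\<lambda>t. cos (p t))"
  by (intro smooth_on_sin smooth_on_cos smooth open_UNIV)+

lemma periods:
  "x (t + of_int k * (2 * T)) = x t" "y (t + of_int k * (2 * T)) = y t"
  "cos (p (t + of_int k * (2 * T))) = cos (p t)" "sin (p (t + of_int k * (2 * T))) = sin (p t)"
  using periodic_int[of x "2 * T"] periodic_int[of y "2 * T"] per
    periodic_int[of "\<lambda>t. cos (p t)" "2 * T"] periodic_int[of "\<lambda>t. sin (p t)" "2 * T"] by auto

definition torus :: "('a::euclidean_space \<times> 'b::euclidean_space) set" where
  "torus = {z. \<exists>t. norm (fst z) = x t \<and> norm (snd z) = y t}"

text \<open>Determined only up to multiples of the period \<open>2 T\<close>, and not continuous; \<open>local_time\<close> provides smooth local branches.\<close>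

definition time :: "'a::euclidean_space \<times> 'b::euclidean_space \<Rightarrow> real" where
  "time z = (SOME t. norm (fst z) = x t \<and> norm (snd z) = y t)"

lemma time: "norm (fst z) = x (time z)" "norm (snd z) = y (time z)" if "z \<in> torus"
  using that someI_ex[of "\<lambda>t. norm (fst z) = x t \<and> norm (snd z) = y t"]
  by (auto simp: torus_def time_def)

lemma torusI: "norm (fst z) = x t \<Longrightarrow> norm (snd z) = y t \<Longrightarrow> z \<in> torus"
  by (auto simp: torus_def)

lemma time_eq:
  assumes "norm (fst z) = x t" "norm (snd z) = y t"
  obtains k :: int where "time z = t + of_int k * (2 * T)"
  using inj[of "time z" t] time[OF torusI[OF assms]] assms by auto

lemma torus_nonzero: "z \<in> torus \<Longrightarrow> fst z \<noteq> 0 \<and> snd z \<noteq> 0"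
  using time pos by (metis less_irrefl norm_zero)

lemma graph_x:
  assumes "sin (p t0) \<noteq> 0"
  shows "\<exists>I W \<tau>. open I \<and> open W \<and> (x t0, y t0) \<in> W \<and> smooth_on I \<tau>
    \<and> (\<forall>a b. (a, b) \<in> W \<longrightarrow> a \<in> I \<and> ((\<exists>t. x t = a \<and> y t = b) \<longleftrightarrow> b = y (\<tau> a)))
    \<and> (\<forall>t. (x t, y t) \<in> W \<longrightarrow> (\<exists>k::int. t = \<tau> (x t) + of_int k * (2 * T)))"
proof (rule local_graph[where f' = "\<lambda>t. - (x t * y t * sin (p t))"])
  show "(x has_real_derivative - (x t * y t * sin (p t))) (at t)" for t by (rule xd)
  show "smooth_on UNIV (\<lambda>t. - (x t * y t * sin (p t)))"
    by (intro smooth_on_minus smooth_on_mult smooth smooth_sin_cos open_UNIV)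
  show "- (x t0 * y t0 * sin (p t0)) \<noteq> 0" using assms pos[of t0] by simp
  show "continuous_on UNIV y" by (rule smooth_on_continuous, rule smooth)
  show "\<exists>k::int. s = t + of_int k * (2 * T)" if "x s = x t" "y s = y t" for s t by (rule inj[OF that])
qed (rule T per)+

lemma graph_y:
  assumes "cos (p t0) \<noteq> 0"
  shows "\<exists>I W \<tau>. open I \<and> open W \<and> (y t0, x t0) \<in> W \<and> smooth_on I \<tau>
    \<and> (\<forall>a b. (a, b) \<in> W \<longrightarrow> a \<in> I \<and> ((\<exists>t. y t = a \<and> x t = b) \<longleftrightarrow> b = x (\<tau> a)))
    \<and> (\<forall>t. (y t, x t) \<in> W \<longrightarrow> (\<exists>k::int. t = \<tau> (y t) + of_int k * (2 * T)))"
proof (rule local_graph[where f' = "\<lambda>t. x t * y t * cos (p t)"])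
  show "(y has_real_derivative x t * y t * cos (p t)) (at t)" for t by (rule yd)
  show "smooth_on UNIV (\<lambda>t. x t * y t * cos (p t))"
    by (intro  smooth_on_mult smooth smooth_sin_cos open_UNIV)
  show "x t0 * y t0 * cos (p t0) \<noteq> 0" using assms pos[of t0] by simp
  show "continuous_on UNIV x" by (rule smooth_on_continuous, rule smooth)
  show "\<exists>k::int. s = t + of_int k * (2 * T)" if "y s = y t" "x s = x t" for s t by (rule inj[OF that(2,1)])
qed (rule T per)+

text \<open>Where \<open>sin p\<close> is nonzero, \<open>x\<close> serves as local parameter of the
  curve; where it vanishes, \<open>cos p\<close> does not and \<open>y\<close> serves.\<close>

lemma local_time:
  fixes z0 :: "'a::euclidean_space \<times> 'b::euclidean_space"
  assumes "z0 \<in> torus"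
  obtains U s where "open U" "z0 \<in> U" "smooth_on U s" "\<And>z. z \<in> U \<Longrightarrow> fst z \<noteq> 0 \<and> snd z \<noteq> 0"
    "\<And>z. z \<in> U \<Longrightarrow> z \<in> torus \<Longrightarrow> \<exists>k::int. time z = s z + of_int k * (2 * T)"
proof (cases "sin (p (time z0)) = 0")
  case False
  obtain I W \<tau> where g: "open I" "open W" "(x (time z0), y (time z0)) \<in> W" "smooth_on I \<tau>"
    "\<And>a b. (a, b) \<in> W \<Longrightarrow> a \<in> I \<and> ((\<exists>t. x t = a \<and> y t = b) \<longleftrightarrow> b = y (\<tau> a))"
    "\<And>t. (x t, y t) \<in> W \<Longrightarrow> \<exists>k::int. t = \<tau> (x t) + of_int k * (2 * T)"
    using graph_x[OF False] by blast
  define U :: "('a \<times> 'b) set" where "U = {z. fst z \<noteq> 0} \<inter> {z. snd z \<noteq> 0} \<inter> (\<lambda>z. (norm (fst z), norm (snd z))) -` W"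
  have U: "open U" unfolding U_def
    by (intro open_Int open_Collect_neq open_vimage g continuous_intros)
  have "smooth_on U (\<lambda>z. \<tau> (norm (fst z)))"
    by (rule smooth_on_compose[OF U g(1) smooth_on_norm[OF U smooth_on_fst[OF U smooth_on_id[OF U]]] g(4)])
      (use g(5) in \<open>auto simp: U_def\<close>)
  then show ?thesis
    using that[OF U, of "\<lambda>z. \<tau> (norm (fst z))"] g(3) g(6) torus_nonzero[OF assms] time[OF assms] time
    by (fastforce simp: U_def)
next
  case True
  then have c: "cos (p (time z0)) \<noteq> 0" using sin_cos_squared_add[of "p (time z0)"] by auto
  obtain I W \<tau> where g: "open I" "open W" "(y (time z0), x (time z0)) \<in> W" "smooth_on I \<tau>"
    "\<And>a b. (a, b) \<in> W \<Longrightarrow> a \<in> I \<and> ((\<exists>t. y t = a \<and> x t = b) \<longleftrightarrow> b = x (\<tau> a))"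
    "\<And>t. (y t, x t) \<in> W \<Longrightarrow> \<exists>k::int. t = \<tau> (y t) + of_int k * (2 * T)"
    using graph_y[OF c] by blast
  define U :: "('a \<times> 'b) set" where "U = {z. fst z \<noteq> 0} \<inter> {z. snd z \<noteq> 0} \<inter> (\<lambda>z. (norm (snd z), norm (fst z))) -` W"
  have U: "open U" unfolding U_def
    by (intro open_Int open_Collect_neq open_vimage g continuous_intros)
  have "smooth_on U (\<lambda>z. \<tau> (norm (snd z)))"
    by (rule smooth_on_compose[OF U g(1) smooth_on_norm[OF U smooth_on_snd[OF U smooth_on_id[OF U]]] g(4)])
      (use g(5) in \<open>auto simp: U_def\<close>)
  then show ?thesis
    using that[OF U, of "\<lambda>z. \<tau> (norm (snd z))"] g(3) g(6) torus_nonzero[OF assms] time[OF assms] time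
    by (fastforce simp: U_def)
qed

text \<open>Over a local graph one radius is a smooth function of the other, the situation of
  \<open>sphere_bundle_chart\<close>; the coordinate \<open>e\<close> is any one that does not
  vanish at \<open>P\<close>.\<close>

lemma smooth_hypersurface_torus:
  "smooth_hypersurface (torus :: ('a::euclidean_space \<times> 'b::euclidean_space) set)"
  unfolding smooth_hypersurface_def
proof
  fix P :: "'a \<times> 'b" assume P: "P \<in> torus"
  note nz = torus_nonzero[OF P]
  show "\<exists>U V \<phi> \<psi>. \<exists>b\<in>(Basis :: ('a \<times> 'b) set). open U \<and> open V \<and> P \<in> U \<and> diffeomorphism U V \<phi> \<psi> \<and>
      \<phi> ` (U \<inter> torus) = {y \<in> V. y \<bullet> b = 0}"
  proof (cases "sin (p (time P)) = 0")
    case False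
    obtain I W \<tau> where g: "open I" "open W" "(x (time P), y (time P)) \<in> W" "smooth_on I \<tau>"
      "\<And>a b. (a, b) \<in> W \<Longrightarrow> a \<in> I \<and> ((\<exists>t. x t = a \<and> y t = b) \<longleftrightarrow> b = y (\<tau> a))"
      "\<And>t. (x t, y t) \<in> W \<Longrightarrow> \<exists>k::int. t = \<tau> (x t) + of_int k * (2 * T)"
      using graph_x[OF False] by blast
    obtain e where e: "e \<in> Basis" "snd P \<bullet> e \<noteq> 0" using nz euclidean_all_zero_iff[of "snd P"] by blast
    define U :: "('a \<times> 'b) set" where "U = {z. fst z \<noteq> 0} \<inter> (\<lambda>z. (norm (fst z), norm (snd z))) -` W"
    have b: "(0, e) \<in> (Basis :: ('a \<times> 'b) set)" using e by (simp add: Basis_prod_def)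
    have "\<exists>U V \<phi> \<psi>. open U \<and> open V \<and> P \<in> U \<and> diffeomorphism U V \<phi> \<psi> \<and> \<phi> ` (U \<inter> torus) = {y \<in> V. y \<bullet> ((0, e) :: 'a \<times> 'b) = 0}"
    proof (rule sphere_bundle_chart[OF bounded_linear_fst bounded_linear_snd b, where I = I and G = "\<lambda>a. y (\<tau> a)" and U = U])
      show "smooth_on I (\<lambda>a. y (\<tau> a))" by (rule smooth_on_compose[OF g(1) open_UNIV g(4) smooth(2)]) auto
      show "open U" unfolding U_def by (intro open_Int open_Collect_neq open_vimage g continuous_intros)
      show "P \<in> U" using g(3) nz time[OF P] by (simp add: U_def)
      show "fst z \<noteq> 0 \<and> norm (fst z) \<in> I" if "z \<in> U" for z using that g(5) by (auto simp: U_def)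
      show "z \<in> torus \<longleftrightarrow> norm (snd z) = y (\<tau> (norm (fst z)))" if "z \<in> U" for z
        using that g(5)[of "norm (fst z)" "norm (snd z)"] unfolding torus_def U_def by auto metis+
    qed (use g pos P e in \<open>auto simp: inner_prod_def\<close>)
    then show ?thesis using b by blast
  next
    case True
    then have c: "cos (p (time P)) \<noteq> 0" using sin_cos_squared_add[of "p (time P)"] by auto
    obtain I W \<tau> where g: "open I" "open W" "(y (time P), x (time P)) \<in> W" "smooth_on I \<tau>"
      "\<And>a b. (a, b) \<in> W \<Longrightarrow> a \<in> I \<and> ((\<exists>t. y t = a \<and> x t = b) \<longleftrightarrow> b = x (\<tau> a))"
      "\<And>t. (y t, x t) \<in> W \<Longrightarrow> \<exists>k::int. t = \<tau> (y t) + of_int k * (2 * T)"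
      using graph_y[OF c] by blast
    obtain e where e: "e \<in> Basis" "fst P \<bullet> e \<noteq> 0" using nz euclidean_all_zero_iff[of "fst P"] by blast
    define U :: "('a \<times> 'b) set" where "U = {z. snd z \<noteq> 0} \<inter> (\<lambda>z. (norm (snd z), norm (fst z))) -` W"
    have b: "(e, 0) \<in> (Basis :: ('a \<times> 'b) set)" using e by (simp add: Basis_prod_def)
    have "\<exists>U V \<phi> \<psi>. open U \<and> open V \<and> P \<in> U \<and> diffeomorphism U V \<phi> \<psi> \<and> \<phi> ` (U \<inter> torus) = {y \<in> V. y \<bullet> ((e, 0) :: 'a \<times> 'b) = 0}"
    proof (rule sphere_bundle_chart[OF bounded_linear_snd bounded_linear_fst b, where I = I and G = "\<lambda>a. x (\<tau> a)" and U = U])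
      show "smooth_on I (\<lambda>a. x (\<tau> a))" by (rule smooth_on_compose[OF g(1) open_UNIV g(4) smooth(1)]) auto
      show "open U" unfolding U_def by (intro open_Int open_Collect_neq open_vimage g continuous_intros)
      show "P \<in> U" using g(3) nz time[OF P] by (simp add: U_def)
      show "snd z \<noteq> 0 \<and> norm (snd z) \<in> I" if "z \<in> U" for z using that g(5) by (auto simp: U_def)
      show "z \<in> torus \<longleftrightarrow> norm (fst z) = x (\<tau> (norm (snd z)))" if "z \<in> U" for z
        using that g(5)[of "norm (snd z)" "norm (fst z)"] unfolding torus_def U_def by auto metis+
    qed (use g pos P e in \<open>auto simp: inner_prod_def\<close>)
    then show ?thesis using b by blast
  qed
qed

lemma torus_image: "torus = (\<lambda>(u, v, t). (x t *\<^sub>R u, y t *\<^sub>R v)) `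
    (sphere (0::'a::euclidean_space) 1 \<times> sphere (0::'b::euclidean_space) 1 \<times> {- T..T})"
  (is "_ = ?F ` ?A")
proof (intro equalityI subsetI)
  fix z :: "'a \<times> 'b" assume z: "z \<in> torus"
  obtain k :: int where k: "- T < time z + of_int k * (2 * T)" "time z + of_int k * (2 * T) \<le> T"
    using reduce_mod[OF T] by blast
  have "z = ?F (sgn (fst z), sgn (snd z), time z + of_int k * (2 * T))"
    using time[OF z] pos[of "time z"] by (simp add: periods prod_eq_iff sgn_div_norm)
  moreover have "(sgn (fst z), sgn (snd z), time z + of_int k * (2 * T)) \<in> ?A"
    using k torus_nonzero[OF z] by (simp add: norm_sgn)
  ultimately show "z \<in> ?F ` ?A" by (rule image_eqI)
next
  fix z :: "'a \<times> 'b" assume "z \<in> ?F ` ?A"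
  then obtain w where w: "w \<in> ?A" "z = ?F w" by blast
  obtain u v t where "w = (u, v, t)" by (cases w) blast
  then have "norm u = 1" "norm v = 1" "z = (x t *\<^sub>R u, y t *\<^sub>R v)" using w by auto
  then show "z \<in> torus" using pos[of t] by (intro torusI[of _ t]) auto
qed

lemma compact_torus: "compact (torus :: ('a::euclidean_space \<times> 'b::euclidean_space) set)"
  unfolding torus_image
proof (rule compact_continuous_image)
  have c: "continuous_on UNIV x" "continuous_on UNIV y" by (rule smooth_on_continuous, rule smooth)+
  show "continuous_on (sphere (0::'a) 1 \<times> sphere (0::'b) 1 \<times> {- T..T}) (\<lambda>(u, v, t). (x t *\<^sub>R u, y t *\<^sub>R v))"
    unfolding case_prod_beta
    by (intro continuous_intros continuous_on_compose2[OF c(1)] continuous_on_compose2[OF c(2)]) auto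
qed (intro compact_Times compact_sphere compact_Icc)

lemma bi_orthogonal_torus: "bi_orthogonal_invariant (torus :: ((real^'n) \<times> (real^'n)) set)"
  unfolding bi_orthogonal_invariant_def
proof (intro allI impI)
  fix A B :: "real^'n^'n" assume AB: "orthogonal_matrix A \<and> orthogonal_matrix B"
  have n: "norm (M *v v) = norm v" if "orthogonal_matrix M" for M :: "real^'n^'n" and v
    using that orthogonal_transformation_matrix[of "\<lambda>v. M *v v"] orthogonal_transformation_norm by auto
  have t: "orthogonal_matrix (transpose M)" "M *v (transpose M *v v) = v" if "orthogonal_matrix M"
    for M :: "real^'n^'n" and v
  proof -
    show "orthogonal_matrix (transpose M)" using that by (simp add: orthogonal_matrix_transpose)
    show "M *v (transpose M *v v) = v"
      using that unfolding matrix_vector_mul_assoc orthogonal_matrix_def by simp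
  qed
  show "(\<lambda>(x, y). (A *v x, B *v y)) ` torus = torus"
  proof (intro equalityI subsetI)
    fix z assume z: "z \<in> (torus :: ((real^'n) \<times> (real^'n)) set)"
    have "(transpose A *v fst z, transpose B *v snd z) \<in> torus"
      using z AB by (simp add: torus_def n t del: transpose_matrix_vector)
    moreover have "z = (\<lambda>(x, y). (A *v x, B *v y)) (transpose A *v fst z, transpose B *v snd z)"
      using AB by (simp add: t del: transpose_matrix_vector)
    ultimately show "z \<in> (\<lambda>(x, y). (A *v x, B *v y)) ` torus" by (rule rev_image_eqI)
  qed (use AB n in \<open>auto simp: torus_def\<close>)
qed

end

section \<open>Unit normal, tangent spaces and mean curvature of the swept hypersurface\<close>

lemma norm_has_vector_derivative:
  fixes f :: "real \<Rightarrow> 'a::real_inner"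
  assumes "(f has_vector_derivative D) (at t)" "f t \<noteq> 0"
  shows "((\<lambda>t. norm (f t)) has_real_derivative sgn (f t) \<bullet> D) (at t)"
proof -
  have "((\<lambda>t. norm (f t)) has_derivative (\<lambda>h. (h *\<^sub>R D) \<bullet> sgn (f t))) (at t)"
    using has_derivative_compose[OF assms(1)[unfolded has_vector_derivative_def] has_derivative_norm[OF assms(2)]] .
  moreover have "(\<lambda>h. (h *\<^sub>R D) \<bullet> sgn (f t)) = (\<lambda>h. (sgn (f t) \<bullet> D) * h)"
    by (simp add: fun_eq_iff inner_commute)
  ultimately show ?thesis unfolding has_field_derivative_def by metis
qed

lemma sgn_line_has_vector_derivative:
  fixes u A :: "'a::real_inner"
  assumes "norm u = 1" "u \<bullet> A = 0"
  shows "((\<lambda>\<tau>. sgn (u + \<tau> *\<^sub>R A)) has_vector_derivative A) (at 0)"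
proof -
  have l: "((\<lambda>\<tau>. u + \<tau> *\<^sub>R A) has_vector_derivative A) (at 0)"
    by (auto intro!: derivative_eq_intros)
  have s: "sgn u = u" using assms(1) by (simp add: sgn_div_norm)
  have "u \<noteq> 0" using assms(1) by auto
  then have "((\<lambda>\<tau>. norm (u + \<tau> *\<^sub>R A)) has_real_derivative 0) (at 0)"
    using norm_has_vector_derivative[OF l] assms(2) s by simp
  then have "((\<lambda>\<tau>. inverse (norm (u + \<tau> *\<^sub>R A))) has_real_derivative 0) (at 0)"
    using DERIV_inverse_fun[of "\<lambda>\<tau>. norm (u + \<tau> *\<^sub>R A)" 0 0 UNIV] assms(1) by simp
  from has_vector_derivative_scaleR[OF this l] show ?thesis
    using assms(1) by (simp add: sgn_div_norm)
qed

text \<open>The inner product of \<open>u + \<tau> A\<close> with \<open>u\<close> is always 1, so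
  projecting this line to the sphere is smooth for all parameters.\<close>

lemma smooth_on_sgn_line:
  fixes u A :: "'a::euclidean_space"
  assumes "norm u = 1" "u \<bullet> A = 0"
  shows "u + \<tau> *\<^sub>R A \<noteq> 0" "smooth_on UNIV (\<lambda>\<tau>. sgn (u + \<tau> *\<^sub>R A))"
proof -
  show nz: "u + \<tau> *\<^sub>R A \<noteq> 0" for \<tau>
  proof
    assume "u + \<tau> *\<^sub>R A = 0"
    then have "u \<bullet> (u + \<tau> *\<^sub>R A) = 0" by simp
    then show False using assms by (simp add: inner_add_right power2_norm_eq_inner[symmetric])
  qed
  show "smooth_on UNIV (\<lambda>\<tau>. sgn (u + \<tau> *\<^sub>R A))"
    by (intro smooth_on_sgn smooth_on_add smooth_on_scaleR smooth_on_const smooth_on_id open_UNIV nz)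
qed

context profile_curve
begin

text \<open>The minus sign undoes the reversal of the normal made for the profile equation. The
  ambiguity of \<open>time\<close> is harmless, since \<open>cos p\<close> and \<open>sin p\<close>
  have period \<open>2 T\<close>.\<close>

definition normal :: "'a::euclidean_space \<times> 'b::euclidean_space \<Rightarrow> 'a \<times> 'b" where
  "normal z = - (cos (p (time z)) *\<^sub>R sgn (fst z), sin (p (time z)) *\<^sub>R sgn (snd z))"

lemma smooth_normal: "smooth_map_on (torus :: ('a::euclidean_space \<times> 'b::euclidean_space) set) normal"
proof (rule smooth_map_onI)
  fix P :: "'a \<times> 'b" assume P: "P \<in> torus"
  obtain U s where U: "open U" "P \<in> U" "smooth_on U s" "\<And>z. z \<in> U \<Longrightarrow> fst z \<noteq> 0 \<and> snd z \<noteq> 0"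
    and s: "\<And>z. z \<in> U \<Longrightarrow> z \<in> torus \<Longrightarrow> \<exists>k::int. time z = s z + of_int k * (2 * T)"
    using local_time[OF P] by metis
  have cs: "smooth_on U (\<lambda>z. cos (p (s z)))" "smooth_on U (\<lambda>z. sin (p (s z)))"
    by (rule smooth_on_compose[OF U(1) open_UNIV U(3)], rule smooth_sin_cos, simp)+
  let ?g = "\<lambda>z. - (cos (p (s z)) *\<^sub>R sgn (fst z), sin (p (s z)) *\<^sub>R sgn (snd z))"
  have "smooth_on U ?g"
    by (intro smooth_on_minus smooth_on_Pair smooth_on_scaleR smooth_on_sgn smooth_on_fst smooth_on_snd smooth_on_id cs U(1))
      (use U(4) in auto)
  moreover have "?g z = normal z" if "z \<in> U \<inter> torus" for z
    using s[of z] that by (auto simp: normal_def periods)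
  ultimately show "\<exists>U g. open U \<and> P \<in> U \<and> smooth_on U g \<and> (\<forall>z\<in>U \<inter> torus. g z = normal z)"
    using U(1,2) by blast
qed

lemma norm_normal: "z \<in> torus \<Longrightarrow> norm (normal z) = 1"
  using torus_nonzero[of z] by (simp add: normal_def norm_Pair norm_sgn)

text \<open>Differentiating \<open>norm (fst z) = x (s z)\<close> and
  \<open>norm (snd z) = y (s z)\<close> along a curve shows that the radial components of
  \<open>v\<close> form a multiple of \<open>(- sin p, cos p)\<close>, the tangent of the
  profile.\<close>

lemma tangent_normal:
  fixes P :: "'a::euclidean_space \<times> 'b::euclidean_space"
  assumes P: "P \<in> torus" and v: "v \<in> tangent_space torus P"
  shows "normal P \<bullet> v = 0"
proof -
  obtain \<gamma> \<epsilon> where g: "\<epsilon> > 0" "smooth_on {-\<epsilon><..<\<epsilon>} \<gamma>" "\<gamma> ` {-\<epsilon><..<\<epsilon>} \<subseteq> torus" "\<gamma> (0::real) = P"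
    and gv: "(\<gamma> has_vector_derivative v) (at 0)"
    using v unfolding tangent_space_def by blast
  obtain U s where U: "open U" "P \<in> U" "smooth_on U s"
    and s: "\<And>z. z \<in> U \<Longrightarrow> z \<in> torus \<Longrightarrow> \<exists>k::int. time z = s z + of_int k * (2 * T)"
    using local_time[OF P] by metis
  define V where "V = {-\<epsilon><..<\<epsilon>} \<inter> \<gamma> -` U"
  have V: "open V" unfolding V_def
    by (rule continuous_open_preimage[OF smooth_on_continuous[OF g(2)] _ U(1)]) simp
  have V0: "0 \<in> V" using g U by (simp add: V_def)
  have n: "norm (fst z) = x (s z)" "norm (snd z) = y (s z)" "cos (p (time z)) = cos (p (s z))" "sin (p (time z)) = sin (p (s z))"
    if "z \<in> U" "z \<in> torus" for z
    using s[OF that] time[OF that(2)] by (auto simp: periods)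
  have nV: "x (s (\<gamma> \<tau>)) = norm (fst (\<gamma> \<tau>))" "y (s (\<gamma> \<tau>)) = norm (snd (\<gamma> \<tau>))" if "\<tau> \<in> V" for \<tau>
  proof -
    have "\<gamma> \<tau> \<in> U" "\<gamma> \<tau> \<in> torus" using g(3) that by (auto simp: V_def)
    then show "x (s (\<gamma> \<tau>)) = norm (fst (\<gamma> \<tau>))" "y (s (\<gamma> \<tau>)) = norm (snd (\<gamma> \<tau>))" using n by auto
  qed
  define D where "D = frechet_derivative s (at P) v"
  have ds: "(s has_derivative frechet_derivative s (at P)) (at P)" by (rule smooth_on_has_derivative[OF U(3,2)])
  have "(s has_derivative frechet_derivative s (at P)) (at (\<gamma> 0))" using ds g(4) by simp
  from has_derivative_compose[OF gv[unfolded has_vector_derivative_def] this]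
  have "((\<lambda>\<tau>. s (\<gamma> \<tau>)) has_derivative (\<lambda>h. frechet_derivative s (at P) (h *\<^sub>R v))) (at 0)" .
  moreover have "(\<lambda>h. frechet_derivative s (at P) (h *\<^sub>R v)) = (\<lambda>h. D * h)"
    using linear_cmul[OF has_derivative_linear[OF ds]] by (simp add: D_def fun_eq_iff)
  ultimately have sd: "((\<lambda>\<tau>. s (\<gamma> \<tau>)) has_real_derivative D) (at 0)"
    by (simp add: has_field_derivative_def)
  let ?t = "s P"
  have fs: "((\<lambda>\<tau>. fst (\<gamma> \<tau>)) has_vector_derivative fst v) (at 0)" "((\<lambda>\<tau>. snd (\<gamma> \<tau>)) has_vector_derivative snd v) (at 0)"
    using bounded_linear.has_vector_derivative[OF bounded_linear_fst gv] bounded_linear.has_vector_derivative[OF bounded_linear_snd gv] by auto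
  have "((\<lambda>\<tau>. x (s (\<gamma> \<tau>))) has_real_derivative - (x ?t * y ?t * sin (p ?t)) * D) (at 0)"
    using DERIV_chain2[OF xd sd] g(4) by simp
  then have "((\<lambda>\<tau>. x (s (\<gamma> \<tau>))) has_vector_derivative - (x ?t * y ?t * sin (p ?t)) * D) (at 0)"
    by (simp only: has_real_derivative_iff_has_vector_derivative)
  then have "((\<lambda>\<tau>. norm (fst (\<gamma> \<tau>))) has_vector_derivative - (x ?t * y ?t * sin (p ?t)) * D) (at 0)"
    by (rule has_vector_derivative_transform_within_open[OF _ V V0]) (simp add: nV)
  moreover have "((\<lambda>\<tau>. norm (fst (\<gamma> \<tau>))) has_vector_derivative sgn (fst P) \<bullet> fst v) (at 0)"
    using norm_has_vector_derivative[OF fs(1)] torus_nonzero[OF P] g(4)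
    by (simp add: has_real_derivative_iff_has_vector_derivative)
  ultimately have e1: "sgn (fst P) \<bullet> fst v = - (x ?t * y ?t * sin (p ?t)) * D"
    by (rule vector_derivative_unique_at[rotated])
  have "((\<lambda>\<tau>. y (s (\<gamma> \<tau>))) has_real_derivative x ?t * y ?t * cos (p ?t) * D) (at 0)"
    using DERIV_chain2[OF yd sd] g(4) by simp
  then have "((\<lambda>\<tau>. y (s (\<gamma> \<tau>))) has_vector_derivative x ?t * y ?t * cos (p ?t) * D) (at 0)"
    by (simp only: has_real_derivative_iff_has_vector_derivative)
  then have "((\<lambda>\<tau>. norm (snd (\<gamma> \<tau>))) has_vector_derivative x ?t * y ?t * cos (p ?t) * D) (at 0)"
    by (rule has_vector_derivative_transform_within_open[OF _ V V0]) (simp add: nV)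
  moreover have "((\<lambda>\<tau>. norm (snd (\<gamma> \<tau>))) has_vector_derivative sgn (snd P) \<bullet> snd v) (at 0)"
    using norm_has_vector_derivative[OF fs(2)] torus_nonzero[OF P] g(4)
    by (simp add: has_real_derivative_iff_has_vector_derivative)
  ultimately have e2: "sgn (snd P) \<bullet> snd v = x ?t * y ?t * cos (p ?t) * D"
    by (rule vector_derivative_unique_at[rotated])
  have "normal P \<bullet> v = - (cos (p ?t) * (sgn (fst P) \<bullet> fst v) + sin (p ?t) * (sgn (snd P) \<bullet> snd v))"
    using n(3,4)[OF U(2) P] by (simp add: normal_def inner_prod_def)
  also have "\<dots> = 0" unfolding e1 e2 by (simp add: algebra_simps)
  finally show ?thesis .
qed

lemma unit_normal_field_normal:
  "unit_normal_field (torus :: ('a::euclidean_space \<times> 'b::euclidean_space) set) normal"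
  unfolding unit_normal_field_def using smooth_normal norm_normal tangent_normal by blast

text \<open>The curve \<open>\<tau> \<mapsto> (x (t + \<beta> \<tau>) sgn (u + \<tau> A / x t), y (t + \<beta> \<tau>) sgn (v + \<tau> B / y t))\<close> with
  \<open>\<beta> = a / (x t * y t)\<close> lies in the torus, and the normal along it is explicit.\<close>

lemma tangent_curve:
  fixes P :: "'a::euclidean_space \<times> 'b::euclidean_space" and a :: real
  assumes P: "P \<in> torus" and A: "sgn (fst P) \<bullet> A = 0" and B: "sgn (snd P) \<bullet> B = 0"
  defines "t \<equiv> time P"
  defines "v \<equiv> (- (a * sin (p t)) *\<^sub>R sgn (fst P) + A, (a * cos (p t)) *\<^sub>R sgn (snd P) + B)"
  shows "v \<in> tangent_space torus P"
    "frechet_derivative normal (at P within torus) v =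
      - (- (r t * a * sin (p t)) *\<^sub>R sgn (fst P) + (cos (p t) / x t) *\<^sub>R A,
         (r t * a * cos (p t)) *\<^sub>R sgn (snd P) + (sin (p t) / y t) *\<^sub>R B)"
proof -
  have ps: "x t \<noteq> 0" "y t \<noteq> 0" using pos[of t] by auto
  let ?u = "sgn (fst P)" and ?v = "sgn (snd P)"
  have nz: "norm ?u = 1" "norm ?v = 1" using torus_nonzero[OF P] by (auto simp: norm_sgn)
  \<comment> \<open>Dividing by the speed \<open>x y\<close> makes \<open>a\<close> the arc length
    velocity along the profile.\<close>
  define \<beta> where "\<beta> = a / (x t * y t)"
  define u where "u \<tau> = sgn (?u + \<tau> *\<^sub>R (A /\<^sub>R x t))" for \<tau>
  define w where "w \<tau> = sgn (?v + \<tau> *\<^sub>R (B /\<^sub>R y t))" for \<tau>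
  define \<sigma> where "\<sigma> \<tau> = t + \<beta> * \<tau>" for \<tau>
  define \<gamma> where "\<gamma> \<tau> = (x (\<sigma> \<tau>) *\<^sub>R u \<tau>, y (\<sigma> \<tau>) *\<^sub>R w \<tau>)" for \<tau>
  have A': "?u \<bullet> (A /\<^sub>R x t) = 0" "?v \<bullet> (B /\<^sub>R y t) = 0" using A B by auto
  have smu: "smooth_on UNIV u" "smooth_on UNIV w"
    unfolding u_def[abs_def] w_def[abs_def] using smooth_on_sgn_line(2) nz A' by blast+
  have nu: "norm (u \<tau>) = 1" "norm (w \<tau>) = 1" for \<tau>
    using smooth_on_sgn_line(1)[OF nz(1) A'(1)] smooth_on_sgn_line(1)[OF nz(2) A'(2)]
    by (auto simp: u_def w_def norm_sgn)
  have du: "(u has_vector_derivative A /\<^sub>R x t) (at 0)" "(w has_vector_derivative B /\<^sub>R y t) (at 0)"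
    unfolding u_def[abs_def] w_def[abs_def]
    by (intro sgn_line_has_vector_derivative nz A')+
  have u0: "u 0 = ?u" "w 0 = ?v" using nz sgn_div_norm[of ?u] sgn_div_norm[of ?v] by (simp_all add: u_def w_def)
  have sm\<sigma>: "smooth_on UNIV \<sigma>" unfolding \<sigma>_def[abs_def]
    by (intro smooth_on_add smooth_on_mult smooth_on_const smooth_on_id open_UNIV)
  have d\<sigma>: "(\<sigma> has_real_derivative \<beta>) (at 0)" and \<sigma>0: "\<sigma> 0 = t"
    unfolding \<sigma>_def[abs_def] by (auto intro!: derivative_eq_intros)
  have "smooth_on UNIV (\<lambda>\<tau>. x (\<sigma> \<tau>))" "smooth_on UNIV (\<lambda>\<tau>. y (\<sigma> \<tau>))"
    by (rule smooth_on_compose[OF open_UNIV open_UNIV sm\<sigma>], rule smooth, simp)+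
  then have sm\<gamma>: "smooth_on UNIV \<gamma>" unfolding \<gamma>_def[abs_def]
    by (intro smooth_on_Pair smooth_on_scaleR smu open_UNIV)
  have n\<gamma>: "norm (fst (\<gamma> \<tau>)) = x (\<sigma> \<tau>)" "norm (snd (\<gamma> \<tau>)) = y (\<sigma> \<tau>)" for \<tau>
    using pos[of "\<sigma> \<tau>"] by (simp_all add: \<gamma>_def nu)
  have in_torus: "\<gamma> \<tau> \<in> torus" for \<tau> by (rule torusI[OF n\<gamma>])
  have \<gamma>0: "\<gamma> 0 = P"
    using time[OF P] ps by (simp add: \<gamma>_def \<sigma>0 u0 sgn_div_norm prod_eq_iff t_def)
  have dx: "((\<lambda>\<tau>. x (\<sigma> \<tau>)) has_real_derivative - (a * sin (p t))) (at 0)"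
    using DERIV_chain2[OF xd d\<sigma>] ps by (simp add: \<sigma>0 \<beta>_def field_simps)
  have dy: "((\<lambda>\<tau>. y (\<sigma> \<tau>)) has_real_derivative a * cos (p t)) (at 0)"
    using DERIV_chain2[OF yd d\<sigma>] ps by (simp add: \<sigma>0 \<beta>_def field_simps)
  have dp: "((\<lambda>\<tau>. p (\<sigma> \<tau>)) has_real_derivative r t * a) (at 0)"
    using DERIV_chain2[OF pd d\<sigma>] ps by (simp add: \<sigma>0 \<beta>_def field_simps)
  have dcos: "((\<lambda>\<tau>. cos (p (\<sigma> \<tau>))) has_real_derivative - (r t * a * sin (p t))) (at 0)"
    using DERIV_chain2[OF DERIV_cos dp] by (simp add: \<sigma>0 mult_ac)
  have dsin: "((\<lambda>\<tau>. sin (p (\<sigma> \<tau>))) has_real_derivative r t * a * cos (p t)) (at 0)"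
    using DERIV_chain2[OF DERIV_sin dp] by (simp add: \<sigma>0 mult_ac)
  have d\<gamma>: "(\<gamma> has_vector_derivative v) (at 0)"
    using has_vector_derivative_Pair[OF has_vector_derivative_scaleR[OF dx du(1)] has_vector_derivative_scaleR[OF dy du(2)]] ps
    by (simp add: \<gamma>_def[abs_def] v_def \<sigma>0 u0 add.commute)
  show "v \<in> tangent_space torus P"
    unfolding tangent_space_def
    using smooth_on_subset[OF sm\<gamma>] in_torus \<gamma>0 d\<gamma>
    by (intro CollectI exI[of _ \<gamma>] exI[of _ 1]) auto
  have "normal (\<gamma> \<tau>) = - (cos (p (\<sigma> \<tau>)) *\<^sub>R u \<tau>, sin (p (\<sigma> \<tau>)) *\<^sub>R w \<tau>)" for \<tau>
  proof -
    obtain k :: int where k: "time (\<gamma> \<tau>) = \<sigma> \<tau> + of_int k * (2 * T)" using time_eq[OF n\<gamma>(1)[of \<tau>] n\<gamma>(2)[of \<tau>]] by blast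
    have "sgn (fst (\<gamma> \<tau>)) = u \<tau>" "sgn (snd (\<gamma> \<tau>)) = w \<tau>"
      unfolding sgn_div_norm n\<gamma> using pos[of "\<sigma> \<tau>"] by (simp_all add: \<gamma>_def)
    then show ?thesis by (simp add: normal_def k periods)
  qed
  moreover have "((\<lambda>\<tau>. - (cos (p (\<sigma> \<tau>)) *\<^sub>R u \<tau>, sin (p (\<sigma> \<tau>)) *\<^sub>R w \<tau>)) has_vector_derivative
      - (- (r t * a * sin (p t)) *\<^sub>R ?u + (cos (p t) / x t) *\<^sub>R A, (r t * a * cos (p t)) *\<^sub>R ?v + (sin (p t) / y t) *\<^sub>R B)) (at 0)"
    using has_vector_derivative_minus[OF has_vector_derivative_Pair[OF has_vector_derivative_scaleR[OF dcos du(1)] has_vector_derivative_scaleR[OF dsin du(2)]]]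
    by (simp add: \<sigma>0 u0 add.commute divide_inverse)
  ultimately have "((\<lambda>\<tau>. normal (\<gamma> \<tau>)) has_vector_derivative
      - (- (r t * a * sin (p t)) *\<^sub>R ?u + (cos (p t) / x t) *\<^sub>R A, (r t * a * cos (p t)) *\<^sub>R ?v + (sin (p t) / y t) *\<^sub>R B)) (at 0)"
    by simp
  from vector_derivative_unique_at[OF derivative_along_curve[OF smooth_normal in_torus d\<gamma>] this]
  show "frechet_derivative normal (at P within torus) v =
      - (- (r t * a * sin (p t)) *\<^sub>R sgn (fst P) + (cos (p t) / x t) *\<^sub>R A,
         (r t * a * cos (p t)) *\<^sub>R sgn (snd P) + (sin (p t) / y t) *\<^sub>R B)"
    unfolding \<gamma>0 .
qed

text \<open>The tangent space is the orthogonal sum of the profile direction \<open>\<theta>\<close>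
  and the tangent spaces of the two spheres, and \<open>tangent_curve\<close> shows that the
  derivative of the normal acts on each as a scalar.\<close>

lemma mean_curvature_torus:
  fixes P :: "'a::euclidean_space \<times> 'b::euclidean_space"
  assumes P: "P \<in> torus"
  defines "t \<equiv> time P"
  shows "mean_curvature torus normal P =
    - (r t + real (DIM('a) - 1) * (cos (p t) / x t) + real (DIM('b) - 1) * (sin (p t) / y t))"
proof -
  let ?u = "sgn (fst P)" and ?v = "sgn (snd P)"
  let ?c = "cos (p t)" and ?s = "sin (p t)"
  have nz: "norm ?u = 1" "norm ?v = 1" using torus_nonzero[OF P] by (auto simp: norm_sgn)
  then have uu: "?u \<bullet> ?u = 1" "?v \<bullet> ?v = 1" by (simp_all add: power2_norm_eq_inner[symmetric])
  have nz': "?u \<noteq> 0" "?v \<noteq> 0" using torus_nonzero[OF P] by (auto simp: sgn_zero_iff)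
  define \<theta> where "\<theta> = (- ?s *\<^sub>R ?u, ?c *\<^sub>R ?v)"
  define V :: "nat \<Rightarrow> ('a \<times> 'b) set" where
    "V j = (if j = 0 then span {\<theta>} else if j = 1 then {A. ?u \<bullet> A = 0} \<times> {0} else {0} \<times> {B. ?v \<bullet> B = 0})" for j
  define k :: "nat \<Rightarrow> real" where "k j = (if j = 0 then - r t else if j = 1 then - (?c / x t) else - (?s / y t))" for j
  have \<theta>: "\<theta> \<bullet> \<theta> = 1"
    unfolding \<theta>_def inner_prod_def using sin_cos_squared_add[of "p t"] by (simp add: uu power2_eq_square)
  have V_iff: "(\<forall>j\<in>{0,1,2}. w j \<in> V j) \<longleftrightarrow> (\<exists>a. w 0 = a *\<^sub>R \<theta>) \<and> (?u \<bullet> fst (w 1) = 0 \<and> snd (w 1) = 0)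
      \<and> (fst (w 2) = 0 \<and> ?v \<bullet> snd (w 2) = 0)" for w
    by (auto simp: V_def span_singleton mem_Times_iff)
  have split: "(\<Sum>j\<in>{0,1,2}. w j) = w 0 + (w 1 + w 2)" for w :: "nat \<Rightarrow> 'c::comm_monoid_add"
    by simp
  have "mean_curvature torus normal P = (\<Sum>j\<in>{0,1,2::nat}. k j * real (dim (V j)))"
  proof (rule mean_curvature_orthogonal_sum)
    show "subspace (V j)" for j
      unfolding V_def by (auto intro!: subspace_span subspace_Times subspace_hyperplane)
    show "v \<bullet> w = 0" if "i \<in> {0,1,2}" "j \<in> {0,1,2}" "i \<noteq> j" "v \<in> V i" "w \<in> V j" for i j :: nat and v w
      using that by (auto simp: V_def span_singleton \<theta>_def inner_prod_def inner_commute[of _ ?u] inner_commute[of _ ?v])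
    have tan: "(\<Sum>j\<in>{0,1,2}. w j) \<in> tangent_space torus P \<and>
        frechet_derivative normal (at P within torus) (\<Sum>j\<in>{0,1,2}. w j) = (\<Sum>j\<in>{0,1,2}. k j *\<^sub>R w j)"
      if w: "\<forall>j\<in>{0,1,2}. w j \<in> V j" for w
    proof -
      obtain a where a: "w 0 = a *\<^sub>R \<theta>" and w1: "?u \<bullet> fst (w 1) = 0" "snd (w 1) = 0" and w2: "fst (w 2) = 0" "?v \<bullet> snd (w 2) = 0"
        using w unfolding V_iff by blast
      have eq: "w 0 + (w 1 + w 2) = (- (a * ?s) *\<^sub>R ?u + fst (w 1), (a * ?c) *\<^sub>R ?v + snd (w 2))"
        using a w1 w2 by (simp add: prod_eq_iff \<theta>_def)
      show ?thesis
        unfolding split eq using tangent_curve[OF P w1(1) w2(2), of a, folded t_def] a w1 w2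
        by (simp add: prod_eq_iff \<theta>_def k_def)
    qed
    then show "frechet_derivative normal (at P within torus) (\<Sum>j\<in>{0,1,2}. w j) = (\<Sum>j\<in>{0,1,2}. k j *\<^sub>R w j)"
      if "\<forall>j\<in>{0,1,2}. w j \<in> V j" for w using that by blast
    show "tangent_space torus P = {\<Sum>j\<in>{0,1,2}. w j |w. \<forall>j\<in>{0,1,2}. w j \<in> V j}"
    proof (intro equalityI subsetI)
      fix z assume z: "z \<in> tangent_space torus P"
      have "normal P \<bullet> z = - (?c * (?u \<bullet> fst z) + ?s * (?v \<bullet> snd z))"
        by (simp add: normal_def inner_prod_def t_def)
      then have n: "?c * (?u \<bullet> fst z) + ?s * (?v \<bullet> snd z) = 0"
        using tangent_normal[OF P z] by simp
      \<comment> \<open>The component along \<open>\<theta>\<close>. Because \<open>z\<close> is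
        orthogonal to the normal, its radial part is exactly \<open>a *\<^sub>R \<theta>\<close>,
        and the rest is tangent to the two spheres.\<close>
      define a where "a = - ?s * (?u \<bullet> fst z) + ?c * (?v \<bullet> snd z)"
      have sc: "?s * ?s + ?c * ?c = 1" using sin_cos_squared_add[of "p t"] by (simp add: power2_eq_square)
      have a: "- (a * ?s) = ?u \<bullet> fst z" "a * ?c = ?v \<bullet> snd z"
        using n sc unfolding a_def by algebra+
      define w where "w j = (if j = 0 then a *\<^sub>R \<theta> else if j = 1 then (fst z + (a * ?s) *\<^sub>R ?u, 0) else (0, snd z - (a * ?c) *\<^sub>R ?v))" for j :: nat
      have "\<forall>j\<in>{0,1,2}. w j \<in> V j"
        unfolding V_iff using a by (auto simp: w_def inner_add_right inner_diff_right uu)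
      moreover have "z = (\<Sum>j\<in>{0,1,2}. w j)" unfolding split by (simp add: w_def \<theta>_def prod_eq_iff)
      ultimately show "z \<in> {\<Sum>j\<in>{0,1,2}. w j |w. \<forall>j\<in>{0,1,2}. w j \<in> V j}" by blast
    qed (use tan in blast)
  qed simp
  moreover have "dim (V 0) = 1"
    using \<theta> by (auto simp: V_def dim_span)
  moreover have "dim (V 1) = DIM('a) - 1"
    unfolding V_def using dim_Times[OF subspace_hyperplane[of ?u] subspace_single_0] dim_hyperplane[OF nz'(1)] by simp
  moreover have "dim (V 2) = DIM('b) - 1"
    unfolding V_def using dim_Times[OF subspace_single_0 subspace_hyperplane[of ?v]] dim_hyperplane[OF nz'(2)] by simp
  ultimately show ?thesis unfolding split by (simp add: k_def algebra_simps)
qed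

end

section \<open>Diffeomorphism with the product of spheres\<close>

lemma cos_sin_arctan_tan:
  assumes "0 < cos d"
  shows "cos (arctan (sin d / cos d)) = cos d" "sin (arctan (sin d / cos d)) = sin d"
proof -
  have "1 + (sin d / cos d)\<^sup>2 = (1 / cos d)\<^sup>2"
    using assms sin_cos_squared_add[of d] by (simp add: field_simps)
  then have "sqrt (1 + (sin d / cos d)\<^sup>2) = 1 / cos d" using assms by (simp add: real_sqrt_abs)
  then show "cos (arctan (sin d / cos d)) = cos d" "sin (arctan (sin d / cos d)) = sin d"
    using assms by (simp_all add: cos_arctan sin_arctan)
qed

lemma inner_sgn: "v \<bullet> sgn v = norm (v :: 'a::real_inner)"
  by (cases "v = 0") (simp_all add: sgn_div_norm power2_norm_eq_inner[symmetric] power2_eq_square)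

context profile_curve
begin

text \<open>The unit circle is run through with the period \<open>2 T\<close> of the profile, so
  that \<open>circ (time z)\<close> is insensitive to the choice made in
  \<open>time\<close>.\<close>

definition circ :: "real \<Rightarrow> real^2" where
  "circ t = cos (pi * t / T) *\<^sub>R axis 1 1 + sin (pi * t / T) *\<^sub>R axis 2 1"

definition circ' :: "real \<Rightarrow> real^2" where
  "circ' t = (- sin (pi * t / T)) *\<^sub>R axis 1 1 + cos (pi * t / T) *\<^sub>R axis 2 1"

definition ang :: "real^2 \<Rightarrow> real" where "ang w = (SOME t. circ t = w)"

lemma axis_inner: "(axis 1 1 :: real^2) \<bullet> axis 1 1 = 1" "(axis 2 1 :: real^2) \<bullet> axis 2 1 = 1"
  "(axis 1 1 :: real^2) \<bullet> axis 2 1 = 0" "(axis 2 1 :: real^2) \<bullet> axis 1 1 = 0"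
  by (simp_all add: inner_axis_axis)

lemma circ_inner:
  "circ s \<bullet> circ t = cos (pi * s / T - pi * t / T)" "circ s \<bullet> circ' t = sin (pi * s / T - pi * t / T)"
  by (simp_all add: circ_def circ'_def inner_add_left inner_add_right inner_diff_right axis_inner cos_diff sin_diff)

lemma norm_circ: "norm (circ t) = 1"
  by (simp add: norm_eq_sqrt_inner circ_inner)

lemma circ_eq_iff: "circ s = circ t \<longleftrightarrow> (\<exists>k::int. s = t + of_int k * (2 * T))"
proof -
  have "circ s = circ t \<longleftrightarrow> sin (pi * s / T) = sin (pi * t / T) \<and> cos (pi * s / T) = cos (pi * t / T)"
    by (auto simp: circ_def vec_eq_iff forall_2 axis_def)
  also have "\<dots> \<longleftrightarrow> (\<exists>k::int. pi * s / T = pi * t / T + 2 * pi * of_int k)" by (rule sin_cos_eq_iff)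
  also have "\<dots> \<longleftrightarrow> (\<exists>k::int. s = t + of_int k * (2 * T))"
  proof (rule ex_cong1)
    fix k :: int
    have "pi * s / T = pi * t / T + 2 * pi * of_int k \<longleftrightarrow> pi * s = pi * (t + of_int k * (2 * T))"
      using T by (simp add: field_simps)
    then show "(pi * s / T = pi * t / T + 2 * pi * of_int k) = (s = t + of_int k * (2 * T))" by simp
  qed
  finally show ?thesis .
qed

lemma circ_ang: "norm w = 1 \<Longrightarrow> circ (ang w) = w"
proof -
  assume "norm w = 1"
  then have "(w $ 1)\<^sup>2 + (w $ 2)\<^sup>2 = 1" by (simp add: norm_vec_def L2_set_def sum_2)
  then obtain a where a: "w $ 1 = cos a" "w $ 2 = sin a" using sincos_total_2pi by metis
  have "circ (a * T / pi) = w" using T a by (simp add: circ_def vec_eq_iff forall_2 axis_def)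
  then show ?thesis unfolding ang_def by (rule someI)
qed

lemma ang_circ: obtains k :: int where "ang (circ t) = t + of_int k * (2 * T)"
  using circ_ang[OF norm_circ, of t] unfolding circ_eq_iff by blast

text \<open>On the half plane around \<open>w0\<close> the arctangent of the quotient of the
  components along \<open>circ' t0\<close> and \<open>circ t0\<close> is a smooth branch of the
  angle.\<close>

lemma local_ang:
  assumes "norm w0 = 1"
  obtains U \<theta> where "open U" "w0 \<in> U" "smooth_on U \<theta>"
    "\<And>w. w \<in> U \<Longrightarrow> norm w = 1 \<Longrightarrow> \<exists>k::int. ang w = \<theta> w + of_int k * (2 * T)"
proof -
  define t0 where "t0 = ang w0"
  define U where "U = {w. 0 < w \<bullet> circ t0}"
  define \<theta> where "\<theta> w = t0 + T / pi * arctan ((w \<bullet> circ' t0) / (w \<bullet> circ t0))" for w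
  have U: "open U" unfolding U_def by (intro open_Collect_less continuous_intros)
  have "w0 \<bullet> w0 = 1" using assms by (simp add: power2_norm_eq_inner[symmetric])
  then have w0: "w0 \<in> U" using circ_ang[OF assms] by (simp add: U_def t0_def)
  have sm: "smooth_on U \<theta>" unfolding \<theta>_def[abs_def]
    by (intro smooth_on_add smooth_on_mult smooth_on_const smooth_on_arctan smooth_on_divide smooth_on_inner smooth_on_id U)
      (auto simp: U_def)
  have "\<exists>k::int. ang w = \<theta> w + of_int k * (2 * T)" if w: "w \<in> U" "norm w = 1" for w
  proof -
    define d where "d = pi * ang w / T - pi * t0 / T"
    have i: "w \<bullet> circ t0 = cos d" "w \<bullet> circ' t0 = sin d"
      using circ_inner[of "ang w" t0] by (simp_all add: circ_ang[OF w(2)] d_def)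
    then have "0 < cos d" using w(1) by (simp add: U_def)
    note c = cos_sin_arctan_tan[OF this]
    have t: "pi * \<theta> w / T = pi * t0 / T + arctan (sin d / cos d)"
      using T by (simp add: \<theta>_def i field_simps)
    have "cos (pi * \<theta> w / T) = cos (pi * t0 / T + d)" "sin (pi * \<theta> w / T) = sin (pi * t0 / T + d)"
      unfolding t cos_add sin_add c by simp_all
    then have "circ (\<theta> w) = circ (ang w)" by (simp add: circ_def d_def)
    then show ?thesis using circ_eq_iff[of "ang w" "\<theta> w"] by simp
  qed
  then show ?thesis using that[OF U w0 sm] by blast
qed

definition split_torus :: "'a::euclidean_space \<times> 'b::euclidean_space \<Rightarrow> 'a \<times> 'b \<times> (real^2)" where
  "split_torus z = (sgn (fst z), sgn (snd z), circ (time z))"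

definition join_torus :: "'a::euclidean_space \<times> 'b::euclidean_space \<times> (real^2) \<Rightarrow> 'a \<times> 'b" where
  "join_torus = (\<lambda>(u, v, w). (x (ang w) *\<^sub>R u, y (ang w) *\<^sub>R v))"

lemma smooth_circ: "smooth_on UNIV circ"
proof -
  have "smooth_on UNIV (\<lambda>t. pi / T * t)"
    by (intro smooth_on_mult smooth_on_const smooth_on_id open_UNIV)
  then show ?thesis unfolding circ_def[abs_def]
    by (intro smooth_on_add smooth_on_scaleR smooth_on_cos smooth_on_sin smooth_on_const open_UNIV) simp_all
qed

lemma smooth_split: "smooth_map_on (torus :: ('a::euclidean_space \<times> 'b::euclidean_space) set) split_torus"
proof (rule smooth_map_onI)
  fix P :: "'a \<times> 'b" assume P: "P \<in> torus"
  obtain U s where U: "open U" "P \<in> U" "smooth_on U s" "\<And>z. z \<in> U \<Longrightarrow> fst z \<noteq> 0 \<and> snd z \<noteq> 0"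
    and s: "\<And>z. z \<in> U \<Longrightarrow> z \<in> torus \<Longrightarrow> \<exists>k::int. time z = s z + of_int k * (2 * T)"
    using local_time[OF P] by metis
  let ?g = "\<lambda>z. (sgn (fst z), sgn (snd z), circ (s z))"
  have "smooth_on U (\<lambda>z. circ (s z))" by (rule smooth_on_compose[OF U(1) open_UNIV U(3) smooth_circ]) simp
  then have "smooth_on U ?g"
    by (intro smooth_on_Pair smooth_on_sgn smooth_on_fst smooth_on_snd smooth_on_id U(1)) (use U(4) in auto)
  moreover have "?g z = split_torus z" if "z \<in> U \<inter> torus" for z
    using s[of z] that by (simp add: split_torus_def circ_eq_iff[of "time z", symmetric])
  ultimately show "\<exists>U g. open U \<and> P \<in> U \<and> smooth_on U g \<and> (\<forall>z\<in>U \<inter> torus. g z = split_torus z)"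
    using U(1,2) by blast
qed

lemma smooth_join:
  "smooth_map_on (sphere (0::'a::euclidean_space) 1 \<times> sphere (0::'b::euclidean_space) 1 \<times> sphere (0::real^2) 1) join_torus"
  (is "smooth_map_on ?S _")
proof (rule smooth_map_onI)
  fix q :: "'a \<times> 'b \<times> (real^2)" assume q: "q \<in> ?S"
  then have "norm (snd (snd q)) = 1" by auto
  then obtain U \<theta> where U: "open U" "snd (snd q) \<in> U" "smooth_on U \<theta>"
    and \<theta>: "\<And>w. w \<in> U \<Longrightarrow> norm w = 1 \<Longrightarrow> \<exists>k::int. ang w = \<theta> w + of_int k * (2 * T)"
    using local_ang by metis
  define U' :: "('a \<times> 'b \<times> (real^2)) set" where "U' = (\<lambda>z. snd (snd z)) -` U"
  have U': "open U'" unfolding U'_def by (intro open_vimage U continuous_intros)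
  have "smooth_on U' (\<lambda>z. snd (snd z))" by (intro smooth_on_snd smooth_on_id U')
  then have sm: "smooth_on U' (\<lambda>z. \<theta> (snd (snd z)))"
    by (rule smooth_on_compose[OF U' U(1) _ U(3)]) (auto simp: U'_def)
  let ?g = "\<lambda>z. (x (\<theta> (snd (snd z))) *\<^sub>R fst z, y (\<theta> (snd (snd z))) *\<^sub>R fst (snd z))"
  have "smooth_on U' (\<lambda>z. x (\<theta> (snd (snd z))))" "smooth_on U' (\<lambda>z. y (\<theta> (snd (snd z))))"
    by (rule smooth_on_compose[OF U' open_UNIV sm], rule smooth, simp)+
  then have "smooth_on U' ?g"
    by (intro smooth_on_Pair smooth_on_scaleR smooth_on_fst smooth_on_snd smooth_on_id U')
  moreover have "?g z = join_torus z" if "z \<in> U' \<inter> ?S" for z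
  proof -
    have "snd (snd z) \<in> U" "norm (snd (snd z)) = 1" using that by (auto simp: U'_def)
    from \<theta>[OF this] show ?thesis by (auto simp: join_torus_def case_prod_beta periods)
  qed
  moreover have "q \<in> U'" using U(2) by (simp add: U'_def)
  ultimately show "\<exists>U g. open U \<and> q \<in> U \<and> smooth_on U g \<and> (\<forall>z\<in>U \<inter> ?S. g z = join_torus z)"
    using U' by blast
qed

text \<open>\<open>time\<close> and \<open>ang\<close> are only right up to multiples of
  \<open>2 T\<close>, but \<open>x\<close>, \<open>y\<close> and \<open>circ\<close> do not see
  this; hence the two maps are inverse to each other and smooth through local branches.\<close>

lemma diffeomorphic_torus:
  "diffeomorphic (torus :: ('a::euclidean_space \<times> 'b::euclidean_space) set)
     (sphere (0::'a) 1 \<times> sphere (0::'b) 1 \<times> sphere (0::real^2) 1)"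
  (is "diffeomorphic _ ?S")
proof -
  have "homeomorphism torus ?S split_torus join_torus"
  proof (rule homeomorphismI)
    show "continuous_on torus split_torus" "continuous_on ?S join_torus"
      using smooth_map_on_continuous smooth_split smooth_join by blast+
    show "split_torus ` torus \<subseteq> ?S"
    proof
      fix q assume "q \<in> split_torus ` (torus :: ('a \<times> 'b) set)"
      then obtain z :: "'a \<times> 'b" where z: "z \<in> torus" "q = split_torus z" by blast
      then show "q \<in> ?S" using torus_nonzero[OF z(1)] by (simp add: split_torus_def norm_sgn norm_circ)
    qed
    show "join_torus ` ?S \<subseteq> torus"
    proof
      fix z assume "z \<in> join_torus ` ?S"
      then obtain q where q: "q \<in> ?S" "z = join_torus q" by blast
      obtain u v w where "q = (u, v, w)" by (cases q) blast
      then have "norm u = 1" "norm v = 1" "z = (x (ang w) *\<^sub>R u, y (ang w) *\<^sub>R v)"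
        using q by (auto simp: join_torus_def)
      then show "z \<in> torus" using pos[of "ang w"] by (intro torusI[of _ "ang w"]) auto
    qed
    show "join_torus (split_torus z) = z" if z: "z \<in> torus" for z :: "'a \<times> 'b"
    proof -
      obtain k :: int where "ang (circ (time z)) = time z + of_int k * (2 * T)" using ang_circ[of "time z"] by blast
      then show ?thesis
        using time[OF z] pos[of "time z"] by (simp add: join_torus_def split_torus_def periods sgn_div_norm prod_eq_iff)
    qed
    show "split_torus (join_torus q) = q" if q: "q \<in> ?S" for q
    proof -
      obtain u v w where uvw: "q = (u, v, w)" "norm u = 1" "norm v = 1" "norm w = 1" using q by auto
      let ?z = "(x (ang w) *\<^sub>R u, y (ang w) *\<^sub>R v)"
      have n: "norm (fst ?z) = x (ang w)" "norm (snd ?z) = y (ang w)" using uvw pos[of "ang w"] by simp_all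
      obtain k :: int where "time ?z = ang w + of_int k * (2 * T)" using time_eq[OF n] by blast
      then have "circ (time ?z) = w" using circ_eq_iff[of "time ?z" "ang w"] circ_ang[OF uvw(4)] by auto
      moreover have "sgn (fst ?z) = u" "sgn (snd ?z) = v"
        unfolding sgn_div_norm n using pos[of "ang w"] by simp_all
      ultimately show ?thesis by (simp add: uvw(1) join_torus_def split_torus_def)
    qed
  qed
  then show ?thesis unfolding diffeomorphic_def diffeomorphism_def using smooth_split smooth_join by blast
qed

text \<open>The assumed formula for \<open>r\<close> cancels the rotational curvatures
  \<open>cos p / x\<close> and \<open>sin p / y\<close>; half the normal component of the position
  and the constant remain.\<close>

lemma lambda_hypersurface_torus:
  assumes "\<And>t. r t = (x t / 2 - real (DIM('a) - 1) / x t) * cos (p t) + (y t / 2 - real (DIM('b) - 1) / y t) * sin (p t) - c"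
  shows "lambda_hypersurface c (torus :: ('a::euclidean_space \<times> 'b::euclidean_space) set)"
  unfolding lambda_hypersurface_def
proof (intro conjI exI[of _ normal] ballI)
  fix P :: "'a \<times> 'b" assume P: "P \<in> torus"
  let ?t = "time P"
  have "P \<bullet> normal P = - (x ?t * cos (p ?t) + y ?t * sin (p ?t))"
    by (simp add: normal_def inner_prod_def inner_sgn time[OF P])
  then show "mean_curvature torus normal P = 1 / 2 * (P \<bullet> normal P) + c"
    unfolding mean_curvature_torus[OF P] assms by (simp add: algebra_simps)
qed (rule smooth_hypersurface_torus unit_normal_field_normal)+

end

text \<open>Bootstrapping: the right-hand sides are polynomials in \<open>x\<close>,
  \<open>y\<close>, \<open>sin p\<close> and \<open>cos p\<close>, so each order of
  differentiability yields the next.\<close>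

lemma (in profile) ode_smooth:
  assumes o: "\<And>t. ode x y p t"
  shows "smooth_on UNIV x" "smooth_on UNIV y" "smooth_on UNIV p"
proof -
  have "Ck_on k UNIV x \<and> Ck_on k UNIV y \<and> Ck_on k UNIV p" for k
  proof (induction k)
    case 0
    have "isCont x t" "isCont y t" "isCont p t" for t
      using x'[OF o[of t]] y'[OF o[of t]] p'[OF o[of t]] by (auto intro: DERIV_isCont)
    then show ?case by (simp add: continuous_at_imp_continuous_on)
  next
    case (Suc k)
    then have xyp: "Ck_on k UNIV x" "Ck_on k UNIV y" "Ck_on k UNIV p" by auto
    have s: "Ck_on k UNIV (\<lambda>t. sin (p t))" "Ck_on k UNIV (\<lambda>t. cos (p t))"
      by (rule Ck_on_compose[OF open_UNIV open_UNIV xyp(3)], rule smooth_onD, rule smooth_on_sin_cos_real, simp)+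
    note I = Ck_on_add[OF open_UNIV] Ck_on_bilinear[OF bounded_bilinear_mult open_UNIV] Ck_on_const[OF open_UNIV] xyp s
    have "Ck_on k UNIV (\<lambda>t. (- 1) * (x t * y t * sin (p t)))" by (intro I)
    then have "Ck_on (Suc k) UNIV x"
      by (intro Ck_on_real_SucI[where f' = "\<lambda>t. - (x t * y t * sin (p t))"])
        (use x'[OF o] in \<open>simp_all add: has_real_derivative_iff_has_vector_derivative\<close>)
    moreover have "Ck_on k UNIV (\<lambda>t. x t * y t * cos (p t))" by (intro I)
    then have "Ck_on (Suc k) UNIV y"
      by (intro Ck_on_real_SucI[where f' = "\<lambda>t. x t * y t * cos (p t)"])
        (use y'[OF o] in \<open>simp_all add: has_real_derivative_iff_has_vector_derivative\<close>)
    moreover have "Ck_on k UNIV (\<lambda>t. c * x t * y t + (x t * x t * (1 / 2) + - n) * y t * cos (p t)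
        + (y t * y t * (1 / 2) + - n) * x t * sin (p t))" by (intro I)
    then have "Ck_on k UNIV (\<lambda>t. K (x t) (y t) (p t))" by (simp add: K_def power2_eq_square)
    then have "Ck_on (Suc k) UNIV p"
      by (intro Ck_on_real_SucI[where f' = "\<lambda>t. K (x t) (y t) (p t)"])
        (use p'[OF o] in \<open>simp_all add: has_real_derivative_iff_has_vector_derivative\<close>)
    ultimately show ?case by blast
  qed
  then show "smooth_on UNIV x" "smooth_on UNIV y" "smooth_on UNIV p" by (auto simp: smooth_on_def)
qed

theorem theorem1:
  fixes n :: nat and c :: real
  assumes "CARD('n::finite) = n + 1"
    and "n > 1"
    and "c < 0"
  shows "\<exists>S :: ((real^'n) \<times> (real^'n)) set.
           compact S \<and> lambda_hypersurface c S \<and>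
           diffeomorphic S
             (sphere (0 :: real^'n) 1 \<times> sphere (0 :: real^'n) 1 \<times> sphere (0 :: real^2) 1) \<and>
           bi_orthogonal_invariant S"
proof -
  \<comment> \<open>The profile equation is written for the reversed normal, which changes the sign
    of the constant and makes it positive.\<close>
  interpret profile n "- c" by unfold_locales (use assms in auto)
  obtain x y p T where T: "T > 0" and o: "\<And>t. ode x y p t" and pos: "\<And>t. 0 < x t" "\<And>t. 0 < y t"
    and per: "\<And>t. x (t + 2 * T) = x t" "\<And>t. y (t + 2 * T) = y t" "\<And>t. p (t + 2 * T) = p t + 2 * pi"
    and inj: "\<And>s t. x s = x t \<Longrightarrow> y s = y t \<Longrightarrow> \<exists>k::int. s = t + of_int k * (2 * T)"
    using closed_profile by metis
  \<comment> \<open>Dividing \<open>K\<close> by the speed \<open>x y\<close> recovers the curvature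
    with respect to arc length, singular terms included.\<close>
  define r where "r t = (x t / 2 - real n / x t) * cos (p t) + (y t / 2 - real n / y t) * sin (p t) - c" for t
  have K: "K (x t) (y t) (p t) = x t * y t * r t" for t
    using pos[of t] by (simp add: K_def r_def field_simps power2_eq_square)
  interpret C: profile_curve x y p r T
    by unfold_locales (use T x'[OF o] y'[OF o] p'[OF o] K ode_smooth[OF o] pos per inj in auto)
  have "DIM(real^'n) - 1 = n" using assms(1) by simp
  then have "lambda_hypersurface c (C.torus :: ((real^'n) \<times> (real^'n)) set)"
    by (intro C.lambda_hypersurface_torus) (simp add: r_def)
  then show ?thesis
    using C.compact_torus C.diffeomorphic_torus C.bi_orthogonal_torus by blast
qed

end
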